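(* Let $\mathcal{F}$ be a Lie $\mathfrak{g}$-foliation with dense leaves on a manifold $M$, defined by a non-singular Maurer-Cartan form $\omega\in\Omega^1(M,\mathfrak{g})$. Let $\mathfrak{h}\subset\mathfrak{g}$ be an ideal and let $\overline{\omega}\in\Omega^1(M,\mathfrak{g}/\mathfrak{h})$ be the composition of $\omega$ with the projection $\mathfrak{g}\to\mathfrak{g}/\mathfrak{h}$. Then $\overline{\omega}$ defines a Lie $\mathfrak{g}/\mathfrak{h}$-foliation $\overline{\mathcal{F}}$ on $M$, which also has dense leaves. If $\mathcal{F}$ is infinitesimally rigid and $\mathfrak{h}$ is perfect (i.e. $[\mathfrak{h},\mathfrak{h}]=\mathfrak{h}$), then $\overline{\mathcal{F}}$ is also infinitesimally rigid.
   Context: Lie foliations. Let $M$ be a (smooth) manifold and $\mathfrak{g}$ a finite-dimensional real Lie algebra. A Maurer-Cartan form with values in $\mathfrak{g}$ is $\omega\in\Omega^1(M,\mathfrak{g})$ satisfying $d\omega+\frac12[\omega,\omega]=0$, where $[\omega,\omega](X,Y)=2[\omega(X),\omega(Y)]$. If moreover $\omega$ is non-singular, i.e. $\omega_x:T_xM\to\mathfrak{g}$ is surjective for all $x\in M$, then $\ker\omega$ integrates to a foliation $\mathcal{F}$ (with $T\mathcal{F}=\ker\omega$), called the Lie $\mathfrak{g}$-foliation defined by $\omega$. It has dense leaves if each leaf is dense in $M$. Infinitesimal rigidity. For a foliation $\mathcal{F}$ on $M$ with normal bundle $N\mathcal{F}=TM/T\mathcal{F}$, the Bott connection is the flat $T\mathcal{F}$-connection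 $\nabla_X\overline{Y}=\overline{[X,Y]}$ for $X\in\Gamma(T\mathcal{F})$ and $\overline{Y}\in\Gamma(N\mathcal{F})$ the class of the vector field $Y$. It induces, by the usual Koszul formula, a differential $d_\nabla$ on $\Omega^\bullet(\mathcal{F},N\mathcal{F})=\Gamma(\wedge^\bullet T^*\mathcal{F}\otimes N\mathcal{F})$, with cohomology $H^\bullet(\mathcal{F},N\mathcal{F})$. The foliation $\mathcal{F}$ is called infinitesimally rigid if $H^1(\mathcal{F},N\mathcal{F})=0$. *)

theory Defs
  imports "HOL-Analysis.Analysis"
begin

section \<open>Smooth maps between normed spaces\<close>

fun diff_times_on :: "nat \<Rightarrow> 'a::real_normed_vector set \<Rightarrow> ('a \<Rightarrow> 'b::real_normed_vector) \<Rightarrow> bool" where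
  "diff_times_on 0 S f \<longleftrightarrow> continuous_on S f"
| "diff_times_on (Suc n) S f \<longleftrightarrow>
     (\<forall>x\<in>S. f differentiable (at x)) \<and>
     (\<forall>v. diff_times_on n S (\<lambda>x. frechet_derivative f (at x) v))"

text \<open>Only used for open \<open>S\<close>. All iterated directional derivatives exist and are continuous,
  i.e. \<open>f\<close> is of class C-infinity when the domain is finite-dimensional.\<close>

definition smooth_on :: "'a::real_normed_vector set \<Rightarrow> ('a \<Rightarrow> 'b::real_normed_vector) \<Rightarrow> bool" where
  "smooth_on S f \<longleftrightarrow> (\<forall>n. diff_times_on n S f)"


section \<open>Manifolds\<close>

text \<open>A chart is a domain together with a coordinate map; the values of the map outside the
  domain are irrelevant.\<close>

type_synonym ('m, 'e) chart = "'m set \<times> ('m \<Rightarrow> 'e)"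

abbreviation cdom :: "('m, 'e) chart \<Rightarrow> 'm set" where "cdom \<equiv> fst"
abbreviation cmap :: "('m, 'e) chart \<Rightarrow> 'm \<Rightarrow> 'e" where "cmap \<equiv> snd"

definition cimg :: "('m, 'e) chart \<Rightarrow> 'e set" where
  "cimg c = cmap c ` cdom c"

definition cinv :: "('m, 'e) chart \<Rightarrow> 'e \<Rightarrow> 'm" where
  "cinv c = inv_into (cdom c) (cmap c)"

definition is_chart :: "('m::topological_space, 'e::euclidean_space) chart \<Rightarrow> bool" where
  "is_chart c \<longleftrightarrow> open (cdom c) \<and> open (cimg c) \<and>
     homeomorphism (cdom c) (cimg c) (cmap c) (cinv c)"

definition compatible :: "('m, 'e::euclidean_space) chart \<Rightarrow> ('m, 'e) chart \<Rightarrow> bool" where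
  "compatible c d \<longleftrightarrow>
     smooth_on (cmap c ` (cdom c \<inter> cdom d)) (cmap d \<circ> cinv c) \<and>
     smooth_on (cmap d ` (cdom c \<inter> cdom d)) (cmap c \<circ> cinv d)"

text \<open>The underlying set of the manifold is the whole type \<open>'m\<close>; it is Hausdorff and second
  countable, but not assumed connected. The smooth structure is given by an atlas indexed by
  the points: \<open>M p\<close> is a preferred chart around \<open>p\<close>. Every smooth atlas gives
  such a family by choosing for each point a chart that contains it.\<close>

definition smooth_manifold ::
  "('m::{t2_space,second_countable_topology} \<Rightarrow> ('m, 'e::euclidean_space) chart) \<Rightarrow> bool" where
  "smooth_manifold M \<longleftrightarrow>
     (\<forall>p. p \<in> cdom (M p) \<and> is_chart (M p)) \<and> (\<forall>p q. compatible (M p) (M q))"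

text \<open>The charts of the maximal smooth atlas.\<close>

definition smooth_chart ::
  "('m::topological_space \<Rightarrow> ('m, 'e::euclidean_space) chart) \<Rightarrow> ('m, 'e) chart \<Rightarrow> bool" where
  "smooth_chart M c \<longleftrightarrow> is_chart c \<and> (\<forall>p. compatible (M p) c)"


section \<open>Tangent vectors, vector fields and one-forms\<close>

text \<open>The tangent space at \<open>p\<close> is the model space \<open>'e\<close>: a vector is identified with its
  coordinates in the preferred chart \<open>M p\<close>. Thus vector fields have type \<open>'m \<Rightarrow> 'e\<close>,
  and one-forms with values in \<open>'g\<close> have type \<open>'m \<Rightarrow> 'e \<Rightarrow> 'g\<close>. Since the
  preferred chart varies with the point, smoothness and derivatives of such objects are
  always expressed through their representation in one fixed chart.\<close>

text \<open>The differential at \<open>p\<close> of a map \<open>f\<close> defined near \<open>p\<close>, applied to a tangent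
  vector \<open>v\<close> at \<open>p\<close>.\<close>

definition mdiff ::
  "('m \<Rightarrow> ('m, 'e::euclidean_space) chart) \<Rightarrow> ('m \<Rightarrow> 'b::real_normed_vector) \<Rightarrow> 'm \<Rightarrow> 'e \<Rightarrow> 'b" where
  "mdiff M f p v = frechet_derivative (f \<circ> cinv (M p)) (at (cmap (M p) p)) v"

definition vf_rep ::
  "('m \<Rightarrow> ('m, 'e::euclidean_space) chart) \<Rightarrow> 'm \<Rightarrow> ('m \<Rightarrow> 'e) \<Rightarrow> 'e \<Rightarrow> 'e" where
  "vf_rep M q X y = (let p = cinv (M q) y in mdiff M (cmap (M q)) p (X p))"

definition smooth_vf ::
  "('m \<Rightarrow> ('m, 'e::euclidean_space) chart) \<Rightarrow> ('m \<Rightarrow> 'e) \<Rightarrow> bool" where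
  "smooth_vf M X \<longleftrightarrow> (\<forall>q. smooth_on (cimg (M q)) (vf_rep M q X))"

text \<open>The bracket with \<open>[X,Y] f = X (Y f) - Y (X f)\<close>, computed in the preferred chart at \<open>p\<close>,
  which is also the chart in which tangent vectors at \<open>p\<close> are read.\<close>

definition vf_bracket ::
  "('m \<Rightarrow> ('m, 'e::euclidean_space) chart) \<Rightarrow> ('m \<Rightarrow> 'e) \<Rightarrow> ('m \<Rightarrow> 'e) \<Rightarrow> 'm \<Rightarrow> 'e" where
  "vf_bracket M X Y p =
     frechet_derivative (vf_rep M p Y) (at (cmap (M p) p)) (X p) -
     frechet_derivative (vf_rep M p X) (at (cmap (M p) p)) (Y p)"

text \<open>The vector at \<open>p\<close> with constant coordinates \<open>v\<close> in the chart \<open>M q\<close>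
  (for \<open>p\<close> in its domain).\<close>

definition coord_vec ::
  "('m \<Rightarrow> ('m, 'e::euclidean_space) chart) \<Rightarrow> 'm \<Rightarrow> 'e \<Rightarrow> 'm \<Rightarrow> 'e" where
  "coord_vec M q v p = frechet_derivative (cmap (M p) \<circ> cinv (M q)) (at (cmap (M q) p)) v"

text \<open>Smoothness of a form means smoothness of its coefficients in the charts of the atlas.\<close>

definition smooth_one_form ::
  "('m \<Rightarrow> ('m, 'e::euclidean_space) chart) \<Rightarrow> ('m \<Rightarrow> 'e \<Rightarrow> 'g::real_normed_vector) \<Rightarrow> bool" where
  "smooth_one_form M \<omega> \<longleftrightarrow>
     (\<forall>p. linear (\<omega> p)) \<and>
     (\<forall>q v. smooth_on (cimg (M q)) (\<lambda>y. let p = cinv (M q) y in \<omega> p (coord_vec M q v p)))"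

definition ext_deriv ::
  "('m \<Rightarrow> ('m, 'e::euclidean_space) chart) \<Rightarrow> ('m \<Rightarrow> 'e \<Rightarrow> 'g::real_normed_vector) \<Rightarrow>
   ('m \<Rightarrow> 'e) \<Rightarrow> ('m \<Rightarrow> 'e) \<Rightarrow> 'm \<Rightarrow> 'g" where
  "ext_deriv M \<omega> X Y p =
     mdiff M (\<lambda>x. \<omega> x (Y x)) p (X p) - mdiff M (\<lambda>x. \<omega> x (X x)) p (Y p) - \<omega> p (vf_bracket M X Y p)"


section \<open>Lie algebras\<close>

text \<open>A finite-dimensional real Lie algebra is a bracket on a finite-dimensional real vector
  space \<open>'g\<close>. The class \<open>real_inner\<close> is used instead of \<open>euclidean_space\<close> so that the
  zero Lie algebra is included; the inner product serves only to provide the (unique) vector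
  space topology, and no compatibility with the bracket is required.\<close>

definition lie_algebra :: "('g::real_inner \<Rightarrow> 'g \<Rightarrow> 'g) \<Rightarrow> bool" where
  "lie_algebra br \<longleftrightarrow>
     (\<exists>B::'g set. finite B \<and> span B = UNIV) \<and>
     bilinear br \<and> (\<forall>x. br x x = 0) \<and>
     (\<forall>x y z. br x (br y z) + br y (br z x) + br z (br x y) = 0)"

definition lie_ideal :: "('g::real_inner \<Rightarrow> 'g \<Rightarrow> 'g) \<Rightarrow> 'g set \<Rightarrow> bool" where
  "lie_ideal br \<hh> \<longleftrightarrow> subspace \<hh> \<and> (\<forall>x. \<forall>y\<in>\<hh>. br x y \<in> \<hh>)"

definition lie_perfect :: "('g::real_inner \<Rightarrow> 'g \<Rightarrow> 'g) \<Rightarrow> 'g set \<Rightarrow> bool" where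
  "lie_perfect br \<hh> \<longleftrightarrow> span {br x y | x y. x \<in> \<hh> \<and> y \<in> \<hh>} = \<hh>"

text \<open>The quotient of \<open>'g\<close> by \<open>\<hh>\<close> with its induced bracket, and the projection onto it. As a
  quotient by a variable subspace is not a type, \<open>'q\<close> is any vector space with a surjective
  bracket-preserving linear map \<open>\<pi>\<close> whose kernel is \<open>\<hh>\<close>; this determines \<open>'q\<close>,
  its bracket and \<open>\<pi>\<close> up to unique isomorphism.\<close>

definition lie_quotient ::
  "('g::real_inner \<Rightarrow> 'g \<Rightarrow> 'g) \<Rightarrow> 'g set \<Rightarrow> ('q::real_inner \<Rightarrow> 'q \<Rightarrow> 'q) \<Rightarrow> ('g \<Rightarrow> 'q) \<Rightarrow> bool" where
  "lie_quotient br \<hh> brq \<pi> \<longleftrightarrow>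
     linear \<pi> \<and> surj \<pi> \<and> {x. \<pi> x = 0} = \<hh> \<and> (\<forall>x y. \<pi> (br x y) = brq (\<pi> x) (\<pi> y))"

definition form_bracket ::
  "('g::real_inner \<Rightarrow> 'g \<Rightarrow> 'g) \<Rightarrow> ('m \<Rightarrow> 'e \<Rightarrow> 'g) \<Rightarrow> ('m \<Rightarrow> 'e) \<Rightarrow> ('m \<Rightarrow> 'e) \<Rightarrow> 'm \<Rightarrow> 'g" where
  "form_bracket br \<omega> X Y p = 2 *\<^sub>R br (\<omega> p (X p)) (\<omega> p (Y p))"

definition maurer_cartan ::
  "('m \<Rightarrow> ('m, 'e::euclidean_space) chart) \<Rightarrow> ('g::real_inner \<Rightarrow> 'g \<Rightarrow> 'g) \<Rightarrow> ('m \<Rightarrow> 'e \<Rightarrow> 'g) \<Rightarrow> bool" where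
  "maurer_cartan M br \<omega> \<longleftrightarrow>
     smooth_one_form M \<omega> \<and>
     (\<forall>X Y p. smooth_vf M X \<longrightarrow> smooth_vf M Y \<longrightarrow>
        ext_deriv M \<omega> X Y p + (1/2) *\<^sub>R form_bracket br \<omega> X Y p = 0)"

definition nonsingular_form :: "('m \<Rightarrow> 'e \<Rightarrow> 'g) \<Rightarrow> bool" where
  "nonsingular_form \<omega> \<longleftrightarrow> (\<forall>p. surj (\<omega> p))"


section \<open>Foliations\<close>

text \<open>A foliation is given by a linear subspace \<open>W\<close> of the model space (the direction of the
  leaves) and an atlas of foliated charts. Choosing a complement of \<open>W\<close> splits the model space
  as a product of coordinates \<open>(a, b)\<close> with \<open>a\<close> in \<open>W\<close> and \<open>b\<close> transverse; two points have
  the same transverse coordinate iff their difference lies in \<open>W\<close>. Hence the last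
  condition says that the changes of charts are locally of the form \<open>(a, b) \<mapsto> (g(a, b), h(b))\<close>.\<close>

type_synonym ('m, 'e) foliation = "'e set \<times> ('m, 'e) chart set"

abbreviation fol_dir :: "('m, 'e) foliation \<Rightarrow> 'e set" where "fol_dir \<equiv> fst"
abbreviation fol_atlas :: "('m, 'e) foliation \<Rightarrow> ('m, 'e) chart set" where "fol_atlas \<equiv> snd"

definition foliation ::
  "('m::topological_space \<Rightarrow> ('m, 'e::euclidean_space) chart) \<Rightarrow> ('m, 'e) foliation \<Rightarrow> bool" where
  "foliation M F \<longleftrightarrow>
     subspace (fol_dir F) \<and>
     (\<forall>c\<in>fol_atlas F. smooth_chart M c) \<and>
     (\<Union>c\<in>fol_atlas F. cdom c) = UNIV \<and>
     (\<forall>c\<in>fol_atlas F. \<forall>d\<in>fol_atlas F. \<forall>p\<in>cdom c \<inter> cdom d.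
        \<exists>U. open U \<and> p \<in> U \<and> U \<subseteq> cdom c \<inter> cdom d \<and>
          (\<forall>x\<in>U. \<forall>y\<in>U. cmap c x - cmap c y \<in> fol_dir F \<longrightarrow> cmap d x - cmap d y \<in> fol_dir F))"

definition fol_tangent ::
  "('m \<Rightarrow> ('m, 'e::euclidean_space) chart) \<Rightarrow> ('m, 'e) foliation \<Rightarrow> 'm \<Rightarrow> 'e set" where
  "fol_tangent M F p = {v. \<exists>c\<in>fol_atlas F. p \<in> cdom c \<and> mdiff M (cmap c) p v \<in> fol_dir F}"

definition plaque ::
  "('m, 'e::euclidean_space) foliation \<Rightarrow> ('m::topological_space, 'e) chart \<Rightarrow> 'm \<Rightarrow> 'm set" where
  "plaque F c x = connected_component_set {y \<in> cdom c. cmap c y - cmap c x \<in> fol_dir F} x"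

text \<open>Leaves are the classes of the equivalence relation of being joined by a finite chain of
  plaques.\<close>

definition leaf ::
  "('m::topological_space, 'e::euclidean_space) foliation \<Rightarrow> 'm \<Rightarrow> 'm set" where
  "leaf F x = {y. (\<lambda>u v. \<exists>c\<in>fol_atlas F. u \<in> cdom c \<and> v \<in> plaque F c u)\<^sup>*\<^sup>* x y}"

definition dense_leaves :: "('m::topological_space, 'e::euclidean_space) foliation \<Rightarrow> bool" where
  "dense_leaves F \<longleftrightarrow> (\<forall>x. closure (leaf F x) = UNIV)"

definition lie_foliation ::
  "('m::topological_space \<Rightarrow> ('m, 'e::euclidean_space) chart) \<Rightarrow> ('g::real_inner \<Rightarrow> 'g \<Rightarrow> 'g) \<Rightarrow>
   ('m \<Rightarrow> 'e \<Rightarrow> 'g) \<Rightarrow> ('m, 'e) foliation \<Rightarrow> bool" where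
  "lie_foliation M br \<omega> F \<longleftrightarrow>
     lie_algebra br \<and> maurer_cartan M br \<omega> \<and> nonsingular_form \<omega> \<and>
     foliation M F \<and> (\<forall>p. fol_tangent M F p = {v. \<omega> p v = 0})"


section \<open>Infinitesimal rigidity\<close>

definition tangent_vf ::
  "('m \<Rightarrow> ('m, 'e::euclidean_space) chart) \<Rightarrow> ('m, 'e) foliation \<Rightarrow> ('m \<Rightarrow> 'e) \<Rightarrow> bool" where
  "tangent_vf M F X \<longleftrightarrow> smooth_vf M X \<and> (\<forall>p. X p \<in> fol_tangent M F p)"

text \<open>The fibre of the normal bundle at \<open>p\<close> consists of the cosets of the tangent space of the
  foliation at \<open>p\<close>; its zero element is \<open>fol_tangent M F p\<close> itself.\<close>

definition normal_class ::
  "('m \<Rightarrow> ('m, 'e::euclidean_space) chart) \<Rightarrow> ('m, 'e) foliation \<Rightarrow> 'm \<Rightarrow> 'e \<Rightarrow> 'e set" where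
  "normal_class M F p v = {w. w - v \<in> fol_tangent M F p}"

definition coset_diff :: "'e::ab_group_add set \<Rightarrow> 'e set \<Rightarrow> 'e set" where
  "coset_diff A B = {a - b | a b. a \<in> A \<and> b \<in> B}"

text \<open>\<open>Y\<close> represents the section \<open>s\<close> of the normal bundle near \<open>p\<close>.\<close>

definition represents_at ::
  "('m::topological_space \<Rightarrow> ('m, 'e::euclidean_space) chart) \<Rightarrow> ('m, 'e) foliation \<Rightarrow>
   ('m \<Rightarrow> 'e set) \<Rightarrow> 'm \<Rightarrow> ('m \<Rightarrow> 'e) \<Rightarrow> bool" where
  "represents_at M F s p Y \<longleftrightarrow>
     smooth_vf M Y \<and> (\<forall>\<^sub>F x in nhds p. s x = normal_class M F x (Y x))"

text \<open>Smooth sections of the normal bundle: smoothness is local, and means being the class of a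
  smooth vector field near each point.\<close>

definition normal_section ::
  "('m::topological_space \<Rightarrow> ('m, 'e::euclidean_space) chart) \<Rightarrow> ('m, 'e) foliation \<Rightarrow>
   ('m \<Rightarrow> 'e set) \<Rightarrow> bool" where
  "normal_section M F s \<longleftrightarrow> (\<forall>p. \<exists>Y. represents_at M F s p Y)"

text \<open>The Bott connection \<open>\<nabla>\<^sub>X s\<close>, evaluated at \<open>p\<close>: the class of \<open>[X, Y]\<close> at \<open>p\<close> for a vector
  field \<open>Y\<close> representing \<open>s\<close> near \<open>p\<close>. For \<open>X\<close> tangent to the foliation the class
  does not depend on the choice of \<open>Y\<close>.\<close>

definition bott ::
  "('m::topological_space \<Rightarrow> ('m, 'e::euclidean_space) chart) \<Rightarrow> ('m, 'e) foliation \<Rightarrow>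
   ('m \<Rightarrow> 'e) \<Rightarrow> ('m \<Rightarrow> 'e set) \<Rightarrow> 'm \<Rightarrow> 'e set" where
  "bott M F X s p = normal_class M F p (vf_bracket M X (SOME Y. represents_at M F s p Y) p)"

text \<open>Leafwise one-forms with values in the normal bundle. Only the values of \<open>\<alpha> p\<close> on vectors
  tangent to the foliation matter. The second clause is linearity of \<open>\<alpha> p\<close> as a map into the
  quotient space: the combination \<open>k a + b\<close> of representatives represents
  \<open>\<alpha> p (k u + v)\<close>.\<close>

definition leafwise_one_form ::
  "('m::topological_space \<Rightarrow> ('m, 'e::euclidean_space) chart) \<Rightarrow> ('m, 'e) foliation \<Rightarrow>
   ('m \<Rightarrow> 'e \<Rightarrow> 'e set) \<Rightarrow> bool" where
  "leafwise_one_form M F \<alpha> \<longleftrightarrow>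
     (\<forall>p. \<forall>v\<in>fol_tangent M F p. \<alpha> p v \<in> range (normal_class M F p)) \<and>
     (\<forall>p. \<forall>u\<in>fol_tangent M F p. \<forall>v\<in>fol_tangent M F p. \<forall>k.
        \<forall>a\<in>\<alpha> p u. \<forall>b\<in>\<alpha> p v. k *\<^sub>R a + b \<in> \<alpha> p (k *\<^sub>R u + v)) \<and>
     (\<forall>X. tangent_vf M F X \<longrightarrow> normal_section M F (\<lambda>p. \<alpha> p (X p)))"

text \<open>The differential induced by the Bott connection, on one-forms (Koszul formula).\<close>

definition d_bott ::
  "('m::topological_space \<Rightarrow> ('m, 'e::euclidean_space) chart) \<Rightarrow> ('m, 'e) foliation \<Rightarrow>
   ('m \<Rightarrow> 'e \<Rightarrow> 'e set) \<Rightarrow> ('m \<Rightarrow> 'e) \<Rightarrow> ('m \<Rightarrow> 'e) \<Rightarrow> 'm \<Rightarrow> 'e set" where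
  "d_bott M F \<alpha> X Y p =
     coset_diff
       (coset_diff (bott M F X (\<lambda>x. \<alpha> x (Y x)) p) (bott M F Y (\<lambda>x. \<alpha> x (X x)) p))
       (\<alpha> p (vf_bracket M X Y p))"

definition closed_one_form ::
  "('m::topological_space \<Rightarrow> ('m, 'e::euclidean_space) chart) \<Rightarrow> ('m, 'e) foliation \<Rightarrow>
   ('m \<Rightarrow> 'e \<Rightarrow> 'e set) \<Rightarrow> bool" where
  "closed_one_form M F \<alpha> \<longleftrightarrow>
     (\<forall>X Y p. tangent_vf M F X \<longrightarrow> tangent_vf M F Y \<longrightarrow> d_bott M F \<alpha> X Y p = normal_class M F p 0)"

definition exact_one_form ::
  "('m::topological_space \<Rightarrow> ('m, 'e::euclidean_space) chart) \<Rightarrow> ('m, 'e) foliation \<Rightarrow>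
   ('m \<Rightarrow> 'e \<Rightarrow> 'e set) \<Rightarrow> bool" where
  "exact_one_form M F \<alpha> \<longleftrightarrow>
     (\<exists>s. normal_section M F s \<and> (\<forall>X p. tangent_vf M F X \<longrightarrow> \<alpha> p (X p) = bott M F X s p))"

definition infinitesimally_rigid ::
  "('m::topological_space \<Rightarrow> ('m, 'e::euclidean_space) chart) \<Rightarrow> ('m, 'e) foliation \<Rightarrow> bool" where
  "infinitesimally_rigid M F \<longleftrightarrow>
     (\<forall>\<alpha>. leafwise_one_form M F \<alpha> \<and> closed_one_form M F \<alpha> \<longrightarrow> exact_one_form M F \<alpha>)"

end

theory Submission
  imports Defs
begin

text \<open>The quotient foliation comes from the Frobenius theorem, whose charts are obtained by solving an ordinary
  differential equation that depends smoothly on parameters. Its leaves contain the leaves of \<open>F\<close>, hence are dense.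

  For rigidity, the Maurer-Cartan form trivialises the normal bundle together with its Bott connection, so the cohomology
  in question is leafwise cohomology with values in a fixed vector space. Let \<open>a\<close> be a closed form on \<open>F'\<close> with values in
  \<open>\<gg>/\<hh>\<close>. Rigidity of \<open>F\<close> gives a function \<open>f\<close> with \<open>a = df\<close> along \<open>F\<close>. The closed form \<open>a - df\<close> vanishes along \<open>F\<close>
  and amounts to a function from the manifold to the linear maps on \<open>\<hh>\<close>. Closedness makes this function constant along
  the dense leaves of \<open>F\<close>, hence constant, and its value kills \<open>[\<hh>, \<hh>] = \<hh>\<close>.\<close>

section \<open>Smooth maps between normed spaces\<close>

text \<open>The trivialisation is one consequence of the Maurer-Cartan equation: for
  \<open>X\<close> tangent to \<open>F\<close>, the value of \<omega> on [X, Y] is the derivative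
  along \<open>X\<close> of the function \<omega>(Y). So \<omega> carries the Bott connection to
  plain differentiation of functions with values in \<gg>. Rigidity of \<open>F\<close> then speaks
  of forms with values in \<gg>, whereas \<open>a\<close> has values in \<gg>/\<hh>; a linear
  section of the projection lifts \<open>a\<close>. The form \<open>a - df\<close> sees a vector
  only through its image in \<hh> under \<omega>. It is tested on fields where \<omega> is locally
  constant: the bracket of such a field with one tangent to \<open>F\<close> is again tangent to
  \<open>F\<close>, and two of them, with values y and y', have a bracket with value [y, y']. Two
  features of the definitions shape the rest. Smoothness is tested along fixed directions, so moving
  arguments are expanded in a basis. A foliation is an atlas with one direction subspace for all
  charts, so the charts found by Frobenius at different points must be brought to a common
  direction.\<close>

lemma diff_times_on_cong:
  assumes "open S" "\<And>x. x \<in> S \<Longrightarrow> f x = g x" "diff_times_on n S f"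
  shows "diff_times_on n S g"
  using assms(2,3)
proof (induction n arbitrary: f g)
  case 0
  then show ?case by (simp cong: continuous_on_cong)
next
  case (Suc n)
  have d: "(g has_derivative frechet_derivative f (at x)) (at x)" if "x \<in> S" for x
    by (rule has_derivative_transform_within_open[of f, OF _ assms(1) that])
      (use Suc.prems that in \<open>auto simp: frechet_derivative_works\<close>)
  have "diff_times_on n S (\<lambda>x. frechet_derivative g (at x) v)" for v
    by (rule Suc.IH[of "\<lambda>x. frechet_derivative f (at x) v"])
      (use Suc.prems frechet_derivative_at[OF d] in auto)
  then show ?case using d by (auto simp: differentiable_def)
qed

text \<open>The definition speaks of \<open>frechet_derivative\<close>; this form accepts any
  explicit derivative. Each closure property below is then an induction on the order that quotes the
  matching differentiation rule.\<close>

lemma diff_times_on_SucI: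
  assumes "open S" "\<And>x. x \<in> S \<Longrightarrow> (f has_derivative f' x) (at x)"
    and "\<And>v. diff_times_on n S (\<lambda>x. f' x v)"
  shows "diff_times_on (Suc n) S f"
proof -
  have "diff_times_on n S (\<lambda>x. frechet_derivative f (at x) v)" for v
    by (rule diff_times_on_cong[OF assms(1) _ assms(3)[of v]])
      (use frechet_derivative_at[OF assms(2)] in auto)
  then show ?thesis using assms(2) by (auto simp: differentiable_def)
qed

lemma diff_times_on_has_derivative:
  "diff_times_on (Suc n) S f \<Longrightarrow> x \<in> S \<Longrightarrow> (f has_derivative frechet_derivative f (at x)) (at x)"
  by (simp add: frechet_derivative_works)

lemma diff_times_on_SucD: "diff_times_on (Suc n) S f \<Longrightarrow> diff_times_on n S f"
proof (induction n arbitrary: f)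
  case 0
  then show ?case
    by (auto intro!: continuous_at_imp_continuous_on differentiable_imp_continuous_within)
qed auto

lemma diff_times_on_le: "m \<le> n \<Longrightarrow> diff_times_on n S f \<Longrightarrow> diff_times_on m S f"
  by (induction n rule: dec_induct) (blast dest: diff_times_on_SucD)+

lemma diff_times_on_subset: "T \<subseteq> S \<Longrightarrow> diff_times_on n S f \<Longrightarrow> diff_times_on n T f"
  by (induction n arbitrary: f) (auto intro: continuous_on_subset)

lemma diff_times_on_UN: "(\<And>i. i \<in> I \<Longrightarrow> open (U i)) \<Longrightarrow> (\<And>i. i \<in> I \<Longrightarrow> diff_times_on n (U i) f)
    \<Longrightarrow> diff_times_on n (\<Union>i\<in>I. U i) f"
  by (induction n arbitrary: f) (auto intro: continuous_on_open_UN)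

lemma diff_times_on_const [simp]: "diff_times_on n S (\<lambda>x. c)"
  by (induction n arbitrary: c) auto

lemma diff_times_on_bounded_linear_comp:
  assumes "open S" "bounded_linear l" "diff_times_on n S f"
  shows "diff_times_on n S (\<lambda>x. l (f x))"
  using assms(3)
proof (induction n arbitrary: f)
  case 0
  then show ?case
    by (simp add: bounded_linear.continuous_on assms)
next
  case (Suc n)
  show ?case
    by (rule diff_times_on_SucI[OF assms(1)])
      (use Suc diff_times_on_has_derivative[OF Suc.prems] in
        \<open>auto intro: bounded_linear.has_derivative[OF assms(2)]\<close>)
qed

lemma diff_times_on_bounded_linear:
  assumes "open S" "bounded_linear l"
  shows "diff_times_on n S l"
proof (cases n)
  case 0
  then show ?thesis using assms
    by (auto intro: bounded_linear.continuous_on)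
next
  case (Suc m)
  show ?thesis unfolding Suc
    by (rule diff_times_on_SucI[OF assms(1), of _ "\<lambda>_. l"])
      (auto intro: bounded_linear_imp_has_derivative assms)
qed

lemma diff_times_on_ident [simp]: "open S \<Longrightarrow> diff_times_on n S (\<lambda>x. x)"
  by (rule diff_times_on_bounded_linear) (auto intro: bounded_linear_ident)

lemma diff_times_on_add:
  assumes "open S" "diff_times_on n S f" "diff_times_on n S g"
  shows "diff_times_on n S (\<lambda>x. f x + g x)"
  using assms(2,3)
proof (induction n arbitrary: f g)
  case 0
  then show ?case by (auto intro: continuous_intros)
next
  case (Suc n)
  show ?case
    by (rule diff_times_on_SucI[OF assms(1) has_derivative_add[OF
      diff_times_on_has_derivative[OF Suc.prems(1)] diff_times_on_has_derivative[OF Suc.prems(2)]]])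
      (use Suc in auto)
qed

lemma diff_times_on_sum:
  assumes "open S" "\<And>i. i \<in> I \<Longrightarrow> diff_times_on n S (f i)"
  shows "diff_times_on n S (\<lambda>x. \<Sum>i\<in>I. f i x)"
  using assms(2) by (induction I rule: infinite_finite_induct) (auto intro: diff_times_on_add[OF assms(1)])

text \<open>By the Leibniz rule the derivative is a sum of two terms of the same shape with one
  factor differentiated, so the induction closes when it is general in \<open>f\<close> and
  \<open>g\<close>.\<close>

lemma diff_times_on_bilinear:
  assumes "open S" "bounded_bilinear B" "diff_times_on n S f" "diff_times_on n S g"
  shows "diff_times_on n S (\<lambda>x. B (f x) (g x))"
  using assms(3,4)
proof (induction n arbitrary: f g)
  case 0
  then show ?case using bounded_bilinear.continuous_on[OF assms(2)] by auto
next
  case (Suc n)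
  note lower = Suc.prems[THEN diff_times_on_SucD]
  show ?case
    by (rule diff_times_on_SucI[OF assms(1) bounded_bilinear.FDERIV[OF assms(2)
      diff_times_on_has_derivative[OF Suc.prems(1)] diff_times_on_has_derivative[OF Suc.prems(2)]]])
      (use Suc lower in \<open>auto intro!: diff_times_on_add[OF assms(1)] Suc.IH\<close>)
qed

lemmas diff_times_on_scaleR = diff_times_on_bilinear[OF _ bounded_bilinear_scaleR]
lemmas diff_times_on_mult = diff_times_on_bilinear[OF _ bounded_bilinear_mult]
lemmas diff_times_on_inner = diff_times_on_bilinear[OF _ bounded_bilinear_inner]

lemma diff_times_on_diff:
  assumes "open S" "diff_times_on n S f" "diff_times_on n S g"
  shows "diff_times_on n S (\<lambda>x. f x - g x)"
  using diff_times_on_add[OF assms(1,2) diff_times_on_bounded_linear_comp[OF assms(1)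
    bounded_linear_minus[OF bounded_linear_ident] assms(3)]] by simp

text \<open>Reduces a family of linear maps with a moving argument to its values on finitely many
  fixed vectors, the only ones that the definition of smoothness tests.\<close>

lemma linear_euclidean_sum:
  fixes l :: "'a::euclidean_space \<Rightarrow> 'b::real_normed_vector"
  assumes "linear l"
  shows "l x = (\<Sum>b\<in>Basis. (x \<bullet> b) *\<^sub>R l b)"
proof -
  have "l x = l (\<Sum>b\<in>Basis. (x \<bullet> b) *\<^sub>R b)" by (simp add: euclidean_representation)
  also have "\<dots> = (\<Sum>b\<in>Basis. (x \<bullet> b) *\<^sub>R l b)"
    by (simp only: linear_sum[OF assms] linear_scale[OF assms])
  finally show ?thesis .
qed

lemma diff_times_on_linear_family:
  fixes l :: "'a::real_normed_vector \<Rightarrow> 'b::euclidean_space \<Rightarrow> 'c::real_normed_vector"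
  assumes S: "open S" and lin: "\<And>x. x \<in> S \<Longrightarrow> linear (l x)"
    and l: "\<And>b. b \<in> Basis \<Longrightarrow> diff_times_on n S (\<lambda>x. l x b)" and f: "diff_times_on n S f"
  shows "diff_times_on n S (\<lambda>x. l x (f x))"
proof (rule diff_times_on_cong[OF S])
  show "(\<Sum>b\<in>Basis. (f x \<bullet> b) *\<^sub>R l x b) = l x (f x)" if "x \<in> S" for x
    by (rule linear_euclidean_sum[OF lin[OF that], symmetric])
  show "diff_times_on n S (\<lambda>x. \<Sum>b\<in>Basis. (f x \<bullet> b) *\<^sub>R l x b)"
    by (intro diff_times_on_sum diff_times_on_scaleR diff_times_on_inner S l f diff_times_on_const)
qed

text \<open>In the chain rule the derivative of \<open>g\<close> at \<open>f x\<close> is a linear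
  family in \<open>x\<close>. Its values on basis vectors are compositions of lower order, and the
  moving argument is handled by \<open>diff_times_on_linear_family\<close>.\<close>

lemma diff_times_on_compose:
  fixes f :: "'a::real_normed_vector \<Rightarrow> 'b::euclidean_space" and g :: "'b \<Rightarrow> 'c::real_normed_vector"
  assumes "open S" "open T" "f ` S \<subseteq> T" "diff_times_on n S f" "diff_times_on n T g"
  shows "diff_times_on n S (\<lambda>x. g (f x))"
  using assms(4,5)
proof (induction n arbitrary: g)
  case 0
  then show ?case using assms(3) by (auto intro: continuous_on_compose2)
next
  case (Suc n)
  have d: "((\<lambda>x. g (f x)) has_derivative
      (\<lambda>v. frechet_derivative g (at (f x)) (frechet_derivative f (at x) v))) (at x)" if "x \<in> S" for x
    by (rule has_derivative_compose[OF diff_times_on_has_derivative[OF Suc.prems(1) that]])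
      (rule diff_times_on_has_derivative[OF Suc.prems(2)], use that assms in auto)
  show ?case
  proof (rule diff_times_on_SucI[OF assms(1) d])
    fix v
    show "diff_times_on n S (\<lambda>x. frechet_derivative g (at (f x)) (frechet_derivative f (at x) v))"
    proof (rule diff_times_on_linear_family[OF assms(1)])
      show "linear (frechet_derivative g (at (f x)))" if "x \<in> S" for x
        by (rule has_derivative_linear[OF diff_times_on_has_derivative[OF Suc.prems(2)]])
          (use that assms in auto)
      show "diff_times_on n S (\<lambda>x. frechet_derivative g (at (f x)) b)" for b
        by (rule Suc.IH) (use Suc.prems diff_times_on_SucD in auto)
    qed (use Suc.prems in auto)
  qed
qed

lemma diff_times_on_Pair:
  assumes "open S" "diff_times_on n S f" "diff_times_on n S g"
  shows "diff_times_on n S (\<lambda>x. (f x, g x))"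
proof -
  have "diff_times_on n S (\<lambda>x. (f x, 0) + (0, g x))"
    by (rule diff_times_on_add[OF assms(1)
      diff_times_on_bounded_linear_comp[OF assms(1) _ assms(2), of "\<lambda>x. (x, 0)"]
      diff_times_on_bounded_linear_comp[OF assms(1) _ assms(3), of "\<lambda>x. (0, x)"]])
      (auto intro: bounded_linear_Pair bounded_linear_ident bounded_linear_zero)
  then show ?thesis by simp
qed

lemma diff_times_on_frechet:
  fixes f :: "'a::euclidean_space \<Rightarrow> 'b::real_normed_vector"
  assumes "open S" "diff_times_on (Suc n) S f" "diff_times_on n S g"
  shows "diff_times_on n S (\<lambda>x. frechet_derivative f (at x) (g x))"
  by (rule diff_times_on_linear_family[OF assms(1) has_derivative_linear[OF
    diff_times_on_has_derivative[OF assms(2)]]]) (use assms in auto)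

lemma diff_times_on_inverse:
  fixes f :: "'a::real_normed_vector \<Rightarrow> real"
  assumes S: "open S" and f: "diff_times_on n S f" and nz: "\<And>x. x \<in> S \<Longrightarrow> f x \<noteq> 0"
  shows "diff_times_on n S (\<lambda>x. inverse (f x))"
  using f
proof (induction n)
  case 0
  then show ?case using nz by (auto intro: continuous_intros)
next
  case (Suc n)
  show ?case
  proof (rule diff_times_on_SucI[OF S Deriv.has_derivative_inverse[OF nz diff_times_on_has_derivative[OF Suc.prems]]])
    fix v
    have i: "diff_times_on n S (\<lambda>x. inverse (f x))"
      using Suc diff_times_on_SucD by blast
    have "diff_times_on n S (\<lambda>x. frechet_derivative f (at x) v)" using Suc.prems by simp
    then show "diff_times_on n S (\<lambda>x. - (inverse (f x) * frechet_derivative f (at x) v * inverse (f x)))"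
      by (intro diff_times_on_mult diff_times_on_bounded_linear_comp[OF S
        bounded_linear_minus[OF bounded_linear_ident]] S i)
  qed
qed

section \<open>Closure properties of smooth maps, inherited from each finite order\<close>

lemma smooth_on_cong:
  "open S \<Longrightarrow> smooth_on S f \<Longrightarrow> (\<And>x. x \<in> S \<Longrightarrow> f x = g x) \<Longrightarrow> smooth_on S g"
  unfolding smooth_on_def using diff_times_on_cong by blast

lemma smooth_on_subset: "smooth_on S f \<Longrightarrow> T \<subseteq> S \<Longrightarrow> smooth_on T f"
  unfolding smooth_on_def using diff_times_on_subset by blast

lemma smooth_on_local:
  assumes "\<And>x. x \<in> S \<Longrightarrow> \<exists>U. open U \<and> x \<in> U \<and> smooth_on U f"
  shows "smooth_on S f"
proof -
  obtain U where U: "\<And>x. x \<in> S \<Longrightarrow> open (U x) \<and> x \<in> U x \<and> smooth_on (U x) f"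
    using assms by metis
  then have "smooth_on (\<Union>x\<in>S. U x) f"
    unfolding smooth_on_def using diff_times_on_UN[of S U _ f] by blast
  then show ?thesis by (rule smooth_on_subset) (use U in auto)
qed

lemma smooth_on_const [simp]: "smooth_on S (\<lambda>x. c)"
  by (simp add: smooth_on_def)

lemma smooth_on_bounded_linear_comp:
  "open S \<Longrightarrow> bounded_linear l \<Longrightarrow> smooth_on S f \<Longrightarrow> smooth_on S (\<lambda>x. l (f x))"
  unfolding smooth_on_def using diff_times_on_bounded_linear_comp by blast

lemma smooth_on_ident [simp]: "open S \<Longrightarrow> smooth_on S (\<lambda>x. x)"
  by (simp add: smooth_on_def)

lemma smooth_on_bounded_linear: "open S \<Longrightarrow> bounded_linear l \<Longrightarrow> smooth_on S l"
  unfolding smooth_on_def using diff_times_on_bounded_linear by blast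

lemma smooth_on_add:
  "open S \<Longrightarrow> smooth_on S f \<Longrightarrow> smooth_on S g \<Longrightarrow> smooth_on S (\<lambda>x. f x + g x)"
  unfolding smooth_on_def using diff_times_on_add by blast

lemma smooth_on_diff:
  "open S \<Longrightarrow> smooth_on S f \<Longrightarrow> smooth_on S g \<Longrightarrow> smooth_on S (\<lambda>x. f x - g x)"
  unfolding smooth_on_def using diff_times_on_diff by blast

lemma smooth_on_bilinear:
  "open S \<Longrightarrow> bounded_bilinear B \<Longrightarrow> smooth_on S f \<Longrightarrow> smooth_on S g \<Longrightarrow> smooth_on S (\<lambda>x. B (f x) (g x))"
  unfolding smooth_on_def using diff_times_on_bilinear by blast

lemmas smooth_on_scaleR = smooth_on_bilinear[OF _ bounded_bilinear_scaleR]
lemmas smooth_on_mult = smooth_on_bilinear[OF _ bounded_bilinear_mult]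
lemmas smooth_on_inner = smooth_on_bilinear[OF _ bounded_bilinear_inner]

lemma smooth_on_Pair:
  "open S \<Longrightarrow> smooth_on S f \<Longrightarrow> smooth_on S g \<Longrightarrow> smooth_on S (\<lambda>x. (f x, g x))"
  unfolding smooth_on_def using diff_times_on_Pair by blast

lemma smooth_on_inverse:
  fixes f :: "'a::real_normed_vector \<Rightarrow> real"
  shows "open S \<Longrightarrow> smooth_on S f \<Longrightarrow> (\<And>x. x \<in> S \<Longrightarrow> f x \<noteq> 0) \<Longrightarrow> smooth_on S (\<lambda>x. inverse (f x))"
  unfolding smooth_on_def using diff_times_on_inverse by blast

lemma smooth_on_linear_family:
  fixes l :: "'a::real_normed_vector \<Rightarrow> 'b::euclidean_space \<Rightarrow> 'c::real_normed_vector"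
  assumes "open S" "\<And>x. x \<in> S \<Longrightarrow> linear (l x)"
    "\<And>b. b \<in> Basis \<Longrightarrow> smooth_on S (\<lambda>x. l x b)" "smooth_on S f"
  shows "smooth_on S (\<lambda>x. l x (f x))"
  unfolding smooth_on_def
proof
  show "diff_times_on n S (\<lambda>x. l x (f x))" for n
    by (rule diff_times_on_linear_family[where l = l, OF assms(1)])
      (use assms(2-4) in \<open>auto simp: smooth_on_def\<close>)
qed

lemma smooth_on_compose:
  fixes f :: "'a::real_normed_vector \<Rightarrow> 'b::euclidean_space" and g :: "'b \<Rightarrow> 'c::real_normed_vector"
  shows "open S \<Longrightarrow> open T \<Longrightarrow> f ` S \<subseteq> T \<Longrightarrow> smooth_on S f \<Longrightarrow> smooth_on T g \<Longrightarrow> smooth_on S (\<lambda>x. g (f x))"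
  unfolding smooth_on_def using diff_times_on_compose by blast

lemma smooth_on_frechet:
  fixes f :: "'a::euclidean_space \<Rightarrow> 'b::real_normed_vector"
  shows "open S \<Longrightarrow> smooth_on S f \<Longrightarrow> smooth_on S g \<Longrightarrow> smooth_on S (\<lambda>x. frechet_derivative f (at x) (g x))"
  unfolding smooth_on_def using diff_times_on_frechet by blast

lemma smooth_on_has_derivative:
  "smooth_on S f \<Longrightarrow> x \<in> S \<Longrightarrow> (f has_derivative frechet_derivative f (at x)) (at x)"
  unfolding smooth_on_def using diff_times_on_has_derivative by blast

lemma smooth_on_differentiable: "smooth_on S f \<Longrightarrow> x \<in> S \<Longrightarrow> f differentiable (at x)"
  using smooth_on_has_derivative differentiable_def by blast

lemma smooth_on_continuous: "smooth_on S f \<Longrightarrow> continuous_on S f"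
  unfolding smooth_on_def by (metis diff_times_on.simps(1))

lemma smooth_on_frechet_const: "smooth_on S f \<Longrightarrow> smooth_on S (\<lambda>x. frechet_derivative f (at x) v)"
  unfolding smooth_on_def using diff_times_on.simps(2) by blast

subsection \<open>Bump functions\<close>

text \<open>The power \<open>k\<close> is there because differentiation leads from exp(-1/x) to its
  products with powers of 1/x; the linear span of the whole family is closed under it.\<close>

definition flat_exp :: "nat \<Rightarrow> real \<Rightarrow> real" where
  "flat_exp k x = (if x \<le> 0 then 0 else exp (- inverse x) * inverse x ^ k)"

text \<open>With \<open>y = inverse x\<close> this is the limit of \<open>y ^ k / exp y\<close> at
  infinity.\<close>

lemma flat_exp_tendsto_0: "(flat_exp k \<longlongrightarrow> 0) (at 0)"
proof -
  have "((\<lambda>x. exp (- inverse x) * inverse x ^ k) \<longlongrightarrow> 0) (at_right (0::real))"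
    using filterlim_compose[OF tendsto_power_div_exp_0[of k] filterlim_inverse_at_top_right]
    by (simp add: exp_minus field_simps)
  then have "(flat_exp k \<longlongrightarrow> 0) (at_right 0)"
    by (rule Lim_transform_eventually) (auto simp: eventually_at_right_less flat_exp_def eventually_at_filter)
  moreover have "(flat_exp k \<longlongrightarrow> 0) (at_left 0)"
    by (rule Lim_transform_eventually[OF tendsto_const]) (auto simp: flat_exp_def eventually_at_filter)
  ultimately show ?thesis by (simp add: filterlim_at_split)
qed

lemma flat_exp_derivative:
  "(flat_exp k has_field_derivative (flat_exp (k+2) x - real k * flat_exp (k+1) x)) (at x)"
proof (cases x "0::real" rule: linorder_cases)
  case less
  have "((\<lambda>x. 0) has_field_derivative 0) (at x)" by simp
  then show ?thesis
    by (rule has_field_derivative_transform_within_open[of _ _ _ "{..<0}", THEN DERIV_cong])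
      (use less in \<open>auto simp: flat_exp_def\<close>)
next
  case equal
  \<comment> \<open>The difference quotient at 0 is again a function of the family, namely
    \<open>flat_exp (Suc k)\<close>.\<close>
  have "((\<lambda>y. (flat_exp k y - flat_exp k 0) / (y - 0)) \<longlongrightarrow> 0) (at 0)"
    by (rule Lim_transform_eventually[OF flat_exp_tendsto_0[of "Suc k"]])
      (auto simp: flat_exp_def eventually_at_filter field_simps)
  then show ?thesis unfolding equal has_field_derivative_iff by (simp add: flat_exp_def)
next
  case greater
  have "((\<lambda>x. exp (- inverse x) * inverse x ^ k) has_field_derivative
      (flat_exp (k+2) x - real k * flat_exp (k+1) x)) (at x)"
    using greater
    by (cases k; auto intro!: derivative_eq_intros simp: flat_exp_def algebra_simps numeral_eq_Suc
        simp flip: power_Suc; simp)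
  then show ?thesis
    by (rule has_field_derivative_transform_within_open[of _ _ _ "{0<..}"])
      (use greater in \<open>auto simp: flat_exp_def\<close>)
qed

lemma smooth_on_flat_exp: "smooth_on UNIV (flat_exp k)"
  unfolding smooth_on_def
proof
  fix n show "diff_times_on n UNIV (flat_exp k)"
  proof (induction n arbitrary: k)
    case 0
    then show ?case
      by (auto intro!: continuous_at_imp_continuous_on DERIV_isCont flat_exp_derivative)
  next
    case (Suc n)
    show ?case
      by (rule diff_times_on_SucI[OF _ flat_exp_derivative[unfolded has_field_derivative_def]])
        (auto intro!: diff_times_on_mult diff_times_on_diff Suc)
  qed
qed

text \<open>A quotient u / (u + v) with u positive exactly inside the ball of radius
  \<open>r\<close> and v positive exactly outside the closed ball of radius \<open>r/2\<close>; for
  \<open>0 < r\<close> they never vanish together. Squared norms keep it smooth at the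
  origin.\<close>

definition bump :: "real \<Rightarrow> 'a::euclidean_space \<Rightarrow> real" where
  "bump r y = flat_exp 0 (r^2 - y \<bullet> y) *
     inverse (flat_exp 0 (r^2 - y \<bullet> y) + flat_exp 0 (y \<bullet> y - (r/2)^2))"

lemma flat_exp_nonneg: "0 \<le> flat_exp k x"
  and flat_exp_pos: "0 < x \<Longrightarrow> 0 < flat_exp k x"
  and flat_exp_zero: "x \<le> 0 \<Longrightarrow> flat_exp k x = 0"
  by (auto simp: flat_exp_def)

lemma smooth_on_bump: "0 < r \<Longrightarrow> smooth_on UNIV (bump r :: 'a::euclidean_space \<Rightarrow> real)"
proof -
  assume r: "0 < r"
  have i: "smooth_on UNIV (\<lambda>y::'a. y \<bullet> y)" by (intro smooth_on_inner) auto
  have 1: "smooth_on UNIV (\<lambda>y::'a. flat_exp 0 (r^2 - y \<bullet> y))"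
    by (rule smooth_on_compose[OF _ _ _ _ smooth_on_flat_exp]) (auto intro: smooth_on_diff i)
  have 2: "smooth_on UNIV (\<lambda>y::'a. flat_exp 0 (y \<bullet> y - (r/2)^2))"
    by (rule smooth_on_compose[OF _ _ _ _ smooth_on_flat_exp]) (auto intro: smooth_on_diff i)
  have p: "flat_exp 0 (r^2 - y \<bullet> y) + flat_exp 0 (y \<bullet> y - (r/2)^2) \<noteq> 0" for y :: 'a
  proof (cases "y \<bullet> y < r^2")
    case True
    then show ?thesis
      using flat_exp_pos[of "r^2 - y \<bullet> y" 0] flat_exp_nonneg[of 0 "y \<bullet> y - (r/2)^2"] by simp
  next
    case False
    moreover have "(r/2)^2 < r^2" using r by (simp add: power2_eq_square)
    ultimately show ?thesis
      using flat_exp_pos[of "y \<bullet> y - (r/2)^2" 0] flat_exp_nonneg[of 0 "r^2 - y \<bullet> y"] by simp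
  qed
  show ?thesis unfolding bump_def[abs_def]
    by (intro smooth_on_mult smooth_on_inverse smooth_on_add 1 2 p open_UNIV)
qed

lemma bump_eq_1: "0 < r \<Longrightarrow> norm y \<le> r/2 \<Longrightarrow> bump r y = 1"
proof -
  assume r: "0 < r" "norm y \<le> r/2"
  then have le: "y \<bullet> y \<le> (r/2)^2"
    by (metis dot_square_norm norm_ge_zero power_mono)
  have lt: "(r/2)^2 < r^2" using r by (simp add: power2_eq_square)
  show ?thesis
    using flat_exp_pos[of "r^2 - y \<bullet> y" 0] flat_exp_zero[of "y \<bullet> y - (r/2)^2" 0] le lt
    by (simp add: bump_def)
qed

lemma bump_eq_0: "0 < r \<Longrightarrow> r \<le> norm y \<Longrightarrow> bump r y = 0"
proof -
  assume "0 < r" "r \<le> norm y"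
  then have "r^2 \<le> y \<bullet> y" by (metis dot_square_norm less_imp_le power_mono)
  then show ?thesis by (simp add: bump_def flat_exp_zero)
qed

subsection \<open>Symmetry of second derivatives\<close>

text \<open>Two applications of the mean value theorem: one in direction \<open>u\<close> to the
  increment of \<open>f\<close> over \<open>h *\<^sub>R v\<close>, then one in direction
  \<open>v\<close> to the derivative so obtained.\<close>

lemma second_difference_mean_value:
  fixes f :: "'a::real_normed_vector \<Rightarrow> real"
  assumes f: "diff_times_on 2 S f" and h: "0 < h"
    and S: "\<And>s t. 0 \<le> s \<Longrightarrow> s \<le> h \<Longrightarrow> 0 \<le> t \<Longrightarrow> t \<le> h \<Longrightarrow> x + s *\<^sub>R u + t *\<^sub>R v \<in> S"
  shows "\<exists>s t. 0 \<le> s \<and> s \<le> h \<and> 0 \<le> t \<and> t \<le> h \<and>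
    f (x + h *\<^sub>R u + h *\<^sub>R v) - f (x + h *\<^sub>R u) - f (x + h *\<^sub>R v) + f x =
    h * (h * frechet_derivative (\<lambda>y. frechet_derivative f (at y) u) (at (x + s *\<^sub>R u + t *\<^sub>R v)) v)"
proof -
  let ?D = "\<lambda>y. frechet_derivative f (at y) u"
  have f1: "diff_times_on (Suc (Suc 0)) S f" using f by (simp add: numeral_eq_Suc)
  then have D: "diff_times_on (Suc 0) S ?D" by simp
  have derf: "((\<lambda>s. f (x + s *\<^sub>R u + t *\<^sub>R v)) has_real_derivative ?D (x + s *\<^sub>R u + t *\<^sub>R v)) (at s)"
    if "x + s *\<^sub>R u + t *\<^sub>R v \<in> S" for s t
  proof -
    note d = diff_times_on_has_derivative[OF f1 that]
    have "((\<lambda>s. f (x + s *\<^sub>R u + t *\<^sub>R v)) has_derivative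
        (\<lambda>k. frechet_derivative f (at (x + s *\<^sub>R u + t *\<^sub>R v)) (k *\<^sub>R u))) (at s)"
      by (rule has_derivative_compose[of "\<lambda>s. x + s *\<^sub>R u + t *\<^sub>R v" _ _ _ f, OF _ d])
        (auto intro!: derivative_eq_intros)
    then show ?thesis
      by (simp add: has_field_derivative_def linear_scale[OF has_derivative_linear[OF d]] mult_commute_abs)
  qed
  have derD: "((\<lambda>t. ?D (x + s *\<^sub>R u + t *\<^sub>R v)) has_real_derivative
      frechet_derivative ?D (at (x + s *\<^sub>R u + t *\<^sub>R v)) v) (at t)"
    if "x + s *\<^sub>R u + t *\<^sub>R v \<in> S" for s t
  proof -
    note d = diff_times_on_has_derivative[OF D that]
    have "((\<lambda>t. ?D (x + s *\<^sub>R u + t *\<^sub>R v)) has_derivative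
        (\<lambda>k. frechet_derivative ?D (at (x + s *\<^sub>R u + t *\<^sub>R v)) (k *\<^sub>R v))) (at t)"
      by (rule has_derivative_compose[of "\<lambda>t. x + s *\<^sub>R u + t *\<^sub>R v" _ _ _ ?D, OF _ d])
        (auto intro!: derivative_eq_intros)
    then show ?thesis
      by (simp add: has_field_derivative_def linear_scale[OF has_derivative_linear[OF d]]
        mult_commute_abs)
  qed
  have "((\<lambda>s. f (x + s *\<^sub>R u + h *\<^sub>R v) - f (x + s *\<^sub>R u + 0 *\<^sub>R v)) has_real_derivative
      ?D (x + s *\<^sub>R u + h *\<^sub>R v) - ?D (x + s *\<^sub>R u + 0 *\<^sub>R v)) (at s)"
    if "0 \<le> s" "s \<le> h" for s
    by (rule DERIV_diff[OF derf derf]) (use S[of s h] S[of s 0] that h in auto)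
  from MVT2[OF h this]
  obtain s where s: "0 < s" "s < h" and
    1: "f (x + h *\<^sub>R u + h *\<^sub>R v) - f (x + h *\<^sub>R u) - (f (x + h *\<^sub>R v) - f x) =
      h * (?D (x + s *\<^sub>R u + h *\<^sub>R v) - ?D (x + s *\<^sub>R u))"
    by auto
  have "((\<lambda>t. ?D (x + s *\<^sub>R u + t *\<^sub>R v)) has_real_derivative
      frechet_derivative ?D (at (x + s *\<^sub>R u + t *\<^sub>R v)) v) (at t)" if "0 \<le> t" "t \<le> h" for t
    by (rule derD) (use S s that in auto)
  from MVT2[OF h this]
  obtain t where "0 < t" "t < h"
    "?D (x + s *\<^sub>R u + h *\<^sub>R v) - ?D (x + s *\<^sub>R u) =
      h * frechet_derivative ?D (at (x + s *\<^sub>R u + t *\<^sub>R v)) v"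
    by auto
  with 1 s show ?thesis
    by (intro exI[of _ s] exI[of _ t]) auto
qed

text \<open>The second difference over a parallelogram is symmetric in \<open>u\<close> and
  \<open>v\<close>, so the two mixed derivatives take a common value at points arbitrarily close to
  \<open>x\<close>. By continuity they cannot differ at \<open>x\<close>.\<close>

lemma symmetric_second_derivative_real:
  fixes f :: "'a::real_normed_vector \<Rightarrow> real"
  assumes f: "diff_times_on 2 S f" and "open S" "x \<in> S"
  shows "frechet_derivative (\<lambda>y. frechet_derivative f (at y) u) (at x) v =
    frechet_derivative (\<lambda>y. frechet_derivative f (at y) v) (at x) u"
proof (rule ccontr)
  let ?A = "\<lambda>u v y. frechet_derivative (\<lambda>y. frechet_derivative f (at y) u) (at y) v"
  assume "?A u v x \<noteq> ?A v u x"
  then have e: "0 < \<bar>?A u v x - ?A v u x\<bar> / 2" by simp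
  have cont: "isCont (?A u v) x" for u v
    using f \<open>open S\<close> \<open>x \<in> S\<close> by (auto simp: numeral_eq_Suc continuous_on_eq_continuous_at)
  have "\<exists>r>0. \<forall>y. dist y x < r \<longrightarrow> dist (?A u v y) (?A u v x) < \<bar>?A u v x - ?A v u x\<bar> / 2 \<and>
      dist (?A v u y) (?A v u x) < \<bar>?A u v x - ?A v u x\<bar> / 2 \<and> y \<in> S"
  proof -
    obtain r1 where "r1 > 0" "\<forall>y. dist y x < r1 \<longrightarrow> dist (?A u v y) (?A u v x) < \<bar>?A u v x - ?A v u x\<bar> / 2"
      using cont[of u v] e unfolding continuous_at_eps_delta by (metis (lifting))
    moreover obtain r2 where "r2 > 0" "\<forall>y. dist y x < r2 \<longrightarrow> dist (?A v u y) (?A v u x) < \<bar>?A u v x - ?A v u x\<bar> / 2"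
      using cont[of v u] e unfolding continuous_at_eps_delta by (metis (lifting))
    moreover obtain r3 where "r3 > 0" "\<forall>y. dist y x < r3 \<longrightarrow> y \<in> S"
      using \<open>open S\<close> \<open>x \<in> S\<close> unfolding open_dist by metis
    ultimately show ?thesis
      by (intro exI[of _ "min r1 (min r2 r3)"]) auto
  qed
  then obtain r where r: "r > 0" and close: "\<And>y. dist y x < r \<Longrightarrow>
      dist (?A u v y) (?A u v x) < \<bar>?A u v x - ?A v u x\<bar> / 2 \<and>
      dist (?A v u y) (?A v u x) < \<bar>?A u v x - ?A v u x\<bar> / 2 \<and> y \<in> S"
    by blast
  \<comment> \<open>Chosen so that the whole parallelogram stays within \<open>r / 2\<close> of
    \<open>x\<close>; the summand 1 keeps the denominator positive.\<close>
  define h where "h = r / (2 * (norm u + norm v + 1))"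
  have h: "h > 0" using r by (simp add: h_def add_nonneg_pos)
  have near: "dist (x + s *\<^sub>R u + t *\<^sub>R v) x < r" if "0 \<le> s" "s \<le> h" "0 \<le> t" "t \<le> h" for s t
  proof -
    have "norm (s *\<^sub>R u + t *\<^sub>R v) \<le> h * norm u + h * norm v"
      using that by (intro norm_triangle_le add_mono) (auto intro: mult_right_mono)
    also have "\<dots> \<le> h * (norm u + norm v + 1)" using h by (simp add: algebra_simps)
    also have "\<dots> = r / 2"
    proof -
      have "0 < norm u + norm v + 1" by (simp add: add_nonneg_pos)
      then show ?thesis by (simp add: h_def field_simps del: distrib_left_numeral)
    qed
    also have "\<dots> < r" using r by simp
    finally show ?thesis by (simp add: dist_norm add.assoc)
  qed
  obtain s t where st: "0 \<le> s" "s \<le> h" "0 \<le> t" "t \<le> h"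
    "f (x + h *\<^sub>R u + h *\<^sub>R v) - f (x + h *\<^sub>R u) - f (x + h *\<^sub>R v) + f x = h * (h * ?A u v (x + s *\<^sub>R u + t *\<^sub>R v))"
    using second_difference_mean_value[OF f h, of x u v] close near by blast
  obtain s' t' where st': "0 \<le> s'" "s' \<le> h" "0 \<le> t'" "t' \<le> h"
    "f (x + h *\<^sub>R v + h *\<^sub>R u) - f (x + h *\<^sub>R v) - f (x + h *\<^sub>R u) + f x = h * (h * ?A v u (x + s' *\<^sub>R v + t' *\<^sub>R u))"
  proof -
    have "x + s *\<^sub>R v + t *\<^sub>R u \<in> S" if "0 \<le> s" "s \<le> h" "0 \<le> t" "t \<le> h" for s t
      using close[OF near[OF that(3,4,1,2)]] by (simp add: algebra_simps)
    then show thesis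
      using second_difference_mean_value[OF f h, of x v u] that by blast
  qed
  have "f (x + h *\<^sub>R v + h *\<^sub>R u) = f (x + h *\<^sub>R u + h *\<^sub>R v)"
    by (simp add: algebra_simps)
  with st(5) st'(5) have "h * (h * ?A u v (x + s *\<^sub>R u + t *\<^sub>R v)) = h * (h * ?A v u (x + s' *\<^sub>R v + t' *\<^sub>R u))"
    by linarith
  then have "?A u v (x + s *\<^sub>R u + t *\<^sub>R v) = ?A v u (x + s' *\<^sub>R v + t' *\<^sub>R u)"
    using h by simp
  moreover have "x + s' *\<^sub>R v + t' *\<^sub>R u = x + t' *\<^sub>R u + s' *\<^sub>R v" by simp
  \<comment> \<open>The common value \<open>p\<close> would lie within half the distance of
    \<open>a\<close> and \<open>b\<close> from both of them.\<close>
  moreover have False if "dist p a < \<bar>a - b\<bar> / 2" "dist p b < \<bar>a - b\<bar> / 2" for p a b :: real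
  proof -
    have "dist a b \<le> dist p a + dist p b" by (rule dist_triangle3)
    also have "\<dots> < \<bar>a - b\<bar> / 2 + \<bar>a - b\<bar> / 2" using that by (rule add_strict_mono)
    finally show False by (simp add: dist_real_def)
  qed
  ultimately show False
    using close[OF near[OF st(1-4)]] close[OF near[OF st'(3,4,1,2)]] by metis
qed

text \<open>Pairing with each fixed vector \<open>w\<close> reduces this to real values.\<close>

lemma symmetric_second_derivative:
  fixes f :: "'a::real_normed_vector \<Rightarrow> 'b::real_inner"
  assumes f: "diff_times_on 2 S f" and S: "open S" and x: "x \<in> S"
  shows "frechet_derivative (\<lambda>y. frechet_derivative f (at y) u) (at x) v =
    frechet_derivative (\<lambda>y. frechet_derivative f (at y) v) (at x) u"
proof -
  have f2: "diff_times_on (Suc (Suc 0)) S f" using f by (simp add: numeral_eq_Suc)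
  have *: "frechet_derivative (\<lambda>y. frechet_derivative (\<lambda>z. f z \<bullet> w) (at y) u) (at x) v =
      frechet_derivative (\<lambda>y. frechet_derivative f (at y) u) (at x) v \<bullet> w" for w u v
  proof -
    have 1: "frechet_derivative (\<lambda>z. f z \<bullet> w) (at y) u = frechet_derivative f (at y) u \<bullet> w" if "y \<in> S" for y u
      by (rule fun_cong[OF frechet_derivative_at[symmetric]])
        (intro has_derivative_inner_left diff_times_on_has_derivative[OF f2 that])
    have d: "((\<lambda>y. frechet_derivative f (at y) u \<bullet> w) has_derivative
        (\<lambda>v. frechet_derivative (\<lambda>y. frechet_derivative f (at y) u) (at x) v \<bullet> w)) (at x)"
      by (intro has_derivative_inner_left diff_times_on_has_derivative[where n = 0, OF _ x]) (use f2 in auto)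
    have "((\<lambda>y. frechet_derivative (\<lambda>z. f z \<bullet> w) (at y) u) has_derivative
        (\<lambda>v. frechet_derivative (\<lambda>y. frechet_derivative f (at y) u) (at x) v \<bullet> w)) (at x)"
      by (rule has_derivative_transform_within_open[OF d S x]) (simp add: 1)
    from frechet_derivative_at[OF this] show ?thesis by metis
  qed
  have "diff_times_on 2 S (\<lambda>z. f z \<bullet> w)" for w
    by (intro diff_times_on_inner S f diff_times_on_const)
  from symmetric_second_derivative_real[OF this S x, of _ u v]
  show ?thesis unfolding * by (metis vector_eq_rdot)
qed

subsection \<open>Inverses of operators and the smooth inverse function theorem\<close>

text \<open>The second factor vanishes at \<open>x\<close>, so continuity of \<open>c\<close> is
  enough for the product rule. This breaks a circle below, where the derivative of an inverse
  operator is computed while that inverse is only known to be continuous.\<close>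

lemma has_derivative_continuous_scaleR:
  fixes c :: "'a::real_normed_vector \<Rightarrow> real"
  assumes c: "isCont c x" and h: "(h has_derivative h') (at x)"
  shows "((\<lambda>y. c y *\<^sub>R (h y - h x)) has_derivative (\<lambda>u. c x *\<^sub>R h' u)) (at x)"
  unfolding has_derivative_at_within
proof safe
  interpret h': bounded_linear h' by (rule has_derivative_bounded_linear[OF h])
  show "bounded_linear (\<lambda>u. c x *\<^sub>R h' u)"
    by (rule bounded_linear_const_scaleR[OF h'.bounded_linear_axioms])
  obtain K where K: "K > 0" "\<And>u. norm (h' u) \<le> norm u * K" using h'.pos_bounded by blast
  let ?r = "\<lambda>y. (h y - h x - h' (y - x)) /\<^sub>R norm (y - x)"
  have r: "(?r \<longlongrightarrow> 0) (at x)"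
    using h by (simp add: has_derivative_at_within)
  have cx: "(c \<longlongrightarrow> c x) (at x)" using c by (simp add: isCont_def)
  have "((\<lambda>y. \<bar>c y - c x\<bar> * K + \<bar>c y\<bar> * norm (?r y)) \<longlongrightarrow> \<bar>c x - c x\<bar> * K + \<bar>c x\<bar> * norm (0::'b)) (at x)"
    by (intro tendsto_intros r cx)
  then have lim: "((\<lambda>y. \<bar>c y - c x\<bar> * K + \<bar>c y\<bar> * norm (?r y)) \<longlongrightarrow> 0) (at x)" by simp
  show "((\<lambda>y. (c y *\<^sub>R (h y - h x) - c x *\<^sub>R (h x - h x) - c x *\<^sub>R h' (y - x)) /\<^sub>R norm (y - x)) \<longlongrightarrow> 0) (at x)"
  proof (rule Lim_null_comparison[OF _ lim], rule eventuallyI)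
    fix y
    have "norm (inverse (norm (y - x)) *\<^sub>R h' (y - x)) \<le> K"
      using K(1) K(2)[of "y - x"] by (cases "y = x") (auto simp: h'.zero field_simps)
    then have "norm ((c y - c x) *\<^sub>R (inverse (norm (y - x)) *\<^sub>R h' (y - x))) \<le> \<bar>c y - c x\<bar> * K"
      by (metis abs_ge_zero mult_left_mono norm_scaleR)
    moreover have "(c y *\<^sub>R (h y - h x) - c x *\<^sub>R (h x - h x) - c x *\<^sub>R h' (y - x)) /\<^sub>R norm (y - x) =
        (c y - c x) *\<^sub>R (inverse (norm (y - x)) *\<^sub>R h' (y - x)) + c y *\<^sub>R ?r y"
      by (simp add: algebra_simps)
    ultimately show "norm ((c y *\<^sub>R (h y - h x) - c x *\<^sub>R (h x - h x) - c x *\<^sub>R h' (y - x)) /\<^sub>R norm (y - x))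
        \<le> \<bar>c y - c x\<bar> * K + \<bar>c y\<bar> * norm (?r y)"
      by (smt (verit) norm_scaleR norm_triangle_ineq)
  qed
qed

locale inverse_operators =
  fixes S :: "'z::real_normed_vector set" and A R :: "'z \<Rightarrow> 'e::euclidean_space \<Rightarrow> 'e"
  assumes S: "open S"
    and lin_A: "x \<in> S \<Longrightarrow> linear (A x)" and lin_R: "x \<in> S \<Longrightarrow> linear (R x)"
    and RA: "x \<in> S \<Longrightarrow> R x (A x v) = v" and AR: "x \<in> S \<Longrightarrow> A x (R x v) = v"
begin

text \<open>The resolvent identity, from which both continuity and the derivative of the inverse are
  read off.\<close>

lemma R_diff: "x \<in> S \<Longrightarrow> y \<in> S \<Longrightarrow> R y v - R x v = - R x (A y (R y v) - A x (R y v))"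
  by (simp add: linear_diff[OF lin_R] RA AR)

lemma linear_derivative_operator:
  assumes A: "\<And>w. ((\<lambda>x. A x w) has_derivative A' w) (at x)" and x: "x \<in> S"
  shows "linear (\<lambda>w. A' w u)"
proof (rule linearI)
  have *: "((\<lambda>y. A y w + A y w') has_derivative (\<lambda>u. A' w u + A' w' u)) (at x)" for w w'
    by (intro has_derivative_add A)
  have "((\<lambda>y. A y (w + w')) has_derivative (\<lambda>u. A' w u + A' w' u)) (at x)" for w w'
    by (rule has_derivative_transform_within_open[OF * S x]) (simp add: linear_add[OF lin_A])
  from has_derivative_unique[OF A this]
  show "A' (w + w') u = A' w u + A' w' u" for w w' by (rule fun_cong)
  have *: "((\<lambda>y. c *\<^sub>R A y w) has_derivative (\<lambda>u. c *\<^sub>R A' w u)) (at x)" for c w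
    by (intro has_derivative_scaleR_right A)
  have "((\<lambda>y. A y (c *\<^sub>R w)) has_derivative (\<lambda>u. c *\<^sub>R A' w u)) (at x)" for c w
    by (rule has_derivative_transform_within_open[OF * S x]) (simp add: linear_scale[OF lin_A])
  from has_derivative_unique[OF A this]
  show "A' (c *\<^sub>R w) u = c *\<^sub>R A' w u" for c w by (rule fun_cong)
qed

lemma isCont_inverse_operator:
  assumes A: "\<And>w. continuous_on S (\<lambda>x. A x w)" and x: "x \<in> S"
  shows "isCont (\<lambda>y. R y v) x"
proof -
  \<comment> \<open>A sum of column norms, used in place of the operator norm of
    \<open>A y - A x\<close>, which it dominates.\<close>
  define N where "N y = (\<Sum>b\<in>Basis. norm (A y b - A x b))" for y
  have N: "(N \<longlongrightarrow> 0) (at x)"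
  proof -
    have "(N \<longlongrightarrow> (\<Sum>b\<in>(Basis::'e set). norm (A x b - A x b))) (at x)"
      unfolding N_def[abs_def]
      by (intro tendsto_intros) (use A S x in \<open>auto simp: continuous_on_eq_continuous_at isCont_def\<close>)
    then show ?thesis by simp
  qed
  have NA: "norm (A y w - A x w) \<le> N y * norm w" if "y \<in> S" for y w
  proof -
    have "A y w - A x w = (\<Sum>b\<in>Basis. (w \<bullet> b) *\<^sub>R (A y b - A x b))"
      using linear_euclidean_sum[OF lin_A[OF that], of w] linear_euclidean_sum[OF lin_A[OF x], of w]
      by (simp add: scaleR_diff_right sum_subtractf)
    also have "norm \<dots> \<le> (\<Sum>b\<in>Basis. norm w * norm (A y b - A x b))"
      by (intro sum_norm_le) (simp add: Basis_le_norm mult_right_mono)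
    finally show ?thesis by (simp add: N_def sum_distrib_left[symmetric] mult.commute)
  qed
  obtain K where K: "K > 0" "\<And>w. norm (R x w) \<le> norm w * K"
    using bounded_linear.pos_bounded[OF linear_conv_bounded_linear[THEN iffD1, OF lin_R[OF x]]] by blast
  \<comment> \<open>Below this threshold the resolvent identity gives
    \<open>norm (R y v - R x v) \<le> norm (R y v) / 2\<close>, hence the a priori bound
    \<open>norm (R y v) \<le> 2 * norm (R x v)\<close>.\<close>
  have ev: "\<forall>\<^sub>F y in at x. y \<in> S \<and> N y < 1 / (2 * K)"
    using eventually_at_in_open'[OF S x] order_tendstoD(2)[OF N, of "1 / (2 * K)"] K(1)
    by (auto elim: eventually_elim2)
  have "((\<lambda>y. R y v - R x v) \<longlongrightarrow> 0) (at x)"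
  proof (rule Lim_null_comparison)
    show "((\<lambda>y. 2 * K * norm (R x v) * N y) \<longlongrightarrow> 0) (at x)"
      using tendsto_mult_right_zero[OF N] by simp
    show "\<forall>\<^sub>F y in at x. norm (R y v - R x v) \<le> 2 * K * norm (R x v) * N y"
    proof (rule eventually_mono[OF ev])
      fix y assume y: "y \<in> S \<and> N y < 1 / (2 * K)"
      have N0: "0 \<le> N y" by (simp add: N_def sum_nonneg)
      have "norm (R y v - R x v) \<le> norm (A y (R y v) - A x (R y v)) * K"
        using R_diff[OF x, of y v] y K(2) by (metis norm_minus_cancel)
      also have "\<dots> \<le> N y * norm (R y v) * K"
        using NA y K(1) by (intro mult_right_mono) auto
      finally have 1: "norm (R y v - R x v) \<le> K * N y * norm (R y v)" by (simp add: mult_ac)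
      have "K * N y \<le> 1/2" using y K(1) by (simp add: field_simps)
      then have "norm (R y v - R x v) \<le> norm (R y v) / 2"
        using 1 mult_right_mono[of "K * N y" "1/2" "norm (R y v)"] by simp
      then have "norm (R y v) \<le> 2 * norm (R x v)"
        by (smt (verit) field_sum_of_halves norm_triangle_sub)
      then show "norm (R y v - R x v) \<le> 2 * K * norm (R x v) * N y"
        using order_trans[OF 1 mult_left_mono[of "norm (R y v)" "2 * norm (R x v)" "K * N y"]] K(1) N0
        by (simp add: mult_ac)
    qed
  qed
  then show ?thesis by (simp add: isCont_def LIM_zero_iff)
qed

text \<open>In a basis the resolvent identity is a sum of terms
  \<open>(R y v \<bullet> b) *\<^sub>R (A y b - A x b)\<close>: a continuous coefficient times a
  differentiable factor that vanishes at \<open>x\<close>.\<close>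

lemma has_derivative_inverse_operator:
  assumes A: "\<And>w. (\<And>x. x \<in> S \<Longrightarrow> ((\<lambda>x. A x w) has_derivative (\<lambda>u. A' x u w)) (at x))" and x: "x \<in> S"
  shows "((\<lambda>y. R y v) has_derivative (\<lambda>u. - R x (A' x u (R x v)))) (at x)"
proof -
  have "continuous_on S (\<lambda>x. A x w)" for w
    by (auto intro!: continuous_at_imp_continuous_on has_derivative_continuous[OF A])
  note cont = isCont_inverse_operator[OF this x, of v]
  have lin': "linear (A' x u)" for u
    by (rule linear_derivative_operator[of "\<lambda>w u. A' x u w", OF A[OF x] x])
  have d: "((\<lambda>y. \<Sum>b\<in>Basis. (R y v \<bullet> b) *\<^sub>R (A y b - A x b)) has_derivative
      (\<lambda>u. \<Sum>b\<in>Basis. (R x v \<bullet> b) *\<^sub>R A' x u b)) (at x)"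
    by (intro has_derivative_sum has_derivative_continuous_scaleR A x isCont_inner cont continuous_const)
  have "((\<lambda>y. R x v - R x (\<Sum>b\<in>Basis. (R y v \<bullet> b) *\<^sub>R (A y b - A x b))) has_derivative
      (\<lambda>u. 0 - R x (\<Sum>b\<in>Basis. (R x v \<bullet> b) *\<^sub>R A' x u b))) (at x)"
    by (intro has_derivative_diff has_derivative_const
      bounded_linear.has_derivative[OF linear_conv_bounded_linear[THEN iffD1, OF lin_R[OF x]] d])
  then have "((\<lambda>y. R x v - R x (\<Sum>b\<in>Basis. (R y v \<bullet> b) *\<^sub>R (A y b - A x b))) has_derivative
      (\<lambda>u. - R x (A' x u (R x v)))) (at x)"
    by (simp add: linear_euclidean_sum[OF lin', of _ "R x v"])
  then show ?thesis
  proof (rule has_derivative_transform_within_open[OF _ S x])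
    fix y assume y: "y \<in> S"
    have "A y (R y v) - A x (R y v) = (\<Sum>b\<in>Basis. (R y v \<bullet> b) *\<^sub>R (A y b - A x b))"
      using linear_euclidean_sum[OF lin_A[OF y], of "R y v"] linear_euclidean_sum[OF lin_A[OF x], of "R y v"]
      by (simp add: scaleR_diff_right sum_subtractf)
    then show "R x v - R x (\<Sum>b\<in>Basis. (R y v \<bullet> b) *\<^sub>R (A y b - A x b)) = R y v"
      using R_diff[OF x y, of v] by (simp add: algebra_simps)
  qed
qed

text \<open>The derivative -R A' R contains \<open>R\<close> undifferentiated, so \<open>R\<close>
  of order n makes its own derivative of order n.\<close>

lemma diff_times_on_inverse_operator:
  "(\<And>w. diff_times_on n S (\<lambda>x. A x w)) \<Longrightarrow> diff_times_on n S (\<lambda>x. R x v)"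
proof (induction n arbitrary: v)
  case 0
  then have "continuous_on S (\<lambda>x. A x w)" for w by simp
  then show ?case by (simp add: continuous_at_imp_continuous_on isCont_inverse_operator)
next
  case (Suc n)
  have IH: "diff_times_on n S (\<lambda>x. R x v)" for v
    by (rule Suc.IH) (use Suc.prems diff_times_on_SucD in blast)
  let ?A' = "\<lambda>x u w. frechet_derivative (\<lambda>x. A x w) (at x) u"
  have d: "((\<lambda>x. A x w) has_derivative (\<lambda>u. ?A' x u w)) (at x)" if "x \<in> S" for x w
    using diff_times_on_has_derivative[OF Suc.prems that] by simp
  note dR = has_derivative_inverse_operator[of ?A', OF d]
  show ?case
  proof (rule diff_times_on_SucI[OF S dR])
    fix u
    have lin': "linear (?A' x u)" if x: "x \<in> S" for x
      by (rule linear_derivative_operator[OF d[OF x] x])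
    have "diff_times_on n S (\<lambda>x. ?A' x u (R x v))"
      by (rule diff_times_on_linear_family[OF S lin' _ IH]) (use Suc.prems in auto)
    then have "diff_times_on n S (\<lambda>x. R x (?A' x u (R x v)))"
      by (intro diff_times_on_linear_family[where l = R and f = "\<lambda>x. ?A' x u (R x v)"] S lin_R IH)
    then show "diff_times_on n S (\<lambda>x. - R x (?A' x u (R x v)))"
      by (rule diff_times_on_bounded_linear_comp[OF S bounded_linear_minus[OF bounded_linear_ident]])
  qed
qed

end

text \<open>The C^1 theorem provides the local inverse \<open>g\<close>, whose derivative at
  \<open>y\<close> inverts the derivative of \<open>f\<close> at \<open>g y\<close>. Regularity is
  bootstrapped: if \<open>g\<close> is of order n, so is this operator, so is its inverse, and
  \<open>g\<close> is of order n + 1.\<close>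

theorem smooth_inverse_function:
  fixes f :: "'e::euclidean_space \<Rightarrow> 'e"
  assumes f: "smooth_on U f" and U: "open U" "x \<in> U" and inj: "inj (frechet_derivative f (at x))"
  obtains U' V g where "open U'" "U' \<subseteq> U" "x \<in> U'" "open V" "f x \<in> V" "homeomorphism U' V f g"
    "smooth_on V g"
proof -
  have d: "(f has_derivative frechet_derivative f (at y)) (at y)" if "y \<in> U" for y
    by (rule smooth_on_has_derivative[OF f that])
  define f' where "f' y = Blinfun (frechet_derivative f (at y))" for y
  have f': "blinfun_apply (f' y) = frechet_derivative f (at y)" if "y \<in> U" for y
    unfolding f'_def by (rule bounded_linear_Blinfun_apply[OF has_derivative_bounded_linear[OF d[OF that]]])
  have cont: "continuous_on U f'"
  proof (rule continuous_on_blinfun_componentwise)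
    fix i
    have "continuous_on U (\<lambda>x. frechet_derivative f (at x) i)"
      by (intro smooth_on_continuous smooth_on_frechet_const f)
    then show "continuous_on U (\<lambda>x. blinfun_apply (f' x) i)"
      by (rule continuous_on_eq) (simp add: f')
  qed
  obtain l where l: "linear l" "l \<circ> frechet_derivative f (at x) = id"
    using linear_injective_left_inverse[OF has_derivative_linear[OF d[OF U(2)]] inj] by blast
  have "Blinfun l o\<^sub>L f' x = id_blinfun"
    using l by (intro blinfun_eqI) (simp add: f'[OF U(2)] fun_eq_iff bounded_linear_Blinfun_apply
      linear_conv_bounded_linear)
  with d f' have "\<And>y. y \<in> U \<Longrightarrow> (f has_derivative blinfun_apply (f' y)) (at y)" by simp
  from inverse_function_theorem[OF U(1) this cont U(2) \<open>Blinfun l o\<^sub>L f' x = id_blinfun\<close>]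
  obtain U' V g g' where *: "open U'" "U' \<subseteq> U" "x \<in> U'" "open V" "f x \<in> V" "homeomorphism U' V f g"
    and g: "\<And>y. y \<in> V \<Longrightarrow> (g has_derivative g' y) (at y)"
      "\<And>y. y \<in> V \<Longrightarrow> g' y = inv (blinfun_apply (f' (g y)))"
      "\<And>y. y \<in> V \<Longrightarrow> bij (blinfun_apply (f' (g y)))"
    by blast
  have gV: "g y \<in> U" if "y \<in> V" for y
    using *(2,6) that by (auto simp: homeomorphism_def)
  interpret inverse_operators V "\<lambda>y. frechet_derivative f (at (g y))" g'
  proof (rule inverse_operators.intro)
    fix y and v :: 'e assume y: "y \<in> V"
    show "linear (frechet_derivative f (at (g y)))" by (rule has_derivative_linear[OF d[OF gV[OF y]]])
    show "linear (g' y)" by (rule has_derivative_linear[OF g(1)[OF y]])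
    show "g' y (frechet_derivative f (at (g y)) v) = v"
      using g(2,3)[OF y] f'[OF gV[OF y]] by (metis bij_inv_eq_iff)
    show "frechet_derivative f (at (g y)) (g' y v) = v"
      using g(2,3)[OF y] f'[OF gV[OF y]] by (metis bij_inv_eq_iff)
  qed fact
  have "diff_times_on n V g" for n
  proof (induction n)
    case 0
    then show ?case
      by (auto intro!: continuous_at_imp_continuous_on has_derivative_continuous[OF g(1)])
  next
    case (Suc n)
    show ?case
    proof (rule diff_times_on_SucI[OF *(4) g(1)], assumption, rule diff_times_on_inverse_operator)
      fix w
      have "diff_times_on n U (\<lambda>x. frechet_derivative f (at x) w)"
        using smooth_on_frechet_const[OF f] by (simp add: smooth_on_def)
      from diff_times_on_compose[OF *(4) U(1) _ Suc this]
      show "diff_times_on n V (\<lambda>y. frechet_derivative f (at (g y)) w)"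
        using gV by blast
    qed
  qed
  with * show ?thesis by (intro that[of U' V g]) (auto simp: smooth_on_def)
qed

section \<open>Ordinary differential equations with parameters\<close>

text \<open>With times in \<open>(-2, 2)\<close> and Lipschitz constant \<open>1/8\<close>, the Picard operator contracts the plain supremum norm,
  and the a priori estimate still tolerates a perturbation of the right-hand side that doubles the constant.\<close>

abbreviation ode_time :: "real set" where "ode_time \<equiv> {-2<..<2}"

lemma onorm_scaleR_le: "norm v \<le> B \<Longrightarrow> onorm (\<lambda>h::real. h *\<^sub>R v) \<le> B"
proof (rule onorm_le)
  fix h :: real assume "norm v \<le> B"
  then show "norm (h *\<^sub>R v) \<le> B * norm h"
    using mult_left_mono[of "norm v" B "\<bar>h\<bar>"] by (simp add: mult.commute)
qed

text \<open>A substitute for Gronwall on a short interval. At a time \<open>s\<close> where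
  \<open>norm (v s)\<close> is largest, the mean value inequality gives
  \<open>norm (v s - v 0) \<le> 2 * (norm (v s) / 4 + r)\<close>, and the resulting half of
  \<open>norm (v s)\<close> is absorbed on the left.\<close>

lemma ode_estimate:
  fixes v :: "real \<Rightarrow> 'u::real_normed_vector"
  assumes a: "0 \<le> a" "a < 2"
    and v: "\<And>t. \<bar>t\<bar> \<le> a \<Longrightarrow> (v has_vector_derivative v' t) (at t within {-a..a})"
    and le: "\<And>t. \<bar>t\<bar> \<le> a \<Longrightarrow> norm (v' t) \<le> norm (v t) / 4 + r"
    and t: "\<bar>t\<bar> \<le> a"
  shows "norm (v t) \<le> 2 * norm (v 0) + 4 * r"
proof -
  have "continuous_on {-a..a} v"
    unfolding continuous_on_eq_continuous_within
  proof
    fix x assume "x \<in> {-a..a}"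
    then have "\<bar>x\<bar> \<le> a" by auto
    from has_vector_derivative_continuous[OF v[OF this]]
    show "continuous (at x within {-a..a}) v" .
  qed
  then have "continuous_on {-a..a} (\<lambda>t. norm (v t))" by (intro continuous_intros)
  then obtain s where s: "s \<in> {-a..a}" "\<And>t. t \<in> {-a..a} \<Longrightarrow> norm (v t) \<le> norm (v s)"
    using continuous_attains_sup[of "{-a..a}" "\<lambda>t. norm (v t)"] a by auto
  have r: "0 \<le> norm (v s) / 4 + r" 
    by (rule order_trans[OF norm_ge_zero le]) (use s(1) in auto)
  have "norm (v s - v 0) \<le> (norm (v s) / 4 + r) * norm (s - 0)"
  proof (rule differentiable_bound[of "{-a..a}" v "\<lambda>t h. h *\<^sub>R v' t"])
    fix x assume x: "x \<in> {-a..a}"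
    then show "(v has_derivative (\<lambda>h. h *\<^sub>R v' x)) (at x within {-a..a})"
      using v[of x] by (simp add: has_vector_derivative_def abs_le_iff)
    have "norm (v x) \<le> norm (v s)" by (rule s(2)[OF x])
    then have "norm (v' x) \<le> norm (v s) / 4 + r" using le[of x] x by (simp add: abs_le_iff)
    then show "onorm (\<lambda>h. h *\<^sub>R v' x) \<le> norm (v s) / 4 + r"
      by (rule onorm_scaleR_le)
  qed (use s a in auto)
  also have "\<dots> \<le> (norm (v s) / 4 + r) * 2"
    using s(1) a r by (intro mult_left_mono) auto
  finally have "norm (v s) \<le> norm (v 0) + norm (v s) / 2 + 2 * r"
    using norm_triangle_sub[of "v s" "v 0"] by (simp add: algebra_simps)
  moreover have "norm (v t) \<le> norm (v s)" using t by (intro s(2)) auto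
  ultimately show ?thesis by simp
qed

definition ode_solution :: "real set \<Rightarrow> (real \<Rightarrow> 'u \<Rightarrow> 'u) \<Rightarrow> 'u \<Rightarrow> (real \<Rightarrow> 'u::real_normed_vector) \<Rightarrow> bool" where
  "ode_solution I F w u \<longleftrightarrow> u 0 = w \<and> (\<forall>t\<in>I. (u has_vector_derivative F t (u t)) (at t))"

lemma ode_solution_unique:
  assumes u: "ode_solution {-b<..<b} F w u" and v: "ode_solution {-b<..<b} F w v" and b: "b \<le> 2"
    and lip: "\<And>t y z. t \<in> {-b<..<b} \<Longrightarrow> norm (F t y - F t z) \<le> norm (y - z) / 8"
    and t: "t \<in> {-b<..<b}"
  shows "u t = v t"
proof -
  have "norm (u t - v t) \<le> 2 * norm (u 0 - v 0) + 4 * 0"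
  proof (rule ode_estimate[where a = "\<bar>t\<bar>" and v' = "\<lambda>t. F t (u t) - F t (v t)"])
    fix s assume s: "\<bar>s\<bar> \<le> \<bar>t\<bar>"
    then have sb: "s \<in> {-b<..<b}" using t by auto
    show "((\<lambda>s. u s - v s) has_vector_derivative F s (u s) - F s (v s)) (at s within {- \<bar>t\<bar>..\<bar>t\<bar>})"
      using u v sb
      by (intro has_vector_derivative_diff; intro has_vector_derivative_at_within[where S = "{- \<bar>t\<bar>..\<bar>t\<bar>}"])
        (auto simp: ode_solution_def)
    show "norm (F s (u s) - F s (v s)) \<le> norm (u s - v s) / 4 + 0"
      using lip[OF sb, of "u s" "v s"] norm_ge_zero[of "u s - v s"] by linarith
  qed (use t b in auto)
  then show ?thesis using u v by (simp add: ode_solution_def)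
qed

lemma ode_solution_exists_compact:
  fixes F :: "real \<Rightarrow> 'u \<Rightarrow> 'u::euclidean_space"
  assumes a: "0 < a" "a < 2"
    and cont: "continuous_on ({-a..a} \<times> UNIV) (\<lambda>(t, y). F t y)"
    and lip: "\<And>t y z. t \<in> {-a..a} \<Longrightarrow> norm (F t y - F t z) \<le> norm (y - z) / 8"
  shows "\<exists>u. ode_solution {-a<..<a} F w u"
proof -
  \<comment> \<open>Both integrals start at the left end \<open>-a\<close>, which also covers
    negative times; subtracting the value at 0 restores the initial condition
    \<open>J y 0 = w\<close>.\<close>
  define J where "J y t = w + (integral {-a..t} (\<lambda>s. F s (y s)) - integral {-a..0} (\<lambda>s. F s (y s)))"
    for y :: "real \<Rightarrow> 'u" and t
  have J: "(J y has_vector_derivative F t (y t)) (at t within {-a..a})"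
    if "continuous_on {-a..a} y" "t \<in> {-a..a}" for y t
  proof -
    have c: "continuous_on {-a..a} (\<lambda>s. F s (y s))"
      using continuous_on_compose2[OF cont, of "{-a..a}" "\<lambda>s. (s, y s)"] that(1)
      by (simp add: continuous_on_Pair image_subset_iff)
    show ?thesis
      unfolding J_def[abs_def] using integral_has_vector_derivative[OF c that(2)]
      by (auto intro!: derivative_eq_intros)
  qed
  \<comment> \<open>Extending by the end values turns \<open>J y\<close> into a bounded continuous
    function on the whole line, so that the contraction acts on a complete metric space.\<close>
  have "\<exists>g::real \<Rightarrow>\<^sub>C 'u. (\<forall>t\<in>{-a..a}. g t = J y t) \<and> (\<forall>t. g t = J y (clamp (-a) a t))" for y :: "real \<Rightarrow>\<^sub>C 'u"
  proof -
    have "continuous_on (cbox (-a) a) (J y)"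
      by (auto simp: continuous_on_eq_continuous_within
        intro!: has_vector_derivative_continuous[OF J] continuous_on_apply_bcontfun)
    from continuous_on_cbox_bcontfunE[OF this] show ?thesis by (metis cbox_interval)
  qed
  then obtain \<Phi> :: "(real \<Rightarrow>\<^sub>C 'u) \<Rightarrow> (real \<Rightarrow>\<^sub>C 'u)"
    where \<Phi>: "\<And>y t. t \<in> {-a..a} \<Longrightarrow> \<Phi> y t = J y t" "\<And>y t. \<Phi> y t = J y (clamp (-a) a t)"
    by metis
  have "dist (\<Phi> y) (\<Phi> z) \<le> (1/4) * dist y z" for y z
  proof (rule dist_bound)
    fix t
    define s where "s = clamp (-a) a t"
    have s: "s \<in> {-a..a}" using clamp_in_interval[of "-a" a t] a by (simp add: s_def)
    \<comment> \<open>The difference \<open>J y - J z\<close> vanishes at 0 and has derivative at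
      most \<open>dist y z / 8\<close>; over a length below 2 this is a contraction by 1/4.\<close>
    have "norm ((J y s - J z s) - (J y 0 - J z 0)) \<le> (dist y z / 8) * norm (s - 0)"
    proof (rule differentiable_bound[of "{-a..a}" "\<lambda>t. J y t - J z t" "\<lambda>t h. h *\<^sub>R (F t (y t) - F t (z t))"])
      fix x assume x: "x \<in> {-a..a}"
      show "((\<lambda>t. J y t - J z t) has_derivative (\<lambda>h. h *\<^sub>R (F x (y x) - F x (z x)))) (at x within {-a..a})"
        unfolding has_vector_derivative_def[symmetric]
        by (intro has_vector_derivative_diff J continuous_on_apply_bcontfun x)
      have "norm (F x (y x) - F x (z x)) \<le> dist y z / 8"
        using lip[OF x, of "y x" "z x"] dist_bounded[of y x z] by (simp add: dist_norm)
      then show "onorm (\<lambda>h. h *\<^sub>R (F x (y x) - F x (z x))) \<le> dist y z / 8"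
        by (rule onorm_scaleR_le)
    qed (use s a in auto)
    also have "\<dots> \<le> (dist y z / 8) * 2" using s a by (intro mult_left_mono) auto
    finally show "dist (\<Phi> y t) (\<Phi> z t) \<le> (1/4) * dist y z"
      by (simp add: \<Phi>(2) s_def[symmetric] dist_norm J_def)
  qed
  then obtain y where y: "\<Phi> y = y" using banach_fix_type[of "1/4" \<Phi>] by auto
  have "ode_solution {-a<..<a} F w y"
    unfolding ode_solution_def
  proof safe
    show "y 0 = w" using \<Phi>(1)[of 0 y] a by (simp add: y J_def)
    fix t assume t: "t \<in> {-a<..<a}"
    have "(J y has_vector_derivative F t (y t)) (at t within {-a<..<a})"
      by (rule has_vector_derivative_within_subset[OF J]) (use t in auto)
    then have "(J y has_vector_derivative F t (y t)) (at t)"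
      using t by (simp add: at_within_open[OF t])
    then show "(y has_vector_derivative F t (y t)) (at t)"
      by (rule has_vector_derivative_transform_within_open[of _ _ _ "{-a<..<a}"])
        (use t \<Phi>(1)[of _ y] y in auto)
  qed
  then show ?thesis by blast
qed

text \<open>The Picard argument works on compact intervals. By uniqueness its solutions for the
  half-widths \<open>a < 2\<close> agree where they overlap, and they glue to one on the open
  interval.\<close>

lemma ode_solution_exists:
  fixes F :: "real \<Rightarrow> 'u \<Rightarrow> 'u::euclidean_space"
  assumes cont: "continuous_on (ode_time \<times> UNIV) (\<lambda>(t, y). F t y)"
    and lip: "\<And>t y z. t \<in> ode_time \<Longrightarrow> norm (F t y - F t z) \<le> norm (y - z) / 8"
  shows "\<exists>u. ode_solution ode_time F w u"
proof -
  have "\<exists>u. ode_solution {-a<..<a} F w u" if "0 < a" "a < 2" for a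
    by (rule ode_solution_exists_compact[OF that continuous_on_subset[OF cont] lip]) (use that in auto)
  then obtain y where y: "\<And>a. 0 < a \<Longrightarrow> a < 2 \<Longrightarrow> ode_solution {-a<..<a} F w (y a)" by metis
  have eq: "y a t = y b t" if "\<bar>t\<bar> < a" "a \<le> b" "b < 2" for a b t
  proof (rule ode_solution_unique[where b = a and F = F])
    show "ode_solution {-a<..<a} F w (y a)" using y[of a] that by auto
    show "ode_solution {-a<..<a} F w (y b)"
      using y[of b] that by (force simp: ode_solution_def)
    show "norm (F s z - F s z') \<le> norm (z - z') / 8" if "s \<in> {-a<..<a}" for s z z'
      by (rule lip) (use that \<open>a \<le> b\<close> \<open>b < 2\<close> in simp)
  qed (use that in auto)
  \<comment> \<open>The half-width midway between \<open>\<bar>t\<bar>\<close> and 2 puts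
    \<open>t\<close> inside an interval that is still admissible.\<close>
  define u where "u t = y ((\<bar>t\<bar> + 2) / 2) t" for t
  have u: "u t = y a t" if "\<bar>t\<bar> < a" "a < 2" for a t
  proof (cases "a \<le> (\<bar>t\<bar> + 2) / 2")
    case True
    show ?thesis unfolding u_def by (rule eq[symmetric]) (use True that in auto)
  next
    case False
    show ?thesis unfolding u_def by (rule eq) (use False that in auto)
  qed
  have "ode_solution ode_time F w u"
    unfolding ode_solution_def
  proof safe
    show "u 0 = w" using u[of 0 1] y[of 1] by (simp add: ode_solution_def)
    fix t :: real assume t: "t \<in> ode_time"
    define a where "a = (\<bar>t\<bar> + 2) / 2"
    have a: "\<bar>t\<bar> < a" "a < 2" using t by (auto simp: a_def)
    then have "(y a has_vector_derivative F t (u t)) (at t)"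
      using y[of a] u[OF a] by (auto simp: ode_solution_def abs_less_iff)
    then show "(u has_vector_derivative F t (u t)) (at t)"
      by (rule has_vector_derivative_transform_within_open[of _ _ _ "{-a<..<a}"])
        (use a u[of _ a] in auto)
  qed
  then show ?thesis by blast
qed

section \<open>Dependence of solutions on parameters\<close>

locale ode_family =
  fixes X :: "'z::euclidean_space set" and F :: "'z \<times> real \<times> 'u \<Rightarrow> 'u::euclidean_space"
    and w :: "'z \<Rightarrow> 'u" and u :: "'z \<times> real \<Rightarrow> 'u"
  assumes X: "open X"
    and lip: "x \<in> X \<Longrightarrow> t \<in> ode_time \<Longrightarrow> norm (F (x, t, y) - F (x, t, z)) \<le> norm (y - z) / 8"
    and sol: "x \<in> X \<Longrightarrow> ode_solution ode_time (\<lambda>t y. F (x, t, y)) (w x) (\<lambda>t. u (x, t))"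
begin

lemma initial: "x \<in> X \<Longrightarrow> u (x, 0) = w x"
  using sol by (simp add: ode_solution_def)

lemma derivative_time:
  "x \<in> X \<Longrightarrow> t \<in> ode_time \<Longrightarrow> ((\<lambda>t. u (x, t)) has_vector_derivative F (x, t, u (x, t))) (at t within S)"
  using sol by (auto simp: ode_solution_def intro: has_vector_derivative_at_within)

lemma continuous_time: "x \<in> X \<Longrightarrow> continuous_on ode_time (\<lambda>t. u (x, t))"
  by (auto intro!: continuous_at_imp_continuous_on has_vector_derivative_continuous derivative_time)

text \<open>The solution for \<open>x0\<close> solves the equation for \<open>x\<close> up to a
  defect which, by compactness of a closed time interval, is uniformly small for \<open>x\<close>
  near \<open>x0\<close>; \<open>ode_estimate\<close> turns the defect into a distance of
  solutions.\<close>

lemma continuous_solution: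
  assumes F: "continuous_on (X \<times> ode_time \<times> UNIV) F" and w: "continuous_on X w"
  shows "continuous_on (X \<times> ode_time) u"
proof (rule continuous_at_imp_continuous_on, rule ballI)
  fix p assume "p \<in> X \<times> ode_time"
  then obtain x0 t0 where p: "p = (x0, t0)" and x0: "x0 \<in> X" and t0: "t0 \<in> ode_time" by auto
  define a where "a = (\<bar>t0\<bar> + 2) / 2"
  have a: "\<bar>t0\<bar> < a" "a < 2" "0 \<le> a" using t0 by (auto simp: a_def)
  have ca: "continuous_on (X \<times> {-a..a}) (\<lambda>(x, t). F (x, t, u (x0, t)))"
  proof -
    have "continuous_on (X \<times> {-a..a}) (\<lambda>q. u (x0, snd q))"
      by (rule continuous_on_compose2[OF continuous_time[OF x0]]) (use a in \<open>auto intro: continuous_intros\<close>)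
    then have "continuous_on (X \<times> {-a..a}) (\<lambda>q. F (fst q, snd q, u (x0, snd q)))"
      by (intro continuous_on_compose2[OF F]) (use a in \<open>auto intro!: continuous_intros\<close>)
    then show ?thesis by (simp add: split_beta)
  qed
  show "isCont u p"
    unfolding p continuous_at_eps_delta
  proof (intro allI impI)
    fix e :: real assume e: "e > 0"
    \<comment> \<open>A defect of \<open>e / 16\<close> and initial values within
      \<open>e / 8\<close> give \<open>2 * (e / 8) + 4 * (e / 16) = e / 2\<close> in the estimate;
      continuity in time contributes the remaining part.\<close>
    obtain X0 where X0: "x0 \<in> X0" "open X0"
      "\<forall>x\<in>X0 \<inter> X. \<forall>t\<in>{-a..a}. dist (F (x, t, u (x0, t))) (F (x0, t, u (x0, t))) \<le> e / 16"
      using continuous_on_prod_compactE[OF ca compact_Icc x0, of "e / 16"] e by auto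
    have cw: "isCont w x0" using w X x0 by (simp add: continuous_on_eq_continuous_at)
    obtain X1 where X1: "x0 \<in> X1" "open X1" "\<And>x. x \<in> X1 \<Longrightarrow> dist (w x) (w x0) < e / 8"
      using cw e unfolding continuous_at_open
      by (metis (no_types, lifting) centre_in_ball dist_commute mem_ball open_ball zero_less_divide_iff zero_less_numeral)
    have ct: "isCont (\<lambda>t. u (x0, t)) t0"
      by (rule has_vector_derivative_continuous[OF derivative_time[OF x0 t0]])
    obtain d1 where d1: "d1 > 0" "\<And>t. dist t t0 < d1 \<Longrightarrow> dist (u (x0, t)) (u (x0, t0)) < e / 4"
      using ct e unfolding continuous_at_eps_delta by (metis (no_types) zero_less_divide_iff zero_less_numeral)
    obtain d2 where d2: "d2 > 0" "ball x0 d2 \<subseteq> X0 \<inter> X1 \<inter> X"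
      using X0(1,2) X1(1,2) X x0 by (metis IntI open_Int open_contains_ball)
    have est: "norm (u (x, t) - u (x0, t)) \<le> e / 2" if x: "x \<in> X0 \<inter> X1 \<inter> X" and t: "\<bar>t\<bar> \<le> a" for x t
    proof -
      have "norm (u (x, t) - u (x0, t)) \<le> 2 * norm (u (x, 0) - u (x0, 0)) + 4 * (e / 16)"
      proof (rule ode_estimate[where v' = "\<lambda>t. F (x, t, u (x, t)) - F (x0, t, u (x0, t))", OF a(3,2) _ _ t])
        fix s assume s: "\<bar>s\<bar> \<le> a"
        then have s': "s \<in> ode_time" "s \<in> {-a..a}" using a by auto
        show "((\<lambda>t. u (x, t) - u (x0, t)) has_vector_derivative F (x, s, u (x, s)) - F (x0, s, u (x0, s)))
            (at s within {-a..a})"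
          by (intro has_vector_derivative_diff derivative_time s') (use x x0 in auto)
        have "F (x, s, u (x, s)) - F (x0, s, u (x0, s)) =
            (F (x, s, u (x, s)) - F (x, s, u (x0, s))) + (F (x, s, u (x0, s)) - F (x0, s, u (x0, s)))" by simp
        also have "norm \<dots> \<le> norm (u (x, s) - u (x0, s)) / 8 + e / 16"
          by (rule norm_triangle_le[OF add_mono[OF lip]])
            (use X0(3) x s' in \<open>auto simp: dist_norm\<close>)
        finally show "norm (F (x, s, u (x, s)) - F (x0, s, u (x0, s))) \<le> norm (u (x, s) - u (x0, s)) / 4 + e / 16"
          using norm_ge_zero[of "u (x, s) - u (x0, s)"] by linarith
      qed
      also have "\<dots> \<le> e / 2" using X1(3)[of x] x x0 by (simp add: initial dist_norm)
      finally show ?thesis .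
    qed
    show "\<exists>d>0. \<forall>q. dist q (x0, t0) < d \<longrightarrow> dist (u q) (u (x0, t0)) < e"
    proof (intro exI conjI allI impI)
      define d where "d = min d1 (min d2 (a - \<bar>t0\<bar>))"
      show "0 < d" using d1 d2 a by (simp add: d_def)
      fix q assume q: "dist q (x0, t0) < d"
      obtain x t where q': "q = (x, t)" by (cases q)
      have "dist x x0 < d" "dist t t0 < d"
        using q dist_fst_le[of q "(x0, t0)"] dist_snd_le[of q "(x0, t0)"] by (auto simp: q')
      then have x: "x \<in> X0 \<inter> X1 \<inter> X" and t: "\<bar>t\<bar> \<le> a" and tt: "dist (u (x0, t)) (u (x0, t0)) < e / 4"
        using d2 d1(2)[of t] by (auto simp: d_def dist_commute dist_real_def)
      have "dist (u (x, t)) (u (x0, t0)) \<le> norm (u (x, t) - u (x0, t)) + dist (u (x0, t)) (u (x0, t0))"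
        by (metis dist_norm dist_triangle)
      also have "\<dots> < e / 2 + e / 2" using est[OF x t] tt e by linarith
      finally show "dist (u q) (u (x0, t0)) < e" by (simp add: q')
    qed
  qed
qed

text \<open>The Lipschitz constant survives linearisation, so the linearised equation meets the same
  existence and uniqueness hypotheses.\<close>

lemma derivative_third_argument_bound:
  assumes x: "x \<in> X" and t: "t \<in> ode_time" and d: "(F has_derivative F') (at (x, t, y0))"
  shows "norm (F' (0, 0, y)) \<le> norm y / 8"
proof -
  have "((\<lambda>s. F (x, t, y0 + s *\<^sub>R y)) has_derivative (\<lambda>s. F' (0, 0, s *\<^sub>R y))) (at (0::real))"
    by (rule has_derivative_compose[of "\<lambda>s. (x, t, y0 + s *\<^sub>R y)" _ _ _ F])
      (use d in \<open>auto intro!: derivative_eq_intros\<close>)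
  moreover have "F' (0, 0, s *\<^sub>R y) = s *\<^sub>R F' (0, 0, y)" for s
    using linear_scale[OF has_derivative_linear[OF d], of s "(0, 0, y)"] by simp
  ultimately have d0: "((\<lambda>s. F (x, t, y0 + s *\<^sub>R y)) has_derivative (\<lambda>s. s *\<^sub>R F' (0, 0, y))) (at 0)"
    by simp
  show ?thesis
  proof (rule field_le_epsilon)
    fix e :: real assume "0 < e"
    then obtain \<delta> where \<delta>: "\<delta> > 0" "\<And>s. norm (s - 0) < \<delta> \<Longrightarrow> norm (F (x, t, y0 + s *\<^sub>R y) - F (x, t, y0 + 0 *\<^sub>R y)
        - (s - 0) *\<^sub>R F' (0, 0, y)) \<le> e * norm (s - 0)"
      using d0[unfolded has_derivative_at_alt] by metis
    define s where "s = \<delta> / 2"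
    have s: "s > 0" "norm (s - 0) < \<delta>" using \<delta>(1) by (auto simp: s_def)
    have "norm (s *\<^sub>R F' (0, 0, y)) \<le> norm (F (x, t, y0 + s *\<^sub>R y) - F (x, t, y0)) + e * s"
      using \<delta>(2)[OF s(2)] s(1) norm_triangle_sub[of "s *\<^sub>R F' (0, 0, y)" "F (x, t, y0 + s *\<^sub>R y) - F (x, t, y0)"]
      by (simp add: norm_minus_commute)
    also have "norm (F (x, t, y0 + s *\<^sub>R y) - F (x, t, y0)) \<le> s * norm y / 8"
      using lip[OF x t, of "y0 + s *\<^sub>R y" y0] s(1) by simp
    finally have "s * norm (F' (0, 0, y)) \<le> s * (norm y / 8 + e)"
      using s(1) by (simp add: algebra_simps)
    then show "norm (F' (0, 0, y)) \<le> norm y / 8 + e" using s(1) by simp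
  qed
qed

text \<open>The derivative is continuous in operator norm, uniformly along the part of the
  trajectory over the compact interval \<open>\<bar>t\<bar> \<le> a\<close>, so one \<open>d\<close>
  serves all these times.\<close>

lemma uniform_linearization:
  assumes F: "diff_times_on 1 (X \<times> ode_time \<times> UNIV) F" and x0: "x0 \<in> X"
    and u: "continuous_on (X \<times> ode_time) u" and a: "a < 2" and e: "0 < e"
  shows "\<exists>d>0. \<forall>h k t. norm h < d \<longrightarrow> norm k < d \<longrightarrow> \<bar>t\<bar> \<le> a \<longrightarrow>
    norm (F (x0 + h, t, u (x0, t) + k) - F (x0, t, u (x0, t))
      - frechet_derivative F (at (x0, t, u (x0, t))) (h, 0, k)) \<le> e * (norm h + norm k)"
proof -
  let ?S = "X \<times> ode_time \<times> (UNIV :: 'u set)"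
  let ?F' = "\<lambda>p. frechet_derivative F (at p)"
  have F': "diff_times_on (Suc 0) ?S F" using F by simp
  have dF: "(F has_derivative ?F' p) (at p)" if "p \<in> ?S" for p
    by (rule diff_times_on_has_derivative[OF F' that])
  \<comment> \<open>The derivative in the parameter and state directions, with time frozen. As a
    bounded operator on a finite-dimensional space it is continuous as soon as its values on fixed
    vectors are.\<close>
  define D where "D p = Blinfun (\<lambda>q :: 'z \<times> 'u. ?F' p (fst q, 0, snd q))" for p
  have D: "blinfun_apply (D p) q = ?F' p (fst q, 0, snd q)" if "p \<in> ?S" for p q
    unfolding D_def
    by (subst bounded_linear_Blinfun_apply)
      (auto intro!: bounded_linear_compose[OF has_derivative_bounded_linear[OF dF[OF that]]]
        bounded_linear_Pair bounded_linear_fst bounded_linear_snd bounded_linear_zero)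
  have "continuous_on ?S D"
  proof (rule continuous_on_blinfun_componentwise)
    fix i
    have "continuous_on ?S (\<lambda>p. ?F' p (fst i, 0, snd i))" using F' by simp
    then show "continuous_on ?S (\<lambda>p. blinfun_apply (D p) i)"
      by (rule continuous_on_eq) (simp add: D)
  qed
  then have "continuous_on ({q. x0 + fst q \<in> X} \<times> {-a..a}) (\<lambda>q. D (x0 + fst (fst q), snd q, u (x0, snd q) + snd (fst q)))"
    by (rule continuous_on_compose2)
      (use a x0 in \<open>auto intro!: continuous_intros continuous_on_compose2[OF u]\<close>)
  from continuous_on_prod_compactE[OF this compact_Icc, of 0 e] e x0
  obtain Q where Q: "0 \<in> Q" "open Q" "\<forall>q\<in>Q \<inter> {q. x0 + fst q \<in> X}. \<forall>t\<in>{-a..a}.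
      dist (D (x0 + fst q, t, u (x0, t) + snd q)) (D (x0, t, u (x0, t))) \<le> e"
    by auto
  have "open {q :: 'z \<times> 'u. x0 + fst q \<in> X}"
    using open_vimage[OF X, of "\<lambda>q :: 'z \<times> 'u. x0 + fst q"] by (simp add: vimage_def continuous_intros)
  then obtain r where r: "r > 0" "ball 0 r \<subseteq> Q \<inter> {q. x0 + fst q \<in> X}"
    using Q(1,2) x0 by (metis (no_types, lifting) IntI add.right_neutral fst_zero mem_Collect_eq open_Int open_contains_ball)
  show ?thesis
  proof (intro exI[of _ "r / 2"] conjI allI impI)
    fix h :: 'z and k :: 'u and t
    assume h: "norm h < r / 2" and k: "norm k < r / 2" and t: "\<bar>t\<bar> \<le> a"
    have "norm (h, k) \<le> norm h + norm k" by (rule norm_Pair_le)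
    then have hk: "(h, k) \<in> ball 0 r" using h k by simp
    have tT: "t \<in> ode_time" "t \<in> {-a..a}" using t a by auto
    let ?g = "\<lambda>q. F (x0 + fst q, t, u (x0, t) + snd q)"
    let ?g' = "\<lambda>q. blinfun_apply (D (x0 + fst q, t, u (x0, t) + snd q))"
    have "norm (?g (h, k) - ?g 0 - ?g' 0 ((h, k) - 0)) \<le> norm ((h, k) - 0) * e"
    proof (rule differentiable_bound_linearization[where S = "ball 0 r"])
      show "0 + s *\<^sub>R ((h, k) - 0) \<in> ball 0 r" if "s \<in> {0..1}" for s
      proof -
        have "norm (s *\<^sub>R (h, k)) \<le> 1 * norm (h, k)"
          unfolding norm_scaleR using that by (intro mult_right_mono) auto
        then show ?thesis using hk by simp
      qed
      show "(?g has_derivative ?g' q) (at q within ball 0 r)" if "q \<in> ball 0 r" for q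
      proof (rule has_derivative_at_withinI)
        have p: "(x0 + fst q, t, u (x0, t) + snd q) \<in> ?S" using r that tT by auto
        have "(?g has_derivative (\<lambda>v. ?F' (x0 + fst q, t, u (x0, t) + snd q) (fst v, 0, snd v))) (at q)"
          by (rule has_derivative_compose[of "\<lambda>q. (x0 + fst q, t, u (x0, t) + snd q)" _ _ _ F, OF _ dF[OF p]])
            (auto intro!: derivative_eq_intros)
        moreover have "?g' q = (\<lambda>v. ?F' (x0 + fst q, t, u (x0, t) + snd q) (fst v, 0, snd v))"
          by (rule ext) (rule D[OF p])
        ultimately show "(?g has_derivative ?g' q) (at q)" by simp
      qed
      show "onorm (?g' q - ?g' 0) \<le> e" if "q \<in> ball 0 r" for q
      proof -
        have "norm (D (x0 + fst q, t, u (x0, t) + snd q) - D (x0, t, u (x0, t))) \<le> e"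
          using Q(3) r(2) that tT(2) unfolding dist_norm by blast
        then show ?thesis
          by (simp add: norm_blinfun.rep_eq minus_blinfun.rep_eq fun_diff_def)
      qed
    qed (use r in auto)
    also have "\<dots> \<le> e * (norm h + norm k)"
      using norm_Pair_le[of h k] e by (simp add: mult.commute mult_left_mono)
    finally show "norm (F (x0 + h, t, u (x0, t) + k) - F (x0, t, u (x0, t)) - ?F' (x0, t, u (x0, t)) (h, 0, k))
        \<le> e * (norm h + norm k)"
      using x0 tT by (simp add: D)
  qed (use r in simp)
qed

text \<open>The error \<open>u (x0 + h, t) - u (x0, t) - W h t\<close> satisfies a differential
  inequality whose defect is a small multiple of \<open>norm h\<close>, and so does its initial
  value. By \<open>ode_estimate\<close> the error itself is small compared with
  \<open>h\<close>.\<close>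

lemma has_derivative_parameter:
  assumes F: "diff_times_on 1 (X \<times> ode_time \<times> UNIV) F" and w: "diff_times_on 1 X w" and x0: "x0 \<in> X"
    and W: "\<And>v. ode_solution ode_time (\<lambda>t y. frechet_derivative F (at (x0, t, u (x0, t))) (v, 0, y))
        (frechet_derivative w (at x0) v) (W v)"
    and t0: "t0 \<in> ode_time"
  shows "((\<lambda>x. u (x, t0)) has_derivative (\<lambda>v. W v t0)) (at x0)"
proof -
  let ?S = "X \<times> ode_time \<times> (UNIV :: 'u set)"
  let ?F' = "\<lambda>p. frechet_derivative F (at p)"
  have F': "diff_times_on (Suc 0) ?S F" and w': "diff_times_on (Suc 0) X w" using F w by simp_all
  have contF: "continuous_on ?S F" using diff_times_on_SucD[OF F'] by simp
  have contw: "continuous_on X w" using diff_times_on_SucD[OF w'] by simp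
  note contu = continuous_solution[OF contF contw]
  have dF: "(F has_derivative ?F' p) (at p)" if "p \<in> ?S" for p
    by (rule diff_times_on_has_derivative[OF F' that])
  have dw: "(w has_derivative frechet_derivative w (at x0)) (at x0)"
    by (rule diff_times_on_has_derivative[OF w' x0])
  define G where "G v t y = ?F' (x0, t, u (x0, t)) (v, 0, y)" for v t y
  have linF: "linear (?F' (x0, t, u (x0, t)))" if "t \<in> ode_time" for t
    by (rule has_derivative_linear[OF dF]) (use that x0 in auto)
  have G_split: "?F' (x0, t, u (x0, t)) (v, 0, y) - ?F' (x0, t, u (x0, t)) (v, 0, z) = ?F' (x0, t, u (x0, t)) (0, 0, y - z)"
    if "t \<in> ode_time" for t v y z
    by (simp add: linear_diff[OF linF[OF that], symmetric])
  have G0: "norm (?F' (x0, t, u (x0, t)) (0, 0, y)) \<le> norm y / 8" if t: "t \<in> ode_time" for t y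
    by (rule derivative_third_argument_bound[OF x0 t dF]) (use t x0 in auto)
  have lipG: "norm (G v t y - G v t z) \<le> norm (y - z) / 8" if "t \<in> ode_time" for v t y z
    unfolding G_def G_split[OF that] by (rule G0[OF that])
  have solW: "ode_solution {-2<..<2} (G v) (frechet_derivative w (at x0) v) (W v)" for v
    using W[of v] by (simp add: G_def[abs_def])
  have dW: "(W v has_vector_derivative G v t (W v t)) (at t)" if "t \<in> ode_time" for v t
    using solW[of v] that by (simp add: ode_solution_def)
  have linw: "linear (frechet_derivative w (at x0))" by (rule has_derivative_linear[OF dw])
  \<comment> \<open>Linearity of \<open>W\<close> in the direction comes from uniqueness: sums and
    multiples of solutions solve the equation for the combined direction.\<close>
  have addW: "W (v + v') t = W v t + W v' t" if t: "t \<in> ode_time" for v v' t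
  proof (rule ode_solution_unique[OF solW _ _ lipG t])
    show "ode_solution {-2<..<2} (G (v + v')) (frechet_derivative w (at x0) (v + v')) (\<lambda>t. W v t + W v' t)"
      unfolding ode_solution_def
    proof (intro conjI ballI)
      show "W v 0 + W v' 0 = frechet_derivative w (at x0) (v + v')"
        using solW[of v] solW[of v'] by (simp add: ode_solution_def linear_add[OF linw])
      fix t :: real assume t: "t \<in> {-2<..<2}"
      have "G (v + v') t (W v t + W v' t) = G v t (W v t) + G v' t (W v' t)"
        unfolding G_def by (simp add: linear_add[OF linF[OF t], symmetric])
      then show "((\<lambda>t. W v t + W v' t) has_vector_derivative G (v + v') t (W v t + W v' t)) (at t)"
        using has_vector_derivative_add[OF dW[OF t] dW[OF t]] by simp
    qed
  qed auto
  have scaleW: "W (c *\<^sub>R v) t = c *\<^sub>R W v t" if t: "t \<in> ode_time" for c v t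
  proof (rule ode_solution_unique[OF solW _ _ lipG t])
    show "ode_solution {-2<..<2} (G (c *\<^sub>R v)) (frechet_derivative w (at x0) (c *\<^sub>R v)) (\<lambda>t. c *\<^sub>R W v t)"
      unfolding ode_solution_def
    proof (intro conjI ballI)
      show "c *\<^sub>R W v 0 = frechet_derivative w (at x0) (c *\<^sub>R v)"
        using solW[of v] by (simp add: ode_solution_def linear_scale[OF linw])
      fix t :: real assume t: "t \<in> {-2<..<2}"
      have "G (c *\<^sub>R v) t (c *\<^sub>R W v t) = c *\<^sub>R G v t (W v t)"
        unfolding G_def by (simp add: linear_scale[OF linF[OF t], symmetric])
      then show "((\<lambda>t. c *\<^sub>R W v t) has_vector_derivative G (c *\<^sub>R v) t (c *\<^sub>R W v t)) (at t)"
        using bounded_linear.has_vector_derivative[OF bounded_linear_scaleR_right dW[OF t], of c] by simp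
    qed
  qed auto
  have linW: "linear (\<lambda>v. W v t)" if "t \<in> ode_time" for t
    by (intro linearI addW scaleW that)
  define a where "a = (\<bar>t0\<bar> + 2) / 2"
  have a: "\<bar>t0\<bar> \<le> a" "a < 2" "0 \<le> a" using t0 by (auto simp: a_def)
  have T: "t \<in> ode_time" if "\<bar>t\<bar> \<le> a" for t using that a by auto
  \<comment> \<open>By linearity in \<open>v\<close> it suffices to bound the finitely many
    \<open>W b\<close>, each continuous on a compact interval.\<close>
  obtain K where K: "K > 0" "\<And>v t. \<bar>t\<bar> \<le> a \<Longrightarrow> norm (W v t) \<le> K * norm v"
  proof -
    have "\<exists>k. \<forall>t\<in>{-a..a}. norm (W b t) \<le> k" for b
    proof -
      have "continuous_on {-a..a} (W b)"
        using dW a by (intro continuous_at_imp_continuous_on ballI has_vector_derivative_continuous[OF dW]) auto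
      from compact_imp_bounded[OF compact_continuous_image[OF this compact_Icc]]
      show ?thesis by (auto simp: bounded_iff)
    qed
    then obtain k where k: "\<And>b t. t \<in> {-a..a} \<Longrightarrow> norm (W b t) \<le> k b" by metis
    have "norm (W v t) \<le> (\<Sum>b\<in>Basis. k b) * norm v" if t: "\<bar>t\<bar> \<le> a" for v t
    proof -
      have "norm (W v t) = norm (\<Sum>b\<in>Basis. (v \<bullet> b) *\<^sub>R W b t)"
        by (subst linear_euclidean_sum[OF linW[OF T[OF t]], of v]) simp
      also have "\<dots> \<le> (\<Sum>b\<in>Basis. norm v * k b)"
      proof (rule sum_norm_le)
        fix b :: 'z assume "b \<in> Basis"
        then have "\<bar>v \<bullet> b\<bar> * norm (W b t) \<le> norm v * k b"
          using t by (intro mult_mono Basis_le_norm k) auto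
        then show "norm ((v \<bullet> b) *\<^sub>R W b t) \<le> norm v * k b" by simp
      qed
      finally show ?thesis by (simp add: sum_distrib_left mult.commute)
    qed
    moreover have "(\<Sum>b\<in>Basis. k b) * norm v \<le> (\<bar>\<Sum>b\<in>Basis. k b\<bar> + 1) * norm v" for v :: 'z
      by (intro mult_right_mono) auto
    ultimately show ?thesis
      by (intro that[of "\<bar>\<Sum>b\<in>Basis. k b\<bar> + 1"]) (auto intro: order_trans)
  qed
  show ?thesis
    unfolding has_derivative_at_alt
  proof (intro conjI allI impI)
    show "bounded_linear (\<lambda>v. W v t0)" using linW[OF t0] by (simp add: linear_conv_bounded_linear)
    fix e :: real assume e: "0 < e"
    \<comment> \<open>The bound 1/8, added to the Lipschitz constant 1/8, uses up the 1/4 allowed by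
      \<open>ode_estimate\<close>; the second bound makes the defect contribute at most
      \<open>e / 2 * norm h\<close>.\<close>
    define \<eta> where "\<eta> = min (1/8) (e / (8 * (1 + K)))"
    have \<eta>: "0 < \<eta>" using e K(1) by (simp add: \<eta>_def)
    have \<eta>8: "\<eta> \<le> 1/8" and "\<eta> \<le> e / (8 * (1 + K))"
      unfolding \<eta>_def by (rule min.cobounded1, rule min.cobounded2)
    then have \<eta>': "8 * (\<eta> * (1 + K)) \<le> e"
      using K(1) by (simp add: pos_le_divide_eq mult.left_commute)
    obtain d1 where d1: "d1 > 0" "\<And>h k t. norm h < d1 \<Longrightarrow> norm k < d1 \<Longrightarrow> \<bar>t\<bar> \<le> a \<Longrightarrow>
        norm (F (x0 + h, t, u (x0, t) + k) - F (x0, t, u (x0, t)) - ?F' (x0, t, u (x0, t)) (h, 0, k))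
          \<le> \<eta> * (norm h + norm k)"
      using uniform_linearization[OF F x0 contu a(2) \<eta>] by metis
    obtain d2 where d2: "d2 > 0" "\<And>h t. norm h < d2 \<Longrightarrow> \<bar>t\<bar> \<le> a \<Longrightarrow>
        x0 + h \<in> X \<and> norm (u (x0 + h, t) - u (x0, t)) < d1"
    proof -
      have "continuous_on (X \<times> {-a..a}) u" by (rule continuous_on_subset[OF contu]) (use a in auto)
      from continuous_on_prod_compactE[OF this compact_Icc x0, of "d1 / 2"] d1(1)
      obtain X0 where X0: "x0 \<in> X0" "open X0" "\<forall>x\<in>X0 \<inter> X. \<forall>t\<in>{-a..a}. dist (u (x, t)) (u (x0, t)) \<le> d1 / 2"
        by auto
      obtain d where "d > 0" "ball x0 d \<subseteq> X0 \<inter> X"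
        using X0 X x0 by (metis IntI open_Int open_contains_ball)
      then have in_X: "x0 + h \<in> X0 \<inter> X" if "norm h < d" for h
        using that by (auto simp: subset_iff dist_norm)
      show ?thesis
      proof (rule that[OF \<open>d > 0\<close>])
        fix h :: 'z and t assume h: "norm h < d" and t: "\<bar>t\<bar> \<le> a"
        have "dist (u (x0 + h, t)) (u (x0, t)) \<le> d1 / 2"
          using X0(3) in_X[OF h] t by (simp add: abs_le_iff)
        then show "x0 + h \<in> X \<and> norm (u (x0 + h, t) - u (x0, t)) < d1"
          using in_X[OF h] d1(1) by (simp add: dist_norm)
      qed
    qed
    have "0 < e / 4" using e by simp
    with dw[unfolded has_derivative_at_alt] obtain d3 where d3: "d3 > 0" and
      d3': "\<And>y. norm (y - x0) < d3 \<Longrightarrow>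
        norm (w y - w x0 - frechet_derivative w (at x0) (y - x0)) \<le> e / 4 * norm (y - x0)"
      by blast
    have w_est: "norm (w (x0 + h) - w x0 - frechet_derivative w (at x0) h) \<le> e / 4 * norm h" if "norm h < d3" for h
      using d3'[of "x0 + h"] that by simp
    show "\<exists>d>0. \<forall>x. norm (x - x0) < d \<longrightarrow>
        norm (u (x, t0) - u (x0, t0) - W (x - x0) t0) \<le> e * norm (x - x0)"
    proof (intro exI[of _ "min d1 (min d2 d3)"] conjI allI impI)
      show "0 < min d1 (min d2 d3)" using d1 d2 d3 by simp
      fix x assume "norm (x - x0) < min d1 (min d2 d3)"
      moreover define h where "h = x - x0"
      ultimately have h: "norm h < d1" "norm h < d2" "norm h < d3" and x: "x = x0 + h" by auto
      let ?\<delta> = "\<lambda>t. u (x0 + h, t) - u (x0, t) - W h t"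
      have "norm (?\<delta> t0) \<le> 2 * norm (?\<delta> 0) + 4 * (\<eta> * (1 + K) * norm h)"
      proof (rule ode_estimate[where v' = "\<lambda>t. F (x0 + h, t, u (x0 + h, t)) - F (x0, t, u (x0, t)) - G h t (W h t)",
          OF a(3,2) _ _ a(1)])
        fix t assume t: "\<bar>t\<bar> \<le> a"
        show "(?\<delta> has_vector_derivative F (x0 + h, t, u (x0 + h, t)) - F (x0, t, u (x0, t)) - G h t (W h t))
            (at t within {-a..a})"
          using d2(2)[OF h(2) t] x0 T[OF t]
          by (intro has_vector_derivative_diff derivative_time has_vector_derivative_at_within[OF dW]) auto
        \<comment> \<open>The true increment. Linearising at \<open>k\<close> leaves the remainder
          controlled by \<open>d1\<close> and the derivative applied to \<open>k - W h t\<close>,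
          which is the error itself.\<close>
        define k where "k = u (x0 + h, t) - u (x0, t)"
        have k: "norm k < d1" using d2(2)[OF h(2) t] by (simp add: k_def)
        have W': "norm (W h t) \<le> K * norm h" by (rule K(2)[OF t])
        have k_le: "norm k \<le> norm (?\<delta> t) + K * norm h"
          using norm_triangle_sub[of k "W h t"] W' by (simp add: k_def)
        have "G h t k - G h t (W h t) = ?F' (x0, t, u (x0, t)) (0, 0, k - W h t)"
          unfolding G_def by (rule G_split[OF T[OF t]])
        then have "F (x0 + h, t, u (x0 + h, t)) - F (x0, t, u (x0, t)) - G h t (W h t) =
            (F (x0 + h, t, u (x0, t) + k) - F (x0, t, u (x0, t)) - G h t k) + ?F' (x0, t, u (x0, t)) (0, 0, ?\<delta> t)"
          by (simp add: k_def algebra_simps)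
        also have "norm \<dots> \<le> \<eta> * (norm h + norm k) + norm (?\<delta> t) / 8"
          using d1(2)[OF h(1) k t] G0[OF T[OF t]] by (intro norm_triangle_le add_mono) (auto simp: G_def)
        also have "\<dots> \<le> \<eta> * (norm h + (norm (?\<delta> t) + K * norm h)) + norm (?\<delta> t) / 8"
          using k_le \<eta> by (intro add_mono mult_left_mono) auto
        also have "\<dots> = \<eta> * norm (?\<delta> t) + norm (?\<delta> t) / 8 + \<eta> * (1 + K) * norm h"
          by (simp add: algebra_simps)
        also have "\<dots> \<le> 1/8 * norm (?\<delta> t) + norm (?\<delta> t) / 8 + \<eta> * (1 + K) * norm h"
          using \<eta>8 by (intro add_right_mono mult_right_mono) auto
        finally show "norm (F (x0 + h, t, u (x0 + h, t)) - F (x0, t, u (x0, t)) - G h t (W h t))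
            \<le> norm (?\<delta> t) / 4 + \<eta> * (1 + K) * norm h"
          by simp
      qed
      also have "?\<delta> 0 = w (x0 + h) - w x0 - frechet_derivative w (at x0) h"
        using d2(2)[OF h(2), of 0] a(3) solW[of h] x0 by (simp add: initial ode_solution_def)
      also have "2 * norm (w (x0 + h) - w x0 - frechet_derivative w (at x0) h) + 4 * (\<eta> * (1 + K) * norm h)
          \<le> 2 * (e / 4 * norm h) + e / 2 * norm h"
        using w_est[OF h(3)] mult_right_mono[OF \<eta>', of "norm h"] by (simp add: algebra_simps)
      finally show "norm (u (x, t0) - u (x0, t0) - W (x - x0) t0) \<le> e * norm (x - x0)"
        by (simp add: x)
    qed
  qed
qed

end

text \<open>The derivative of \<open>u\<close> in the direction of a parameter \<open>v\<close> solves an equation of the same kind, with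
  right-hand side \<open>G v\<close>, so that the induction stays within one type.\<close>

theorem diff_times_on_ode_solution:
  fixes F :: "'z::euclidean_space \<times> real \<times> 'u \<Rightarrow> 'u::euclidean_space"
  assumes "diff_times_on n (X \<times> ode_time \<times> UNIV) F" "diff_times_on n X w" "ode_family X F w u"
  shows "diff_times_on n (X \<times> ode_time) u"
  using assms
proof (induction n arbitrary: F w u)
  case 0
  then show ?case using ode_family.continuous_solution by auto
next
  case (Suc n)
  interpret ode_family X F w u by fact
  let ?S = "X \<times> ode_time \<times> (UNIV :: 'u set)"
  let ?F' = "\<lambda>p. frechet_derivative F (at p)"
  let ?G = "\<lambda>v (x, t, y). ?F' (x, t, u (x, t)) (v, 0 :: real, y)"
  have S: "open ?S" and XT: "open (X \<times> ode_time)" using X by (simp_all add: open_Times)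
  have Fn: "diff_times_on n ?S F" and wn: "diff_times_on n X w" using Suc.prems diff_times_on_SucD by blast+
  \<comment> \<open>The linearised right-hand side is evaluated along \<open>u\<close>, so the
    regularity of \<open>u\<close> at order n is needed before that of its derivative.\<close>
  have un: "diff_times_on n (X \<times> ode_time) u" by (rule Suc.IH[OF Fn wn Suc.prems(3)])
  have F1: "diff_times_on 1 ?S F" and w1: "diff_times_on 1 X w"
    by (rule diff_times_on_le[OF _ Suc.prems(1)] diff_times_on_le[OF _ Suc.prems(2)]; simp)+
  have dF: "(F has_derivative ?F' p) (at p)" if "p \<in> ?S" for p
    by (rule diff_times_on_has_derivative[OF Suc.prems(1) that])
  have F'n: "diff_times_on n ?S (\<lambda>p. ?F' p b)" for b
    using Suc.prems(1) unfolding diff_times_on.simps by blast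
  have proj: "diff_times_on n ?S (\<lambda>p. fst p)" "diff_times_on n ?S (\<lambda>p. fst (snd p))"
      "diff_times_on n ?S (\<lambda>p. snd (snd p))"
    by (rule diff_times_on_bounded_linear[OF S] bounded_linear_fst bounded_linear_snd
      bounded_linear_fst_comp bounded_linear_snd_comp)+
  have inner: "diff_times_on n ?S (\<lambda>p. (fst p, fst (snd p), u (fst p, fst (snd p))))"
    by (intro diff_times_on_Pair S proj diff_times_on_compose[OF S XT _ _ un]) auto
  have G: "diff_times_on n ?S (?G v)" for v
  proof -
    have "diff_times_on n ?S (\<lambda>p. ?F' (fst p, fst (snd p), u (fst p, fst (snd p))) (v, 0, snd (snd p)))"
    proof (rule diff_times_on_linear_family[OF S,
        where l = "\<lambda>p. ?F' (fst p, fst (snd p), u (fst p, fst (snd p)))" and f = "\<lambda>p. (v, 0, snd (snd p))"])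
      show "linear (?F' (fst p, fst (snd p), u (fst p, fst (snd p))))" if "p \<in> ?S" for p
        by (rule has_derivative_linear[OF dF]) (use that in auto)
      show "diff_times_on n ?S (\<lambda>p. ?F' (fst p, fst (snd p), u (fst p, fst (snd p))) b)" for b
        by (rule diff_times_on_compose[OF S S _ inner F'n]) auto
      show "diff_times_on n ?S (\<lambda>p. (v, 0, snd (snd p)))"
        by (intro diff_times_on_Pair S proj diff_times_on_const)
    qed
    then show ?thesis by (simp add: split_beta')
  qed
  have lipG: "norm (?G v (x, t, y) - ?G v (x, t, z)) \<le> norm (y - z) / 8"
    if "x \<in> X" "t \<in> ode_time" for v x t y z
  proof -
    note d = dF[of "(x, t, u (x, t))"]
    have "?G v (x, t, y) - ?G v (x, t, z) = ?F' (x, t, u (x, t)) (0, 0, y - z)"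
      using that by (simp add: linear_diff[OF has_derivative_linear[OF d], symmetric])
    then show ?thesis using derivative_third_argument_bound[OF that d] that by simp
  qed
  have "\<exists>W. ode_solution ode_time (\<lambda>t y. ?G v (x, t, y)) (frechet_derivative w (at x) v) W" if "x \<in> X" for v x
  proof (rule ode_solution_exists)
    have "continuous_on ?S (?G v)" using diff_times_on_le[OF le0 G] by simp
    then have "continuous_on (ode_time \<times> UNIV) (\<lambda>p. ?G v (x, fst p, snd p))"
      by (rule continuous_on_compose2) (use that in \<open>auto intro!: continuous_intros\<close>)
    then show "continuous_on (ode_time \<times> UNIV) (\<lambda>(t, y). ?G v (x, t, y))" by (simp add: split_beta)
  qed (rule lipG[OF that])
  then have ex: "\<exists>W. x \<in> X \<longrightarrow> ode_solution ode_time (\<lambda>t y. ?G v (x, t, y)) (frechet_derivative w (at x) v) W" for v x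
    by blast
  define W where "W v x = (SOME W. x \<in> X \<longrightarrow>
    ode_solution ode_time (\<lambda>t y. ?G v (x, t, y)) (frechet_derivative w (at x) v) W)" for v x
  have W: "ode_solution ode_time (\<lambda>t y. ?G v (x, t, y)) (frechet_derivative w (at x) v) (W v x)" if "x \<in> X" for v x
    using someI_ex[OF ex[of x v]] that unfolding W_def by blast
  \<comment> \<open>The induction hypothesis again, now for the linearised equation with right-hand
    side \<open>?G v\<close>.\<close>
  have Wn: "diff_times_on n (X \<times> ode_time) (\<lambda>p. W v (fst p) (snd p))" for v
  proof (rule Suc.IH[OF G])
    show "diff_times_on n X (\<lambda>x. frechet_derivative w (at x) v)" using Suc.prems(2) by simp
    show "ode_family X (?G v) (\<lambda>x. frechet_derivative w (at x) v) (\<lambda>p. W v (fst p) (snd p))"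
    proof (rule ode_family.intro[OF X lipG])
      fix x assume "x \<in> X"
      from W[OF this, of v]
      show "ode_solution ode_time (\<lambda>t y. ?G v (x, t, y)) (frechet_derivative w (at x) v)
          (\<lambda>t. W v (fst (x, t)) (snd (x, t)))" by simp
    qed
  qed
  have Fu: "diff_times_on n (X \<times> ode_time) (\<lambda>p. F (fst p, snd p, u p))"
    by (rule diff_times_on_compose[OF XT S _ _ Fn])
      (auto intro: diff_times_on_Pair[OF XT diff_times_on_bounded_linear[OF XT bounded_linear_fst]
        diff_times_on_Pair[OF XT diff_times_on_bounded_linear[OF XT bounded_linear_snd] un]])
  have du: "(u has_derivative (\<lambda>(v, s). W v (fst p) (snd p) + s *\<^sub>R F (fst p, snd p, u p))) (at p)"
    if "p \<in> X \<times> ode_time" for p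
  proof -
    obtain x t where p: "p = (x, t)" and x: "x \<in> X" and t: "t \<in> ode_time" using \<open>p \<in> X \<times> ode_time\<close> by auto
    \<comment> \<open>Total differentiability follows from the parameter derivative at this time
      together with a time derivative that is jointly continuous.\<close>
    have "((\<lambda>(x, t). u (x, t)) has_derivative
        (\<lambda>(v, s). W v x t + blinfun_apply (blinfun_scaleR_left (F (x, t, u (x, t)))) s)) (at (x, t) within X \<times> ode_time)"
    proof (rule has_derivative_partialsI[where fy = "\<lambda>x t. blinfun_scaleR_left (F (x, t, u (x, t)))"])
      show "((\<lambda>x. u (x, t)) has_derivative (\<lambda>v. W v x t)) (at x within X)"
        by (rule has_derivative_at_withinI[OF has_derivative_parameter[OF F1 w1 x _ t]]) (use W[OF x] in simp)
      show "((\<lambda>t. u (x, t)) has_derivative blinfun_apply (blinfun_scaleR_left (F (x, t, u (x, t))))) (at t within ode_time)"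
        if "x \<in> X" "t \<in> ode_time" for x t
        using derivative_time[OF that] by (simp add: has_vector_derivative_def)
      have "diff_times_on n (X \<times> ode_time) (\<lambda>q. F (fst q, snd q, u (fst q, snd q)))"
        using Fu by simp
      then have "continuous_on (X \<times> ode_time) (\<lambda>q. F (fst q, snd q, u (fst q, snd q)))"
        using diff_times_on_le[OF le0, of n "X \<times> ode_time"] by simp
      then have "continuous_on (X \<times> ode_time) (\<lambda>q. blinfun_scaleR_left (F (fst q, snd q, u (fst q, snd q))) :: real \<Rightarrow>\<^sub>L 'u)"
        by (intro continuous_intros)
      then show "continuous (at (x, t) within X \<times> ode_time) (\<lambda>(x, t). blinfun_scaleR_left (F (x, t, u (x, t))) :: real \<Rightarrow>\<^sub>L 'u)"
        using x t by (simp add: continuous_on_eq_continuous_within split_beta')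
    qed (use t in auto)
    moreover have "at (x, t) within X \<times> ode_time = at (x, t)" by (rule at_within_open[OF _ XT]) (use x t in auto)
    ultimately show ?thesis by (simp add: p)
  qed
  show ?case
  proof (rule diff_times_on_SucI[OF XT du], assumption)
    fix q :: "'z \<times> real"
    have "diff_times_on n (X \<times> ode_time) (\<lambda>p. W (fst q) (fst p) (snd p) + snd q *\<^sub>R F (fst p, snd p, u p))"
      by (intro diff_times_on_add XT Wn diff_times_on_scaleR diff_times_on_const Fu)
    then show "diff_times_on n (X \<times> ode_time) (\<lambda>p. case q of (v, s) \<Rightarrow> W v (fst p) (snd p) + s *\<^sub>R F (fst p, snd p, u p))"
      by (simp add: split_beta)
  qed
qed

section \<open>The Frobenius theorem\<close>

text \<open>Lie algebras here are of class \<open>real_inner\<close> with a finite spanning set.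
  Orthogonalising that set writes \<open>f\<close> through finitely many inner products, which are
  continuous.\<close>

lemma bounded_linear_finite_dim:
  fixes f :: "'a::real_inner \<Rightarrow> 'b::real_normed_vector" and B :: "'a set"
  assumes "finite B" "span B = UNIV" and f: "linear f"
  shows "bounded_linear f"
proof -
  obtain C :: "'a set" where C: "finite C" "span C = UNIV" "pairwise orthogonal C"
    using basis_orthogonal[OF assms(1)] assms(2) by auto
  have rep: "x = (\<Sum>c\<in>C. ((x \<bullet> c) / (c \<bullet> c)) *\<^sub>R c)" for x
  proof -
    let ?y = "x - (\<Sum>c\<in>C. ((x \<bullet> c) / (c \<bullet> c)) *\<^sub>R c)"
    have o: "orthogonal c ?y" if c: "c \<in> C" for c
    proof -
      \<comment> \<open>The set \<open>C\<close> may contain 0; that term is harmless because both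
        the quotient and \<open>x \<bullet> 0\<close> are 0.\<close>
      have "(\<Sum>d\<in>C. ((x \<bullet> d) / (d \<bullet> d)) *\<^sub>R d) \<bullet> c = (\<Sum>d\<in>C. if d = c then x \<bullet> c else 0)"
        unfolding inner_sum_left
        by (rule sum.cong) (use C(3) c in \<open>auto simp: pairwise_def orthogonal_def\<close>)
      then show ?thesis
        using C(1) c by (simp add: orthogonal_def inner_diff_right inner_commute[of c] )
    qed
    have "?y \<in> span C" using C(2) by simp
    then have "orthogonal ?y ?y"
    proof (rule orthogonal_to_span)
      show "orthogonal ?y c" if "c \<in> C" for c by (subst orthogonal_commute) (rule o[OF that])
    qed
    then have "?y = 0" by (simp only: orthogonal_self)
    then show ?thesis by simp
  qed
  have "f x = (\<Sum>c\<in>C. ((x \<bullet> c) / (c \<bullet> c)) *\<^sub>R f c)" for x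
    by (subst rep) (simp only: linear_sum[OF f] linear_scale[OF f])
  then have "f = (\<lambda>x. \<Sum>c\<in>C. ((x \<bullet> c) / (c \<bullet> c)) *\<^sub>R f c)" by (rule ext)
  moreover have "bounded_linear (\<lambda>x. \<Sum>c\<in>C. ((x \<bullet> c) / (c \<bullet> c)) *\<^sub>R f c)"
    by (intro bounded_linear_sum bounded_linear_scaleR_const bounded_linear_compose[OF bounded_linear_divide]
      bounded_linear_inner_left)
  ultimately show ?thesis by simp
qed

lemma bounded_linear_from_image:
  fixes T :: "'e::euclidean_space \<Rightarrow> 'a::real_inner" and f :: "'a \<Rightarrow> 'b::real_normed_vector"
  assumes "linear T" "surj T" "linear f"
  shows "bounded_linear f"
proof (rule bounded_linear_finite_dim[OF _ _ assms(3)])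
  show "finite (T ` Basis)" by simp
  show "span (T ` Basis) = UNIV" using linear_span_image[OF assms(1), of Basis] assms(2) by simp
qed

lemma has_derivative_linear_family:
  fixes l :: "'a::real_normed_vector \<Rightarrow> 'e::euclidean_space \<Rightarrow> 'c::real_normed_vector"
  assumes S: "open S" "x \<in> S" and lin: "\<And>y. y \<in> S \<Longrightarrow> linear (l y)"
    and l: "\<And>b. (\<lambda>y. l y b) differentiable at x" and f: "(f has_derivative f') (at x)"
  shows "((\<lambda>y. l y (f y)) has_derivative
    (\<lambda>u. frechet_derivative (\<lambda>y. l y (f x)) (at x) u + l x (f' u))) (at x)"
proof -
  let ?D = "\<lambda>b. frechet_derivative (\<lambda>y. l y b) (at x)"
  have D: "((\<lambda>y. l y b) has_derivative ?D b) (at x)" for b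
    using l[of b] by (simp add: frechet_derivative_works)
  have sum: "((\<lambda>y. \<Sum>b\<in>Basis. (g y \<bullet> b) *\<^sub>R l y b) has_derivative
      (\<lambda>u. \<Sum>b\<in>Basis. (g x \<bullet> b) *\<^sub>R ?D b u + (g' u \<bullet> b) *\<^sub>R l x b)) (at x)"
    if "(g has_derivative g') (at x)" for g g'
    by (intro has_derivative_sum has_derivative_scaleR has_derivative_inner_left that D)
  \<comment> \<open>Stated for every \<open>g\<close>: the constant function with value
    \<open>f x\<close> identifies the first summand as the derivative of the coefficients.\<close>
  have *: "((\<lambda>y. l y (g y)) has_derivative
      (\<lambda>u. (\<Sum>b\<in>Basis. (g x \<bullet> b) *\<^sub>R ?D b u) + l x (g' u))) (at x)"
    if "(g has_derivative g') (at x)" for g g'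
  proof -
    have "((\<lambda>y. l y (g y)) has_derivative
        (\<lambda>u. \<Sum>b\<in>Basis. (g x \<bullet> b) *\<^sub>R ?D b u + (g' u \<bullet> b) *\<^sub>R l x b)) (at x)"
      by (rule has_derivative_transform_within_open[OF sum[OF that] S])
        (rule linear_euclidean_sum[OF lin, symmetric])
    then show ?thesis
      using linear_euclidean_sum[OF lin[OF S(2)], of "g' _"] by (simp add: sum.distrib)
  qed
  have fx: "((\<lambda>y. l y (f x)) has_derivative (\<lambda>u. \<Sum>b\<in>Basis. (f x \<bullet> b) *\<^sub>R ?D b u)) (at x)"
    using *[OF has_derivative_const, of "f x"] lin[OF S(2)] by (simp add: linear_0)
  show ?thesis
    unfolding frechet_derivative_at[OF fx, symmetric] by (rule *[OF f])
qed

text \<open>Where the columns of \<open>T y\<close> deviate from those of the identity by less than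
  1 in total, \<open>T y\<close> cannot kill a nonzero vector, hence is invertible. Smoothness of
  the inverse is the operator statement above.\<close>

lemma smooth_local_inverse:
  fixes T :: "'e::euclidean_space \<Rightarrow> 'e \<Rightarrow> 'e"
  assumes V: "open V" "y0 \<in> V" and lin: "\<And>y. y \<in> V \<Longrightarrow> linear (T y)"
    and smooth: "\<And>v. smooth_on V (\<lambda>y. T y v)" and id: "\<And>v. T y0 v = v"
  obtains r R where "0 < r" "ball y0 r \<subseteq> V" "inverse_operators (ball y0 r) T R"
    "\<And>v. smooth_on (ball y0 r) (\<lambda>y. R y v)"
proof -
  define N where "N y = (\<Sum>b\<in>Basis. norm (T y b - b))" for y
  have "isCont N y0"
    unfolding N_def
    by (intro continuous_intros)
      (use smooth_on_continuous[OF smooth] V in \<open>auto simp: continuous_on_eq_continuous_at\<close>)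
  moreover have "N y0 = 0" by (simp add: N_def id)
  ultimately obtain d where d: "d > 0" "\<And>y. dist y y0 < d \<Longrightarrow> N y < 1"
    unfolding continuous_at_eps_delta by (metis abs_less_iff dist_real_def diff_0_right zero_less_one)
  obtain d' where d': "d' > 0" "ball y0 d' \<subseteq> V" using V open_contains_ball by blast
  define r where "r = min d d'"
  have r: "0 < r" "ball y0 r \<subseteq> V" using d d' by (auto simp: r_def)
  have inj: "inj (T y)" if y: "y \<in> ball y0 r" for y
  proof -
    have lT: "linear (T y)" using lin r(2) y by blast
    have "v = 0" if "T y v = 0" for v
    proof -
      have "- v = (\<Sum>b\<in>Basis. (v \<bullet> b) *\<^sub>R (T y b - b))"
        using linear_euclidean_sum[OF lT, of v] that
        by (simp add: scaleR_diff_right sum_subtractf euclidean_representation)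
      then have "norm v = norm (\<Sum>b\<in>Basis. (v \<bullet> b) *\<^sub>R (T y b - b))" by (metis norm_minus_cancel)
      also have "\<dots> \<le> (\<Sum>b\<in>Basis. norm v * norm (T y b - b))"
        by (intro sum_norm_le) (simp add: Basis_le_norm mult_right_mono)
      also have "\<dots> = norm v * N y" by (simp add: N_def sum_distrib_left)
      finally have "norm v \<le> norm v * N y" .
      moreover have "N y < 1" using d(2)[of y] y by (simp add: r_def dist_commute)
      ultimately show "v = 0" by (metis linorder_not_less mult.right_neutral mult_less_cancel_left_pos zero_less_norm_iff)
    qed
    then show ?thesis using linear_injective_0[OF lT] by blast
  qed
  have "\<exists>R. linear R \<and> (\<forall>v. R (T y v) = v) \<and> (\<forall>v. T y (R v) = v)" if y: "y \<in> ball y0 r" for y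
  proof -
    have lT: "linear (T y)" using lin r(2) y by blast
    obtain R where "linear R" "\<forall>v. R (T y v) = v" "\<forall>v. T y (R v) = v"
      using linear_injective_isomorphism[OF lT inj[OF y]] by blast
    then show ?thesis by blast
  qed
  then obtain R where R: "\<And>y. y \<in> ball y0 r \<Longrightarrow> linear (R y)"
    "\<And>y v. y \<in> ball y0 r \<Longrightarrow> R y (T y v) = v" "\<And>y v. y \<in> ball y0 r \<Longrightarrow> T y (R y v) = v"
    by metis
  interpret inverse_operators "ball y0 r" T R
    by (rule inverse_operators.intro) (use R lin r(2) in auto)
  have "smooth_on (ball y0 r) (\<lambda>y. R y v)" for v
    using smooth_on_subset[OF smooth r(2)] unfolding smooth_on_def
    by (blast intro: diff_times_on_inverse_operator)
  with r show ?thesis by (intro that[of r R] inverse_operators_axioms)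
qed

text \<open>Splitting of the tangent spaces near \<open>y0\<close> into the kernel of \<open>\<theta> y\<close> and a fixed complement, the kernel of the
  projection \<open>P\<close>: \<open>B y\<close> lifts along \<open>P\<close> to the kernel and \<open>L y\<close> is a right inverse of \<open>\<theta> y\<close>.\<close>

locale split_coframe =
  fixes \<theta> :: "'e::euclidean_space \<Rightarrow> 'e \<Rightarrow> 'q::real_inner" and y0 :: 'e and r :: real
    and P :: "'e \<Rightarrow> 'e" and B :: "'e \<Rightarrow> 'e \<Rightarrow> 'e" and L :: "'e \<Rightarrow> 'q \<Rightarrow> 'e"
  assumes r: "0 < r"
    and lin_\<theta>: "y \<in> ball y0 r \<Longrightarrow> linear (\<theta> y)"
    and smooth_\<theta>: "smooth_on (ball y0 r) (\<lambda>y. \<theta> y v)"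
    and lin_P: "linear P" and P_fixed: "P v = v \<longleftrightarrow> \<theta> y0 v = 0" and P_idem: "P (P v) = P v"
    and lin_B: "y \<in> ball y0 r \<Longrightarrow> linear (B y)"
    and \<theta>_B: "y \<in> ball y0 r \<Longrightarrow> \<theta> y (B y v) = 0" and P_B: "y \<in> ball y0 r \<Longrightarrow> P (B y v) = P v"
    and B_P: "y \<in> ball y0 r \<Longrightarrow> B y (P v) = B y v"
    and separating: "y \<in> ball y0 r \<Longrightarrow> \<theta> y v = 0 \<Longrightarrow> P v = 0 \<Longrightarrow> v = 0"
    and smooth_B: "smooth_on (ball y0 r) (\<lambda>y. B y v)"
    and \<theta>_L: "y \<in> ball y0 r \<Longrightarrow> \<theta> y (L y g) = g" and P_L: "y \<in> ball y0 r \<Longrightarrow> P (L y g) = 0"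
    and smooth_L: "open N \<Longrightarrow> N \<subseteq> ball y0 r \<Longrightarrow> smooth_on N h \<Longrightarrow> smooth_on N (\<lambda>y. L y (h y))"

text \<open>The maps \<open>T y = P + R0 o \<theta> y\<close> form a moving frame that is the
  identity at \<open>y0\<close>. Its inverse, applied to the image of \<open>P\<close> and to the
  image of \<open>R0\<close>, yields \<open>B\<close> and \<open>L\<close>.\<close>

lemma split_coframe_exists:
  fixes \<theta> :: "'e::euclidean_space \<Rightarrow> 'e \<Rightarrow> 'q::real_inner"
  assumes V: "open V" "y0 \<in> V" and lin: "\<And>y. y \<in> V \<Longrightarrow> linear (\<theta> y)"
    and smooth: "\<And>v. smooth_on V (\<lambda>y. \<theta> y v)" and surj: "surj (\<theta> y0)"
  obtains r P B L where "ball y0 r \<subseteq> V" "split_coframe \<theta> y0 r P B L"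
proof -
  have lin0: "linear (\<theta> y0)" by (rule lin[OF V(2)])
  obtain R0 where R0: "linear R0" "\<And>g. \<theta> y0 (R0 g) = g"
    using linear_surj_right_inverse[OF lin0, of UNIV UNIV] surj by auto
  have bR0: "bounded_linear R0" by (rule bounded_linear_from_image[OF lin0 surj R0(1)])
  define P where "P v = v - R0 (\<theta> y0 v)" for v
  have linP: "linear P"
    by (rule linearI) (simp_all add: P_def linear_add[OF lin0] linear_add[OF R0(1)] linear_scale[OF lin0]
      linear_scale[OF R0(1)] algebra_simps)
  have \<theta>P: "\<theta> y0 (P v) = 0" for v by (simp add: P_def linear_diff[OF lin0] R0)
  have PR0: "P (R0 g) = 0" for g by (simp add: P_def R0)
  define T where "T y v = P v + R0 (\<theta> y v)" for y v
  have linT: "linear (T y)" if "y \<in> V" for y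
    by (rule linearI) (simp_all add: T_def linear_add[OF lin[OF that]] linear_add[OF R0(1)] linear_scale[OF lin[OF that]]
      linear_scale[OF R0(1)] linear_add[OF linP] linear_scale[OF linP] algebra_simps)
  have smoothT: "smooth_on V (\<lambda>y. T y v)" for v
    unfolding T_def by (intro smooth_on_add V smooth_on_const smooth_on_bounded_linear_comp[OF V(1) bR0] smooth)
  have T0: "T y0 v = v" for v by (simp add: T_def P_def)
  obtain r R where r: "0 < r" "ball y0 r \<subseteq> V" and R: "inverse_operators (ball y0 r) T R"
    and smoothR: "\<And>v. smooth_on (ball y0 r) (\<lambda>y. R y v)"
    using smooth_local_inverse[of V y0 T] V linT smoothT T0 by metis
  interpret inverse_operators "ball y0 r" T R by (rule R)
  \<comment> \<open>Applying \<open>\<theta> y0\<close> separates the two components, since it kills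
    the image of \<open>P\<close> and inverts \<open>R0\<close>.\<close>
  have T_eq: "P x = P v \<and> \<theta> y x = g" if "T y x = P v + R0 g" for y x v g
  proof -
    have "\<theta> y0 (T y x) = \<theta> y0 (P v + R0 g)" using that by simp
    then have "\<theta> y x = g" by (simp add: T_def linear_add[OF lin0] \<theta>P R0)
    then show ?thesis using that by (simp add: T_def)
  qed
  define B where "B y v = R y (P v)" for y v
  define L where "L y g = R y (R0 g)" for y g
  have "split_coframe \<theta> y0 r P B L"
  proof (rule split_coframe.intro)
    show "0 < r" by fact
    show "linear (\<theta> y)" if "y \<in> ball y0 r" for y using lin r(2) that by blast
    show "smooth_on (ball y0 r) (\<lambda>y. \<theta> y v)" for v by (rule smooth_on_subset[OF smooth r(2)])
    show "linear P" by fact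
    show "(P v = v) = (\<theta> y0 v = 0)" for v
      using \<theta>P[of v] by (auto simp: P_def linear_0[OF R0(1)])
    show "P (P v) = P v" for v by (simp add: P_def[of "P v"] \<theta>P linear_0[OF R0(1)])
    show "linear (B y)" if "y \<in> ball y0 r" for y
      unfolding B_def using linear_compose[OF linP lin_R[OF that]] by (simp add: o_def)
    show "\<theta> y (B y v) = 0" "P (B y v) = P v" if "y \<in> ball y0 r" for y v
      using T_eq[of y "B y v" v 0] AR[OF that] by (auto simp: B_def linear_0[OF R0(1)])
    show "B y (P v) = B y v" for y v
      by (simp add: B_def P_def[of "P v"] \<theta>P linear_0[OF R0(1)])
    show "v = 0" if "y \<in> ball y0 r" "\<theta> y v = 0" "P v = 0" for y v
      using RA[OF that(1), of v] that(2,3) by (simp add: T_def linear_0[OF R0(1)] linear_0[OF lin_R[OF that(1)]])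
    show "smooth_on (ball y0 r) (\<lambda>y. B y v)" for v unfolding B_def by (rule smoothR)
    show "\<theta> y (L y g) = g" "P (L y g) = 0" if "y \<in> ball y0 r" for y g
      using T_eq[of y "L y g" 0 g] AR[OF that] by (auto simp: L_def linear_0[OF linP])
    \<comment> \<open>Composing with \<open>R0\<close> moves the argument into the Euclidean space
      \<open>'e\<close>, where it can be expanded in a basis.\<close>
    show "smooth_on N (\<lambda>y. L y (h y))" if N: "open N" "N \<subseteq> ball y0 r" and h: "smooth_on N h" for N h
      unfolding L_def
    proof (rule smooth_on_linear_family[where l = R and f = "\<lambda>y. R0 (h y)", OF N(1)])
      show "linear (R x)" if "x \<in> N" for x using lin_R N(2) that by blast
      show "smooth_on N (\<lambda>y. R y b)" for b by (rule smooth_on_subset[OF smoothR N(2)])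
      show "smooth_on N (\<lambda>y. R0 (h y))" by (rule smooth_on_bounded_linear_comp[OF N(1) bR0 h])
    qed
  qed
  with r(2) show ?thesis by (rule that)
qed

text \<open>The derivative is continuous on a compact ball and zero outside it, hence globally
  bounded.\<close>

lemma smooth_compact_support_lipschitz:
  fixes f :: "'e::euclidean_space \<Rightarrow> 'b::real_normed_vector"
  assumes f: "smooth_on UNIV f" and supp: "\<And>y. y \<notin> cball c r \<Longrightarrow> f y = 0"
  obtains C where "0 \<le> C" "\<And>y z. norm (f y - f z) \<le> C * norm (y - z)"
proof -
  let ?D = "\<lambda>y. frechet_derivative f (at y)"
  have d: "(f has_derivative ?D y) (at y)" for y by (rule smooth_on_has_derivative[OF f UNIV_I])
  define N where "N y = (\<Sum>b\<in>Basis. norm (?D y b))" for y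
  have "continuous_on (cball c r) N"
    unfolding N_def
    by (intro continuous_intros continuous_on_subset[OF smooth_on_continuous[OF smooth_on_frechet_const[OF f]]]) auto
  then have "bounded (N ` cball c r)"
    by (intro compact_imp_bounded compact_continuous_image compact_cball)
  then obtain C where C: "\<And>y. y \<in> cball c r \<Longrightarrow> norm (N y) \<le> C"
    unfolding bounded_iff by blast
  have N0: "N y = 0" if "y \<notin> cball c r" for y
  proof -
    have "((\<lambda>_. 0) has_derivative ?D y) (at y)"
      by (rule has_derivative_transform_within_open[OF d, of "- cball c r"]) (use that supp in auto)
    then have "?D y = (\<lambda>_. 0)" using has_derivative_unique has_derivative_const by blast
    then show ?thesis by (simp add: N_def)
  qed
  have le: "onorm (?D y) \<le> max C 0" for y
  proof (rule onorm_le)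
    fix v
    have "norm (?D y v) = norm (\<Sum>b\<in>Basis. (v \<bullet> b) *\<^sub>R ?D y b)"
      by (rule arg_cong[OF linear_euclidean_sum[OF has_derivative_linear[OF d]], of norm])
    also have "\<dots> \<le> (\<Sum>b\<in>Basis. norm v * norm (?D y b))"
      by (intro sum_norm_le) (simp add: Basis_le_norm mult_right_mono)
    also have "\<dots> = N y * norm v" by (simp add: N_def sum_distrib_left mult.commute)
    also have "N y \<le> max C 0" using C[of y] N0[of y] by (cases "y \<in> cball c r") auto
    finally show "norm (?D y v) \<le> max C 0 * norm v" by (simp add: mult_right_mono)
  qed
  show ?thesis
  proof (rule that[of "max C 0"])
    show "norm (f y - f z) \<le> max C 0 * norm (y - z)" for y z
      by (rule differentiable_bound[OF convex_UNIV _ le]) (use d in auto)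
  qed simp
qed

text \<open>The two sides differ by the bracket of the lifted fields. Involutivity puts it into the
  kernel of \<open>\<theta> y\<close>; since \<open>P (B y k)\<close> does not depend on
  \<open>y\<close>, it also lies in the kernel of \<open>P\<close>. These kernels meet only in
  0.\<close>

lemma (in split_coframe) lifts_commute:
  assumes inv: "\<And>y u v. y \<in> ball y0 r \<Longrightarrow> \<theta> y u = 0 \<Longrightarrow> \<theta> y v = 0 \<Longrightarrow>
      frechet_derivative (\<lambda>y. \<theta> y v) (at y) u = frechet_derivative (\<lambda>y. \<theta> y u) (at y) v"
    and y: "y \<in> ball y0 r"
  shows "frechet_derivative (\<lambda>y. B y k') (at y) (B y k) = frechet_derivative (\<lambda>y. B y k) (at y) (B y k')"
proof -
  let ?b = "B y k" and ?b' = "B y k'"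
  let ?D\<theta> = "\<lambda>v u. frechet_derivative (\<lambda>y. \<theta> y v) (at y) u"
  let ?DB = "\<lambda>k u. frechet_derivative (\<lambda>y. B y k) (at y) u"
  have dB: "((\<lambda>y. B y k) has_derivative ?DB k) (at y)" for k
    by (rule smooth_on_has_derivative[OF smooth_B y])
  have \<theta>0: "?D\<theta> (B y k) u + \<theta> y (?DB k u) = 0" for k u
  proof -
    have "((\<lambda>y. \<theta> y (B y k)) has_derivative (\<lambda>u. ?D\<theta> (B y k) u + \<theta> y (?DB k u))) (at y)"
      by (rule has_derivative_linear_family[OF open_ball y lin_\<theta> _ dB])
        (auto intro: smooth_on_differentiable[OF smooth_\<theta> y])
    moreover have "((\<lambda>y. \<theta> y (B y k)) has_derivative (\<lambda>u. 0)) (at y)"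
      by (rule has_derivative_transform_within_open[OF has_derivative_const open_ball y])
        (simp add: \<theta>_B)
    ultimately show ?thesis by (rule fun_cong[OF has_derivative_unique])
  qed
  have P0: "P (?DB k u) = 0" for k u
  proof -
    have "((\<lambda>y. P (B y k)) has_derivative (\<lambda>u. P (?DB k u))) (at y)"
      by (rule bounded_linear.has_derivative[OF linear_conv_bounded_linear[THEN iffD1, OF lin_P] dB])
    moreover have "((\<lambda>y. P (B y k)) has_derivative (\<lambda>u. 0)) (at y)"
      by (rule has_derivative_transform_within_open[OF has_derivative_const open_ball y])
        (simp add: P_B)
    ultimately show ?thesis by (rule fun_cong[OF has_derivative_unique])
  qed
  have "?DB k' ?b - ?DB k ?b' = 0"
  proof (rule separating[OF y])
    have "\<theta> y (?DB k' ?b) = \<theta> y (?DB k ?b')"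
      using \<theta>0[of k' ?b] \<theta>0[of k ?b'] inv[OF y \<theta>_B[OF y, of k] \<theta>_B[OF y, of k']]
      by (simp add: add_eq_0_iff)
    then show "\<theta> y (?DB k' ?b - ?DB k ?b') = 0" by (simp add: linear_diff[OF lin_\<theta>[OF y]])
    show "P (?DB k' ?b - ?DB k ?b') = 0" by (simp add: linear_diff[OF lin_P] P0)
  qed
  then show ?thesis by simp
qed

text \<open>The inverse chart maps \<open>z\<close> to \<open>u (z, 1)\<close> where \<open>u\<close> starts at \<open>y0 + (z - P z)\<close> and follows the
  commuting fields \<open>B y (P z)\<close>. For \<open>k\<close> in the image of \<open>P\<close>, both the derivative of \<open>u (z, t)\<close> in direction \<open>k\<close> and
  \<open>t *\<^sub>R B (u (z, t)) k\<close> solve the linearised equation, hence agree.\<close>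

lemma (in split_coframe) flat_parametrization:
  assumes inv: "\<And>y u v. y \<in> ball y0 r \<Longrightarrow> \<theta> y u = 0 \<Longrightarrow> \<theta> y v = 0 \<Longrightarrow>
      frechet_derivative (\<lambda>y. \<theta> y v) (at y) u = frechet_derivative (\<lambda>y. \<theta> y u) (at y) v"
  obtains \<Psi> Z where "open Z" "0 \<in> Z" "smooth_on Z \<Psi>" "\<Psi> 0 = y0" "\<Psi> ` Z \<subseteq> ball y0 r"
    "\<And>v. frechet_derivative \<Psi> (at 0) v = v"
    "\<And>z k. z \<in> Z \<Longrightarrow> P k = k \<Longrightarrow> frechet_derivative \<Psi> (at z) k = B (\<Psi> z) k"
proof -
  \<comment> \<open>Cut off so that the field is defined and Lipschitz on the whole space, as the
    existence theorem demands; it is unchanged on the ball of radius \<open>r/4\<close>.\<close>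
  define B' where "B' y v = bump (r/2) (y - y0) *\<^sub>R B y v" for y v
  have r2: "0 < r/2" using r by simp
  have B'0: "B' y v = 0" if "y \<notin> cball y0 (r/2)" for y v
    using bump_eq_0[OF r2, of "y - y0"] that by (simp add: B'_def dist_norm norm_minus_commute)
  have B'B: "B' y v = B y v" if "y \<in> ball y0 (r/4)" for y v
    using bump_eq_1[OF r2, of "y - y0"] that by (simp add: B'_def dist_norm norm_minus_commute)
  have quarter: "ball y0 (r/4) \<subseteq> ball y0 r" using r by auto
  have linB': "linear (B' y)" for y
  proof (cases "y \<in> ball y0 r")
    case True
    then show ?thesis unfolding B'_def by (intro linear_compose_scale_right lin_B)
  next
    case False
    then have "B' y = (\<lambda>_. 0)" using B'0[of y] r by auto
    then show ?thesis by (simp add: linear_zero)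
  qed
  have smoothB': "smooth_on UNIV (\<lambda>y. B' y v)" for v
  proof (rule smooth_on_local)
    fix y
    show "\<exists>U. open U \<and> y \<in> U \<and> smooth_on U (\<lambda>y. B' y v)"
    proof (cases "y \<in> ball y0 r")
      case True
      have "smooth_on (ball y0 r) (\<lambda>y. bump (r/2) (y - y0))"
        by (rule smooth_on_compose[OF open_ball open_UNIV _ _ smooth_on_bump[OF r2]])
          (auto intro: smooth_on_diff)
      then have "smooth_on (ball y0 r) (\<lambda>y. B' y v)"
        unfolding B'_def by (intro smooth_on_scaleR open_ball smooth_B)
      then show ?thesis using True by blast
    next
      case False
      have "smooth_on (- cball y0 (r/2)) (\<lambda>y. B' y v)"
        by (rule smooth_on_cong[OF _ smooth_on_const[of _ 0]]) (use B'0 in auto)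
      moreover have "y \<in> - cball y0 (r/2)" using False r by auto
      ultimately show ?thesis by blast
    qed
  qed
  obtain C where C: "0 \<le> C" "\<And>y z v. norm (B' y v - B' z v) \<le> C * norm v * norm (y - z)"
  proof -
    have "\<exists>C\<ge>0. \<forall>y z. norm (B' y b - B' z b) \<le> C * norm (y - z)" for b
      using smooth_compact_support_lipschitz[OF smoothB' B'0] by metis
    then obtain C where C: "\<And>b. 0 \<le> C b" "\<And>b y z. norm (B' y b - B' z b) \<le> C b * norm (y - z)" by metis
    have "norm (B' y v - B' z v) \<le> (\<Sum>b\<in>Basis. C b) * norm v * norm (y - z)" for y z v
    proof -
      have "B' y v - B' z v = (\<Sum>b\<in>Basis. (v \<bullet> b) *\<^sub>R (B' y b - B' z b))"
        using linear_euclidean_sum[OF linB', of y v] linear_euclidean_sum[OF linB', of z v]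
        by (simp add: scaleR_diff_right sum_subtractf)
      also have "norm \<dots> \<le> (\<Sum>b\<in>Basis. norm v * (C b * norm (y - z)))"
      proof (rule sum_norm_le)
        fix b :: 'e assume "b \<in> Basis"
        then have "\<bar>v \<bullet> b\<bar> * norm (B' y b - B' z b) \<le> norm v * (C b * norm (y - z))"
          by (intro mult_mono Basis_le_norm C) auto
        then show "norm ((v \<bullet> b) *\<^sub>R (B' y b - B' z b)) \<le> norm v * (C b * norm (y - z))" by simp
      qed
      also have "\<dots> = (\<Sum>b\<in>Basis. C b) * norm v * norm (y - z)"
        by (simp add: sum_distrib_left sum_distrib_right mult_ac)
      finally show ?thesis .
    qed
    then show ?thesis using C(1) by (intro that[of "\<Sum>b\<in>Basis. C b"]) (auto intro: sum_nonneg)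
  qed
  have bP: "bounded_linear P" using lin_P by (simp add: linear_conv_bounded_linear)
  obtain K where K: "K > 0" "\<And>v. norm (P v) \<le> norm v * K" using bounded_linear.pos_bounded[OF bP] by blast
  \<comment> \<open>For parameters this small the Lipschitz constant \<open>C * norm (P z)\<close>
    is at most 1/8; the summand 1 avoids a zero denominator.\<close>
  define X where "X = ball (0 :: 'e) (1 / (8 * (C * K + 1)))"
  have CK: "0 < C * K + 1" using C(1) K(1) by (simp add: add_nonneg_pos)
  have openX: "open X" and X0: "0 \<in> X" using CK by (auto simp: X_def)
  define F where "F = (\<lambda>p :: 'e \<times> real \<times> 'e. B' (snd (snd p)) (P (fst p)))"
  have F_eq: "F (z, t, y) = B' y (P z)" for z t y by (simp add: F_def)
  have lipF: "norm (F (z, t, y) - F (z, t, y')) \<le> norm (y - y') / 8" if "z \<in> X" for z t y y'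
  proof -
    have "C * norm (P z) \<le> C * (norm z * K)" using C(1) K(2) by (intro mult_left_mono)
    also have "\<dots> \<le> (C * K + 1) * norm z" by (simp add: algebra_simps)
    also have "\<dots> \<le> (C * K + 1) * (1 / (8 * (C * K + 1)))"
      using that CK by (intro mult_left_mono) (auto simp: X_def)
    also have "\<dots> = 1/8" using CK by simp
    finally have "C * norm (P z) * norm (y - y') \<le> 1/8 * norm (y - y')" by (rule mult_right_mono) simp
    then show ?thesis using C(2)[of y "P z" y'] by (simp add: F_def)
  qed
  define w where "w z = y0 + (z - P z)" for z
  have smooth_w: "smooth_on S w" if "open S" for S
    unfolding w_def by (intro smooth_on_add smooth_on_diff that smooth_on_const smooth_on_ident
      smooth_on_bounded_linear bP)
  have smooth_F: "smooth_on UNIV F"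
    unfolding F_def
  proof (rule smooth_on_linear_family[where l = "\<lambda>p. B' (snd (snd p))" and f = "\<lambda>p. P (fst p)"])
    have "bounded_linear (\<lambda>p :: 'e \<times> real \<times> 'e. snd (snd p))"
      by (intro bounded_linear_snd_comp bounded_linear_snd)
    then show "smooth_on UNIV (\<lambda>p :: 'e \<times> real \<times> 'e. B' (snd (snd p)) b)" for b
      by (intro smooth_on_compose[OF open_UNIV open_UNIV _ _ smoothB']) (auto intro: smooth_on_bounded_linear)
    show "smooth_on UNIV (\<lambda>p :: 'e \<times> real \<times> 'e. P (fst p))"
      by (intro smooth_on_bounded_linear_comp[OF open_UNIV bP] smooth_on_bounded_linear bounded_linear_fst open_UNIV)
  qed (use linB' in auto)
  have "\<exists>U. ode_solution ode_time (\<lambda>t y. F (z, t, y)) (w z) U" if "z \<in> X" for z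
  proof (rule ode_solution_exists)
    have "continuous_on (ode_time \<times> UNIV) (\<lambda>p. F (z, fst p, snd p))"
      by (rule continuous_on_compose2[OF smooth_on_continuous[OF smooth_F]]) (auto intro!: continuous_intros)
    then show "continuous_on (ode_time \<times> UNIV) (\<lambda>(t, y). F (z, t, y))" by (simp add: split_beta')
  qed (rule lipF[OF that])
  then have ex: "\<exists>U. z \<in> X \<longrightarrow> ode_solution ode_time (\<lambda>t y. F (z, t, y)) (w z) U" for z by blast
  then obtain U where U: "\<And>z. z \<in> X \<Longrightarrow> ode_solution ode_time (\<lambda>t y. F (z, t, y)) (w z) (U z)" by metis
  define u where "u p = U (fst p) (snd p)" for p
  interpret ode_family X F w u
    by (rule ode_family.intro[OF openX lipF]) (use U in \<open>auto simp: u_def\<close>)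
  have XT: "open (X \<times> ode_time)" using openX by (simp add: open_Times)
  have Fn: "diff_times_on n (X \<times> ode_time \<times> UNIV) F" for n
    using smooth_on_subset[OF smooth_F subset_UNIV] by (simp add: smooth_on_def)
  have wn: "diff_times_on n X w" for n using smooth_w[OF openX] by (simp add: smooth_on_def)
  have smooth_u: "smooth_on (X \<times> ode_time) u"
    unfolding smooth_on_def by (intro allI diff_times_on_ode_solution[OF Fn wn ode_family_axioms])
  define \<Psi> where "\<Psi> z = u (z, 1)" for z
  have smooth_\<Psi>: "smooth_on X \<Psi>"
    unfolding \<Psi>_def
    by (rule smooth_on_compose[OF openX XT _ _ smooth_u])
      (auto intro!: smooth_on_Pair smooth_on_ident smooth_on_const openX)
  \<comment> \<open>If \<open>P z = 0\<close>, the driving field is zero and the starting point is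
    \<open>y0 + z\<close>.\<close>
  have stationary: "u (z, t) = y0 + z" if z: "z \<in> X" "P z = 0" and t: "t \<in> ode_time" for z t
  proof (rule ode_solution_unique[where b = 2])
    show "ode_solution {-2<..<2} (\<lambda>t y. F (z, t, y)) (w z) (\<lambda>t. u (z, t))" using sol[OF z(1)] .
    show "ode_solution {-2<..<2} (\<lambda>t y. F (z, t, y)) (w z) (\<lambda>t. y0 + z)"
      using z(2) by (simp add: ode_solution_def w_def F_def linear_0[OF linB'])
    show "norm (F (z, t, y) - F (z, t, y')) \<le> norm (y - y') / 8" for t y y' by (rule lipF[OF z(1)])
  qed (use t in auto)
  \<comment> \<open>Keeps the trajectories up to time 1 where the cut-off is 1, so that
    \<open>B'\<close> may be replaced by \<open>B\<close>.\<close>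
  obtain Z where Z: "open Z" "0 \<in> Z" "Z \<subseteq> X" "\<And>z t. z \<in> Z \<Longrightarrow> \<bar>t\<bar> \<le> 1 \<Longrightarrow> u (z, t) \<in> ball y0 (r/4)"
  proof -
    have "continuous_on (X \<times> {-1..1}) u"
      by (rule continuous_on_subset[OF smooth_on_continuous[OF smooth_u]]) auto
    from continuous_on_prod_compactE[OF this compact_Icc X0, of "r/8"] r
    obtain Z0 where Z0: "0 \<in> Z0" "open Z0" "\<forall>z\<in>Z0 \<inter> X. \<forall>t\<in>{-1..1}. dist (u (z, t)) (u (0, t)) \<le> r/8" by auto
    show ?thesis
    proof (rule that[of "Z0 \<inter> X"])
      fix z t assume z: "z \<in> Z0 \<inter> X" and t: "\<bar>t\<bar> \<le> (1::real)"
      then have "dist (u (z, t)) (u (0, t)) \<le> r/8" using Z0(3) by (simp add: abs_le_iff)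
      moreover have "t \<in> ode_time" using t by auto
      then have "u (0, t) = y0" using stationary[OF X0 linear_0[OF lin_P]] by simp
      ultimately show "u (z, t) \<in> ball y0 (r/4)" using r by (simp add: dist_commute)
    qed (use Z0 openX X0 in auto)
  qed
  show ?thesis
  proof (rule that[of Z \<Psi>])
    show "open Z" "0 \<in> Z" by fact+
    show "smooth_on Z \<Psi>" by (rule smooth_on_subset[OF smooth_\<Psi> Z(3)])
    show \<Psi>0: "\<Psi> 0 = y0" using stationary[OF X0 linear_0[OF lin_P], of 1] by (simp add: \<Psi>_def)
    show "\<Psi> ` Z \<subseteq> ball y0 r" using Z(4)[of _ 1] quarter by (auto simp: \<Psi>_def)
    show D\<Psi>: "frechet_derivative \<Psi> (at z) k = B (\<Psi> z) k" if z: "z \<in> Z" and k: "P k = k" for z k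
    proof -
      have zX: "z \<in> X" using z Z(3) by blast
      have dF: "((\<lambda>p. B' (snd (snd p)) (P (fst p))) has_derivative
          (\<lambda>q. frechet_derivative (\<lambda>y. B' y (P z)) (at y) (snd (snd q)) + B' y (P (fst q)))) (at (z, t :: real, y))" for t y
      proof -
        have d1: "((\<lambda>y. B' y v) has_derivative frechet_derivative (\<lambda>y. B' y v) (at y)) (at y)" for v
          by (rule smooth_on_has_derivative[OF smoothB' UNIV_I])
        have d2: "((\<lambda>p. B' (snd (snd p)) v) has_derivative
            (\<lambda>q. frechet_derivative (\<lambda>y. B' y v) (at y) (snd (snd q)))) (at (z, t :: real, y))" for v
          by (rule has_derivative_compose[of "\<lambda>p. snd (snd p)" _ _ _ "\<lambda>y. B' y v"])
            (use d1 in \<open>auto intro!: derivative_eq_intros\<close>)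
        have "((\<lambda>p. B' (snd (snd p)) (P (fst p))) has_derivative
          (\<lambda>q. frechet_derivative (\<lambda>p. B' (snd (snd p)) (P (fst (z, t, y)))) (at (z, t, y)) q
            + B' (snd (snd (z, t, y))) (P (fst q)))) (at (z, t :: real, y))"
          by (rule has_derivative_linear_family[where l = "\<lambda>p. B' (snd (snd p))" and f = "\<lambda>p. P (fst p)" and S = UNIV])
            (use linB' d2 in \<open>auto simp: differentiable_def intro!: bounded_linear.has_derivative[OF bP] derivative_eq_intros\<close>)
        then show ?thesis by (simp add: frechet_derivative_at[OF d2, symmetric])
      qed
      have fF: "frechet_derivative F (at (z, t, y)) (v, 0, x) =
          frechet_derivative (\<lambda>y. B' y (P z)) (at y) x + B' y (P v)" for v t y x
        by (simp add: F_def frechet_derivative_at[OF dF, symmetric])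
      \<comment> \<open>Starting points depend only on \<open>z - P z\<close>, so they do not move
        when \<open>z\<close> varies in the image of \<open>P\<close>.\<close>
      have fw: "frechet_derivative w (at z) k = 0"
      proof -
        have "(w has_derivative (\<lambda>v. 0 + (v - P v))) (at z)"
          unfolding w_def
          by (intro has_derivative_add has_derivative_diff has_derivative_const has_derivative_ident
            bounded_linear_imp_has_derivative bP)
        from frechet_derivative_at[OF this, symmetric] show ?thesis using k by simp
      qed
      define G where "G v t y = frechet_derivative F (at (z, t, u (z, t))) (v, 0, y)" for v t y
      have smoothG: "smooth_on (ode_time \<times> UNIV) (\<lambda>p. frechet_derivative (\<lambda>y. B' y (P z)) (at (u (z, fst p))) (snd p) + B' (u (z, fst p)) v)" for v
      proof -
        have op: "open (ode_time \<times> (UNIV :: 'e set))" by (simp add: open_Times)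
        have su: "smooth_on (ode_time \<times> UNIV) (\<lambda>p :: real \<times> 'e. u (z, fst p))"
          by (rule smooth_on_compose[OF op XT _
            smooth_on_Pair[OF op smooth_on_const smooth_on_bounded_linear[OF op bounded_linear_fst]] smooth_u])
            (use zX in auto)
        show ?thesis
        proof (rule smooth_on_add[OF op])
          show "smooth_on (ode_time \<times> UNIV) (\<lambda>p :: real \<times> 'e. B' (u (z, fst p)) v)"
            by (rule smooth_on_compose[OF op open_UNIV _ su smoothB']) simp
          show "smooth_on (ode_time \<times> UNIV) (\<lambda>p :: real \<times> 'e. frechet_derivative (\<lambda>y. B' y (P z)) (at (u (z, fst p))) (snd p))"
          proof (rule smooth_on_linear_family[OF op, where
              l = "\<lambda>p. frechet_derivative (\<lambda>y. B' y (P z)) (at (u (z, fst p)))" and f = snd])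
            show "linear (frechet_derivative (\<lambda>y. B' y (P z)) (at (u (z, fst p))))" for p :: "real \<times> 'e"
              by (rule has_derivative_linear[OF smooth_on_has_derivative[OF smoothB' UNIV_I]])
            show "smooth_on (ode_time \<times> UNIV) (\<lambda>p :: real \<times> 'e. frechet_derivative (\<lambda>y. B' y (P z)) (at (u (z, fst p))) b)" for b
              by (rule smooth_on_compose[OF op open_UNIV _ su smooth_on_frechet_const[OF smoothB']]) simp
            show "smooth_on (ode_time \<times> UNIV) (snd :: real \<times> 'e \<Rightarrow> 'e)"
              by (intro smooth_on_bounded_linear op bounded_linear_snd)
          qed
        qed
      qed
      have lipDB: "norm (frechet_derivative (\<lambda>y. B' y (P z)) (at y) x) \<le> norm x / 8" for y x
      proof -
        have "norm (frechet_derivative F (at (z, 0, y)) (0, 0, x)) \<le> norm x / 8"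
          by (rule derivative_third_argument_bound[OF zX, of 0 _ y])
            (use smooth_on_has_derivative[OF smooth_F UNIV_I] in auto)
        then show ?thesis
          by (simp add: fF linear_0[OF lin_P] linear_0[OF linB'])
      qed
      have linDB: "linear (frechet_derivative (\<lambda>y. B' y v) (at y))" for v y
        by (rule has_derivative_linear[OF smooth_on_has_derivative[OF smoothB' UNIV_I]])
      have "\<exists>W. ode_solution ode_time (G v) (frechet_derivative w (at z) v) W" for v
      proof (rule ode_solution_exists)
        show "continuous_on (ode_time \<times> UNIV) (\<lambda>(t, y). G v t y)"
          using smooth_on_continuous[OF smoothG[of "P v"]] by (simp add: G_def fF split_beta')
        show "norm (G v t y - G v t y') \<le> norm (y - y') / 8" for t y y'
          using lipDB[of "u (z, t)" "y - y'"] by (simp add: G_def fF linear_diff[OF linDB])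
      qed
      then obtain W where W: "\<And>v. ode_solution ode_time (G v) (frechet_derivative w (at z) v) (W v)" by metis
      have "((\<lambda>z. u (z, 1)) has_derivative (\<lambda>v. W v 1)) (at z)"
        by (rule has_derivative_parameter[OF Fn wn zX W[unfolded G_def]]) simp
      from fun_cong[OF frechet_derivative_at[OF this], of k]
      have "W k 1 = frechet_derivative \<Psi> (at z) k" by (simp add: \<Psi>_def[abs_def])
      moreover have "norm (W k 1 - 1 *\<^sub>R B' (u (z, 1)) k) \<le> 2 * norm (W k 0 - 0 *\<^sub>R B' (u (z, 0)) k) + 4 * 0"
      proof (rule ode_estimate[where a = 1 and v = "\<lambda>t. W k t - t *\<^sub>R B' (u (z, t)) k" and
          v' = "\<lambda>t. frechet_derivative (\<lambda>y. B' y (P z)) (at (u (z, t))) (W k t - t *\<^sub>R B' (u (z, t)) k)"])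
        fix t :: real assume t: "\<bar>t\<bar> \<le> 1"
        then have tT: "t \<in> ode_time" by auto
        let ?y = "u (z, t)"
        have y: "?y \<in> ball y0 (r/4)" by (rule Z(4)[OF z t])
        have du: "((\<lambda>t. u (z, t)) has_vector_derivative B' ?y (P z)) (at t)"
          using derivative_time[OF zX tT] by (simp add: F_eq)
        have dBu: "((\<lambda>t. B' (u (z, t)) k) has_vector_derivative
            frechet_derivative (\<lambda>y. B' y k) (at ?y) (B' ?y (P z))) (at t)"
          using has_derivative_compose[OF du[unfolded has_vector_derivative_def]
            smooth_on_has_derivative[OF smoothB'[of k] UNIV_I]]
          by (simp add: has_vector_derivative_def linear_scale[OF linDB])
        have DB_eq: "frechet_derivative (\<lambda>y. B' y v) (at ?y) = frechet_derivative (\<lambda>y. B y v) (at ?y)" for v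
          by (rule frechet_derivative_transform_within_open[OF _ open_ball y])
            (use smooth_on_differentiable[OF smoothB' UNIV_I] B'B in auto)
        \<comment> \<open>Commutation of the lifts enters here: the derivative of the field for
          \<open>k\<close> along the flow becomes the linearised right-hand side applied to that
          field.\<close>
        have "frechet_derivative (\<lambda>y. B' y k) (at ?y) (B' ?y (P z)) = frechet_derivative (\<lambda>y. B' y (P z)) (at ?y) (B' ?y k)"
          unfolding DB_eq B'B[OF y] by (rule lifts_commute[OF inv]) (use y quarter in auto)
        with dBu have dBu': "((\<lambda>t. B' (u (z, t)) k) has_vector_derivative
            frechet_derivative (\<lambda>y. B' y (P z)) (at ?y) (B' ?y k)) (at t)" by simp
        have "(W k has_vector_derivative frechet_derivative (\<lambda>y. B' y (P z)) (at ?y) (W k t) + B' ?y k) (at t)"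
          using W[of k] tT k by (simp add: ode_solution_def G_def fF)
        then have "((\<lambda>t. W k t - t *\<^sub>R B' (u (z, t)) k) has_vector_derivative
            (frechet_derivative (\<lambda>y. B' y (P z)) (at ?y) (W k t) + B' ?y k) -
            (t *\<^sub>R frechet_derivative (\<lambda>y. B' y (P z)) (at ?y) (B' ?y k) + 1 *\<^sub>R B' ?y k)) (at t)"
          by (intro has_vector_derivative_diff has_vector_derivative_scaleR dBu') (auto intro!: derivative_eq_intros)
        then show "((\<lambda>t. W k t - t *\<^sub>R B' (u (z, t)) k) has_vector_derivative
            frechet_derivative (\<lambda>y. B' y (P z)) (at ?y) (W k t - t *\<^sub>R B' ?y k)) (at t within {-1..1})"
          by (intro has_vector_derivative_at_within[where S = "{-1..1}"])
            (simp add: linear_diff[OF linDB] linear_scale[OF linDB])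
        show "norm (frechet_derivative (\<lambda>y. B' y (P z)) (at ?y) (W k t - t *\<^sub>R B' ?y k)) \<le> norm (W k t - t *\<^sub>R B' ?y k) / 4 + 0"
          using lipDB[of ?y "W k t - t *\<^sub>R B' ?y k"] norm_ge_zero[of "W k t - t *\<^sub>R B' ?y k"] by linarith
      qed auto
      moreover have "W k 0 = 0" using W[of k] fw by (simp add: ode_solution_def)
      ultimately have "frechet_derivative \<Psi> (at z) k = B' (u (z, 1)) k" by simp
      then show ?thesis using B'B[OF Z(4)[OF z, of 1]] by (simp add: \<Psi>_def)
    qed
    show "frechet_derivative \<Psi> (at 0) v = v" for v
    proof -
      have d\<Psi>: "(\<Psi> has_derivative frechet_derivative \<Psi> (at 0)) (at 0)"
        by (rule smooth_on_has_derivative[OF smooth_\<Psi> X0])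
      have y0: "y0 \<in> ball y0 r" using r by simp
      have Pv: "frechet_derivative \<Psi> (at 0) (P v) = P v"
      proof -
        have "B y0 v - P v = 0"
          by (rule separating[OF y0]) (simp_all add: linear_diff[OF lin_\<theta>[OF y0]] \<theta>_B[OF y0] linear_diff[OF lin_P]
            P_B[OF y0] P_idem P_fixed[symmetric])
        then show ?thesis using D\<Psi>[OF Z(2) P_idem, of v] by (simp add: \<Psi>0 B_P[OF y0])
      qed
      \<comment> \<open>On the image of \<open>P\<close> the derivative at 0 is known by now; along
        the complement \<open>\<Psi>\<close> is the translation by \<open>y0\<close>, by
        \<open>stationary\<close>.\<close>
      define c where "c = v - P v"
      have Pc: "P c = 0" by (simp add: c_def linear_diff[OF lin_P] P_idem)
      have "((\<lambda>s. \<Psi> (s *\<^sub>R c)) has_derivative (\<lambda>s. frechet_derivative \<Psi> (at 0) (s *\<^sub>R c))) (at 0)"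
        by (rule has_derivative_compose[of "\<lambda>s. s *\<^sub>R c" _ _ _ \<Psi>]) (use d\<Psi> in \<open>auto intro!: derivative_eq_intros\<close>)
      moreover have "((\<lambda>s. \<Psi> (s *\<^sub>R c)) has_derivative (\<lambda>s. s *\<^sub>R c)) (at 0)"
      proof (rule has_derivative_transform_within_open[of "\<lambda>s. y0 + s *\<^sub>R c" _ _ _ "(\<lambda>s. s *\<^sub>R c) -` X"])
        show "open ((\<lambda>s::real. s *\<^sub>R c) -` X)" by (intro open_vimage openX continuous_intros)
        show "y0 + s *\<^sub>R c = \<Psi> (s *\<^sub>R c)" if "s \<in> (\<lambda>s. s *\<^sub>R c) -` X" for s
          using stationary[of "s *\<^sub>R c" 1] that Pc by (simp add: \<Psi>_def linear_scale[OF lin_P])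
      qed (use X0 in \<open>auto intro!: derivative_eq_intros\<close>)
      ultimately have "frechet_derivative \<Psi> (at 0) (1 *\<^sub>R c) = 1 *\<^sub>R c"
        by (rule fun_cong[OF has_derivative_unique])
      then show ?thesis
        using Pv linear_add[OF has_derivative_linear[OF d\<Psi>], of "P v" c] by (simp add: c_def)
    qed
  qed
qed

text \<open>The chart \<open>g\<close> is the local inverse of \<open>\<Psi>\<close>, whose
  derivative carries the image of \<open>P\<close>, that is the kernel of
  \<open>\<theta> y0\<close>, by \<open>B y\<close> to the kernel of
  \<open>\<theta> y\<close>.\<close>

theorem frobenius:
  fixes \<theta> :: "'e::euclidean_space \<Rightarrow> 'e \<Rightarrow> 'q::real_inner"
  assumes V: "open V" "y0 \<in> V" and lin: "\<And>y. y \<in> V \<Longrightarrow> linear (\<theta> y)"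
    and smooth: "\<And>v. smooth_on V (\<lambda>y. \<theta> y v)" and surj: "surj (\<theta> y0)"
    and inv: "\<And>y u v. y \<in> V \<Longrightarrow> \<theta> y u = 0 \<Longrightarrow> \<theta> y v = 0 \<Longrightarrow>
      frechet_derivative (\<lambda>y. \<theta> y v) (at y) u = frechet_derivative (\<lambda>y. \<theta> y u) (at y) v"
  obtains U N g \<Psi> where "open U" "y0 \<in> U" "U \<subseteq> V" "open N" "homeomorphism U N g \<Psi>"
    "smooth_on U g" "smooth_on N \<Psi>"
    "\<And>y v. y \<in> U \<Longrightarrow> \<theta> y0 (frechet_derivative g (at y) v) = 0 \<longleftrightarrow> \<theta> y v = 0"
proof -
  obtain r P B L where rV: "ball y0 r \<subseteq> V" and split: "split_coframe \<theta> y0 r P B L"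
    by (rule split_coframe_exists[OF V lin smooth surj])
  interpret split_coframe \<theta> y0 r P B L by (rule split)
  obtain \<Psi> Z where Z: "open Z" "0 \<in> Z" "smooth_on Z \<Psi>" "\<Psi> 0 = y0" "\<Psi> ` Z \<subseteq> ball y0 r"
    and D0: "\<And>v. frechet_derivative \<Psi> (at 0) v = v"
    and DK: "\<And>z k. z \<in> Z \<Longrightarrow> P k = k \<Longrightarrow> frechet_derivative \<Psi> (at z) k = B (\<Psi> z) k"
    by (rule flat_parametrization) (use inv rV in blast)+
  have "inj (frechet_derivative \<Psi> (at 0))" by (simp add: inj_def D0)
  then obtain N U g where N: "open N" "N \<subseteq> Z" "0 \<in> N" and U: "open U" "\<Psi> 0 \<in> U"
    and hom: "homeomorphism N U \<Psi> g" and g: "smooth_on U g"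
    by (rule smooth_inverse_function[OF Z(3,1,2)]) blast
  have UV: "U \<subseteq> ball y0 r" using hom N(2) Z(5) by (auto simp: homeomorphism_def)
  show ?thesis
  proof (rule that[of U N g \<Psi>])
    show "homeomorphism U N g \<Psi>" using hom by (rule homeomorphism_symD)
    show "smooth_on N \<Psi>" by (rule smooth_on_subset[OF Z(3) N(2)])
    fix y v assume y: "y \<in> U"
    have gN: "g y \<in> N" and \<Psi>g: "\<Psi> (g y) = y" using hom y by (auto simp: homeomorphism_def)
    have gZ: "g y \<in> Z" and yr: "y \<in> ball y0 r" using gN N(2) UV y by auto
    have dg: "(g has_derivative frechet_derivative g (at y)) (at y)" by (rule smooth_on_has_derivative[OF g y])
    have d\<Psi>: "(\<Psi> has_derivative frechet_derivative \<Psi> (at (g y))) (at (g y))" by (rule smooth_on_has_derivative[OF Z(3) gZ])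
    have 1: "frechet_derivative \<Psi> (at (g y)) (frechet_derivative g (at y) v) = v" for v
    proof -
      have "((\<lambda>x. \<Psi> (g x)) has_derivative (\<lambda>v. frechet_derivative \<Psi> (at (g y)) (frechet_derivative g (at y) v))) (at y)"
        by (rule has_derivative_compose[OF dg d\<Psi>])
      moreover have "((\<lambda>x. \<Psi> (g x)) has_derivative (\<lambda>v. v)) (at y)"
        by (rule has_derivative_transform_within_open[OF has_derivative_ident U(1) y])
          (use hom in \<open>auto simp: homeomorphism_def\<close>)
      ultimately show ?thesis by (rule fun_cong[OF has_derivative_unique])
    qed
    have 2: "frechet_derivative g (at y) (frechet_derivative \<Psi> (at (g y)) v) = v" for v
    proof -
      have "((\<lambda>x. g (\<Psi> x)) has_derivative (\<lambda>v. frechet_derivative g (at y) (frechet_derivative \<Psi> (at (g y)) v))) (at (g y))"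
        by (rule has_derivative_compose[OF d\<Psi>]) (simp add: \<Psi>g dg)
      moreover have "((\<lambda>x. g (\<Psi> x)) has_derivative (\<lambda>v. v)) (at (g y))"
        by (rule has_derivative_transform_within_open[OF has_derivative_ident N(1) gN])
          (use hom in \<open>auto simp: homeomorphism_def\<close>)
      ultimately show ?thesis by (rule fun_cong[OF has_derivative_unique])
    qed
    show "(\<theta> y0 (frechet_derivative g (at y) v) = 0) = (\<theta> y v = 0)"
    proof
      assume "\<theta> y0 (frechet_derivative g (at y) v) = 0"
      then have "P (frechet_derivative g (at y) v) = frechet_derivative g (at y) v" by (simp add: P_fixed)
      from DK[OF gZ this] show "\<theta> y v = 0" using 1[of v] \<theta>_B[OF yr] \<Psi>g by metis
    next
      assume v: "\<theta> y v = 0"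
      \<comment> \<open>A kernel vector is the lift of its own projection, so \<open>g\<close>
        straightens it to \<open>P v\<close>.\<close>
      have "v - B y (P v) = 0"
        by (rule separating[OF yr]) (simp_all add: v linear_diff[OF lin_\<theta>[OF yr]] \<theta>_B[OF yr] linear_diff[OF lin_P]
          P_B[OF yr] P_idem)
      then have "frechet_derivative g (at y) v = P v" using DK[OF gZ P_idem, of v] 2[of "P v"] \<Psi>g by simp
      then show "\<theta> y0 (frechet_derivative g (at y) v) = 0" using P_idem[of v] by (simp add: P_fixed[symmetric])
    qed
  qed (use U Z(4) N UV rV g in auto)
qed

section \<open>Calculus on manifolds\<close>

lemma is_chartD:
  assumes "is_chart c"
  shows "open (cdom c)" "open (cimg c)"
    and "x \<in> cdom c \<Longrightarrow> cmap c x \<in> cimg c" "x \<in> cdom c \<Longrightarrow> cinv c (cmap c x) = x"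
    and "y \<in> cimg c \<Longrightarrow> cinv c y \<in> cdom c" "y \<in> cimg c \<Longrightarrow> cmap c (cinv c y) = y"
    and "continuous_on (cdom c) (cmap c)" "continuous_on (cimg c) (cinv c)"
  using assms by (auto simp: is_chart_def homeomorphism_def cimg_def)

lemma chart_image_open:
  assumes c: "is_chart c" and U: "open U" "U \<subseteq> cdom c"
  shows "open (cmap c ` U)"
proof -
  have "open (cimg c \<inter> cinv c -` U)"
    by (rule continuous_open_preimage[OF is_chartD(8)[OF c] is_chartD(2)[OF c] U(1)])
  moreover have "cimg c \<inter> cinv c -` U = cmap c ` U"
    using U(2) is_chartD(3-6)[OF c] by (auto simp: image_iff) (metis subsetD)
  ultimately show ?thesis by simp
qed

lemma chart_preimage_open:
  assumes c: "is_chart c" and N: "open N"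
  shows "open (cdom c \<inter> cmap c -` N)"
  by (rule continuous_open_preimage[OF is_chartD(7)[OF c] is_chartD(1)[OF c] N])

text \<open>While \<open>mdiff\<close> is tied to the preferred chart at each point, this version
  works in any fixed chart, in particular a foliated one.\<close>

definition chart_diff :: "('m, 'e::euclidean_space) chart \<Rightarrow> ('m \<Rightarrow> 'b::real_normed_vector) \<Rightarrow> 'm \<Rightarrow> 'e \<Rightarrow> 'b" where
  "chart_diff c f x v = frechet_derivative (f \<circ> cinv c) (at (cmap c x)) v"

lemma mdiff_chart_diff: "mdiff M f p = chart_diff (M p) f p"
  by (auto simp: mdiff_def chart_diff_def)

text \<open>Local, so that coordinate maps qualify although they are meaningful only on their
  domains, and open in the point, so that derivatives can be taken again.\<close>

definition smooth_near_in :: "('m::topological_space, 'e::euclidean_space) chart \<Rightarrow> ('m \<Rightarrow> 'b::real_normed_vector) \<Rightarrow> 'm \<Rightarrow> bool" where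
  "smooth_near_in c f p \<longleftrightarrow> (\<exists>U. open U \<and> p \<in> U \<and> U \<subseteq> cdom c \<and> smooth_on (cmap c ` U) (f \<circ> cinv c))"

lemma smooth_near_in_cong:
  assumes c: "is_chart c" and f: "smooth_near_in c f p" and eq: "\<forall>\<^sub>F x in nhds p. f x = g x"
  shows "smooth_near_in c g p" "chart_diff c f p = chart_diff c g p"
proof -
  obtain U where U: "open U" "p \<in> U" "U \<subseteq> cdom c" "smooth_on (cmap c ` U) (f \<circ> cinv c)"
    using f by (auto simp: smooth_near_in_def)
  obtain V where V: "open V" "p \<in> V" "\<And>x. x \<in> V \<Longrightarrow> f x = g x"
    using eq by (auto simp: eventually_nhds)
  let ?W = "U \<inter> V"
  have op: "open (cmap c ` ?W)" by (rule chart_image_open[OF c]) (use U V in auto)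
  have sm: "smooth_on (cmap c ` ?W) (f \<circ> cinv c)" by (rule smooth_on_subset[OF U(4)]) auto
  have e: "(f \<circ> cinv c) y = (g \<circ> cinv c) y" if "y \<in> cmap c ` ?W" for y
    using that U(3) V(3) is_chartD(4)[OF c] by auto
  have "smooth_on (cmap c ` ?W) (g \<circ> cinv c)" by (rule smooth_on_cong[OF op sm e])
  then show "smooth_near_in c g p"
    unfolding smooth_near_in_def using U V by (intro exI[of _ ?W]) auto
  have pW: "cmap c p \<in> cmap c ` ?W" using U(2) V(2) by auto
  show "chart_diff c f p = chart_diff c g p"
    unfolding chart_diff_def
    by (rule ext) (rule fun_cong[OF frechet_derivative_transform_within_open[OF smooth_on_differentiable[OF sm pW] op pW e]])
qed

lemma smooth_near_in_has_derivative:
  assumes "smooth_near_in c f p"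
  shows "((f \<circ> cinv c) has_derivative chart_diff c f p) (at (cmap c p))"
  using assms unfolding smooth_near_in_def chart_diff_def[abs_def]
  by (metis image_eqI smooth_on_has_derivative)

lemma smooth_near_in_linear: "smooth_near_in c f p \<Longrightarrow> linear (chart_diff c f p)"
  by (rule has_derivative_linear[OF smooth_near_in_has_derivative])

locale smooth_mfd =
  fixes M :: "'m::{t2_space,second_countable_topology} \<Rightarrow> ('m, 'e::euclidean_space) chart"
  assumes M: "smooth_manifold M"
begin

lemma center: "p \<in> cdom (M p)" and chart: "is_chart (M p)" and comp: "compatible (M p) (M q)"
  using M by (auto simp: smooth_manifold_def)

lemma smooth_chart_M: "smooth_chart M (M q)"
  by (simp add: smooth_chart_def chart comp)

lemma smooth_chartD: "smooth_chart M c \<Longrightarrow> is_chart c"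
  by (simp add: smooth_chart_def)

lemma transition_open: "is_chart c \<Longrightarrow> is_chart d \<Longrightarrow> open (cmap c ` (cdom c \<inter> cdom d))"
  by (rule chart_image_open) (auto simp: is_chartD)

text \<open>Charts of the maximal atlas are by definition compatible with the preferred ones only,
  so near \<open>x\<close> the transition is factored through \<open>M x\<close>.\<close>

lemma smooth_transition:
  assumes c: "smooth_chart M c" and d: "smooth_chart M d"
  shows "smooth_on (cmap c ` (cdom c \<inter> cdom d)) (cmap d \<circ> cinv c)"
proof (rule smooth_on_local)
  fix y assume "y \<in> cmap c ` (cdom c \<inter> cdom d)"
  then obtain x where x: "x \<in> cdom c" "x \<in> cdom d" and y: "y = cmap c x" by auto
  let ?m = "M x"
  note ic = smooth_chartD[OF c] and id = smooth_chartD[OF d]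
  define U where "U = cdom c \<inter> cdom d \<inter> cdom ?m"
  have U: "open U" "U \<subseteq> cdom c" "U \<subseteq> cdom ?m" "U \<subseteq> cdom d"
    using ic id chart[of x] by (auto simp: U_def intro!: open_Int is_chartD(1))
  have s1: "smooth_on (cmap c ` U) (cmap ?m \<circ> cinv c)"
    by (rule smooth_on_subset[of "cmap c ` (cdom ?m \<inter> cdom c)"])
      (use c U in \<open>auto simp: smooth_chart_def compatible_def\<close>)
  have s2: "smooth_on (cmap ?m ` U) (cmap d \<circ> cinv ?m)"
    by (rule smooth_on_subset[of "cmap ?m ` (cdom ?m \<inter> cdom d)"])
      (use d U in \<open>auto simp: smooth_chart_def compatible_def\<close>)
  have op: "open (cmap c ` U)" by (rule chart_image_open[OF ic U(1,2)])
  have "smooth_on (cmap c ` U) (\<lambda>y. (cmap d \<circ> cinv ?m) ((cmap ?m \<circ> cinv c) y))"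
    by (rule smooth_on_compose[OF op chart_image_open[OF chart U(1,3)] _ s1 s2])
      (use U(2) ic in \<open>auto simp: is_chartD(4) subset_iff\<close>)
  then have "smooth_on (cmap c ` U) (cmap d \<circ> cinv c)"
    by (rule smooth_on_cong[OF op])
      (use U ic chart[of x] in \<open>auto simp: is_chartD(4) subset_iff\<close>)
  then show "\<exists>U. open U \<and> y \<in> U \<and> smooth_on U (cmap d \<circ> cinv c)"
    using op x center[of x] y by (intro exI[of _ "cmap c ` U"]) (auto simp: U_def)
qed

lemma smooth_near_cmap:
  assumes "smooth_chart M c" "smooth_chart M d" "x \<in> cdom c" "x \<in> cdom d"
  shows "smooth_near_in c (cmap d) x"
  unfolding smooth_near_in_def
  using assms smooth_transition[OF assms(1,2)]
  by (intro exI[of _ "cdom c \<inter> cdom d"]) (auto simp: is_chartD smooth_chartD)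

lemma smooth_near_change:
  assumes c: "smooth_chart M c" and d: "smooth_chart M d" and x: "x \<in> cdom c" "x \<in> cdom d"
    and f: "smooth_near_in d f x"
  shows "smooth_near_in c f x"
    and "chart_diff c f x v = chart_diff d f x (chart_diff c (cmap d) x v)"
proof -
  note ic = smooth_chartD[OF c] and id = smooth_chartD[OF d]
  obtain U where U: "open U" "x \<in> U" "U \<subseteq> cdom d" and sf: "smooth_on (cmap d ` U) (f \<circ> cinv d)"
    using f by (auto simp: smooth_near_in_def)
  let ?U = "U \<inter> cdom c"
  have oU: "open ?U" using U ic by (auto simp: is_chartD)
  have op: "open (cmap c ` ?U)" "open (cmap d ` U)"
    by (rule chart_image_open[OF ic oU], simp) (rule chart_image_open[OF id U(1,3)])
  have st: "smooth_on (cmap c ` ?U) (cmap d \<circ> cinv c)"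
    by (rule smooth_on_subset[OF smooth_transition[OF c d]]) (use U(3) in auto)
  have eq: "(f \<circ> cinv d) ((cmap d \<circ> cinv c) y) = (f \<circ> cinv c) y" if "y \<in> cmap c ` ?U" for y
    using that U(3) ic id by (auto simp: is_chartD(4) subset_iff)
  have "smooth_on (cmap c ` ?U) (\<lambda>y. (f \<circ> cinv d) ((cmap d \<circ> cinv c) y))"
    by (rule smooth_on_compose[OF op _ st sf]) (use ic in \<open>auto simp: is_chartD(4)\<close>)
  then have "smooth_on (cmap c ` ?U) (f \<circ> cinv c)" by (rule smooth_on_cong[OF op(1)]) (rule eq)
  then show s: "smooth_near_in c f x"
    unfolding smooth_near_in_def using oU U(2) x by (intro exI[of _ ?U]) auto
  have "((\<lambda>y. (f \<circ> cinv d) ((cmap d \<circ> cinv c) y)) has_derivative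
      (\<lambda>v. chart_diff d f x (chart_diff c (cmap d) x v))) (at (cmap c x))"
    by (rule has_derivative_compose[OF smooth_near_in_has_derivative[OF smooth_near_cmap[OF c d x]]])
      (use smooth_near_in_has_derivative[OF f] x ic in \<open>simp add: is_chartD(4) comp_def\<close>)
  then have "((f \<circ> cinv c) has_derivative (\<lambda>v. chart_diff d f x (chart_diff c (cmap d) x v))) (at (cmap c x))"
    by (rule has_derivative_transform_within_open[OF _ op(1)]) (use x U(2) eq in auto)
  from fun_cong[OF has_derivative_unique[OF smooth_near_in_has_derivative[OF s] this]]
  show "chart_diff c f x v = chart_diff d f x (chart_diff c (cmap d) x v)" .
qed

lemma chart_diff_self:
  assumes c: "is_chart c" and x: "x \<in> cdom c"
  shows "chart_diff c (cmap c) x v = v"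
proof -
  have "((cmap c \<circ> cinv c) has_derivative (\<lambda>v. v)) (at (cmap c x))"
    by (rule has_derivative_transform_within_open[OF has_derivative_ident is_chartD(2)[OF c]])
      (use x is_chartD(3,6)[OF c] in auto)
  from fun_cong[OF frechet_derivative_at[OF this], of v] show ?thesis by (simp add: chart_diff_def)
qed

lemma chart_diff_inverse:
  assumes c: "smooth_chart M c" and d: "smooth_chart M d" and x: "x \<in> cdom c" "x \<in> cdom d"
  shows "chart_diff c (cmap d) x (chart_diff d (cmap c) x v) = v"
  using smooth_near_change(2)[OF d c x(2,1) smooth_near_cmap[OF c d x], of v]
    chart_diff_self[OF smooth_chartD[OF d] x(2)] by simp

section \<open>Functions smooth near a point and their differentials\<close>

abbreviation smooth_near :: "('m \<Rightarrow> 'b::real_normed_vector) \<Rightarrow> 'm \<Rightarrow> bool" where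
  "smooth_near f p \<equiv> smooth_near_in (M p) f p"

lemmas smooth_near_cong = smooth_near_in_cong[OF chart]

lemma mdiff_cong: "smooth_near f p \<Longrightarrow> \<forall>\<^sub>F x in nhds p. f x = g x \<Longrightarrow> mdiff M f p = mdiff M g p"
  unfolding mdiff_chart_diff by (rule smooth_near_cong(2))

lemma linear_mdiff: "smooth_near f p \<Longrightarrow> linear (mdiff M f p)"
  unfolding mdiff_chart_diff by (rule smooth_near_in_linear)

lemma smooth_near_in_chart: "smooth_near f x \<Longrightarrow> smooth_chart M c \<Longrightarrow> x \<in> cdom c \<Longrightarrow> smooth_near_in c f x"
  by (rule smooth_near_change(1)[OF _ smooth_chart_M _ center])

lemma smooth_near_from_chart: "smooth_near_in c f x \<Longrightarrow> smooth_chart M c \<Longrightarrow> x \<in> cdom c \<Longrightarrow> smooth_near f x"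
  by (rule smooth_near_change(1)[OF smooth_chart_M _ center])

lemma mdiff_in_chart:
  "smooth_near f x \<Longrightarrow> smooth_chart M c \<Longrightarrow> x \<in> cdom c \<Longrightarrow>
    mdiff M f x v = chart_diff c f x (mdiff M (cmap c) x v)"
  unfolding mdiff_chart_diff
  by (rule smooth_near_change(2)[OF smooth_chart_M _ center]) (auto intro: smooth_near_in_chart)

lemma smooth_near_chart_map: "smooth_chart M c \<Longrightarrow> x \<in> cdom c \<Longrightarrow> smooth_near (cmap c) x"
  by (rule smooth_near_cmap[OF smooth_chart_M _ center])

lemma smooth_near_isCont:
  assumes "smooth_near f p"
  shows "isCont f p"
proof -
  obtain U where U: "open U" "p \<in> U" "U \<subseteq> cdom (M p)" "smooth_on (cmap (M p) ` U) (f \<circ> cinv (M p))"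
    using assms by (auto simp: smooth_near_in_def)
  have "continuous_on U (\<lambda>x. (f \<circ> cinv (M p)) (cmap (M p) x))"
    by (rule continuous_on_compose2[OF smooth_on_continuous[OF U(4)]])
      (use continuous_on_subset[OF is_chartD(7)[OF chart] U(3)] in auto)
  then have "continuous_on U f"
    by (rule continuous_on_eq) (use U(3) chart[of p] in \<open>auto simp: is_chartD(4)\<close>)
  then show ?thesis using U(1,2) by (simp add: continuous_on_eq_continuous_at)
qed

lemma smooth_near_const: "smooth_near (\<lambda>x. c) p"
  unfolding smooth_near_in_def
  using center chart by (intro exI[of _ "cdom (M p)"]) (auto simp: is_chartD comp_def)

lemma smooth_near_bounded_linear:
  assumes f: "smooth_near f p" and l: "bounded_linear l"
  shows "smooth_near (\<lambda>x. l (f x)) p" "mdiff M (\<lambda>x. l (f x)) p v = l (mdiff M f p v)"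
proof -
  obtain U where U: "open U" "p \<in> U" "U \<subseteq> cdom (M p)" "smooth_on (cmap (M p) ` U) (f \<circ> cinv (M p))"
    using f by (auto simp: smooth_near_in_def)
  have "smooth_on (cmap (M p) ` U) (\<lambda>y. l ((f \<circ> cinv (M p)) y))"
    by (rule smooth_on_bounded_linear_comp[OF chart_image_open[OF chart U(1,3)] l U(4)])
  then show s: "smooth_near (\<lambda>x. l (f x)) p"
    using U by (auto simp: smooth_near_in_def comp_def)
  have "((\<lambda>y. l ((f \<circ> cinv (M p)) y)) has_derivative (\<lambda>v. l (chart_diff (M p) f p v))) (at (cmap (M p) p))"
    by (rule bounded_linear.has_derivative[OF l smooth_near_in_has_derivative[OF f]])
  moreover have "((\<lambda>y. l ((f \<circ> cinv (M p)) y)) has_derivative chart_diff (M p) (\<lambda>x. l (f x)) p) (at (cmap (M p) p))"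
    using smooth_near_in_has_derivative[OF s] by (simp add: comp_def)
  ultimately show "mdiff M (\<lambda>x. l (f x)) p v = l (mdiff M f p v)"
    unfolding mdiff_chart_diff using fun_cong[OF has_derivative_unique] by blast
qed

lemma smooth_near_diff:
  assumes f: "smooth_near f p" and g: "smooth_near g p"
  shows "smooth_near (\<lambda>x. f x - g x) p" "mdiff M (\<lambda>x. f x - g x) p v = mdiff M f p v - mdiff M g p v"
proof -
  obtain U where U: "open U" "p \<in> U" "U \<subseteq> cdom (M p)" "smooth_on (cmap (M p) ` U) (f \<circ> cinv (M p))"
    using f by (auto simp: smooth_near_in_def)
  obtain V where V: "open V" "p \<in> V" "V \<subseteq> cdom (M p)" "smooth_on (cmap (M p) ` V) (g \<circ> cinv (M p))"
    using g by (auto simp: smooth_near_in_def)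
  have o: "open (cmap (M p) ` (U \<inter> V))" by (rule chart_image_open[OF chart]) (use U V in auto)
  have "smooth_on (cmap (M p) ` (U \<inter> V)) (\<lambda>y. (f \<circ> cinv (M p)) y - (g \<circ> cinv (M p)) y)"
    by (intro smooth_on_diff o smooth_on_subset[OF U(4)] smooth_on_subset[OF V(4)]) auto
  then show s: "smooth_near (\<lambda>x. f x - g x) p"
    unfolding smooth_near_in_def using U V by (intro exI[of _ "U \<inter> V"]) (auto simp: comp_def)
  have "((\<lambda>y. (f \<circ> cinv (M p)) y - (g \<circ> cinv (M p)) y) has_derivative
      (\<lambda>v. chart_diff (M p) f p v - chart_diff (M p) g p v)) (at (cmap (M p) p))"
    by (intro has_derivative_diff smooth_near_in_has_derivative f g)
  moreover have "((\<lambda>y. (f \<circ> cinv (M p)) y - (g \<circ> cinv (M p)) y) has_derivative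
      chart_diff (M p) (\<lambda>x. f x - g x) p) (at (cmap (M p) p))"
    using smooth_near_in_has_derivative[OF s] by (simp add: comp_def)
  ultimately show "mdiff M (\<lambda>x. f x - g x) p v = mdiff M f p v - mdiff M g p v"
    unfolding mdiff_chart_diff using fun_cong[OF has_derivative_unique] by blast
qed

lemma mdiff_const [simp]: "mdiff M (\<lambda>x. c) p v = 0"
  by (simp add: mdiff_def comp_def)

subsection \<open>Vector fields and one-forms\<close>

lemma vf_rep_eq: "x \<in> cdom (M q) \<Longrightarrow> vf_rep M q X (cmap (M q) x) = mdiff M (cmap (M q)) x (X x)"
  by (simp add: vf_rep_def is_chartD(4)[OF chart])

lemma vf_rep_center: "vf_rep M p X (cmap (M p) p) = X p"
  by (simp add: vf_rep_eq center mdiff_chart_diff chart_diff_self chart)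

lemma coord_vec_eq: "coord_vec M q v x = chart_diff (M q) (cmap (M x)) x v"
  by (simp add: coord_vec_def chart_diff_def)

lemma coord_vec_center: "coord_vec M p v p = v"
  by (simp add: coord_vec_eq chart_diff_self chart center)

lemma mdiff_coord_vec:
  assumes "x \<in> cdom (M q)" "smooth_near f x"
  shows "mdiff M f x (coord_vec M q v x) = chart_diff (M q) f x v"
  unfolding mdiff_in_chart[OF assms(2) smooth_chart_M assms(1)]
  by (simp add: coord_vec_eq mdiff_chart_diff chart_diff_inverse[OF smooth_chart_M smooth_chart_M center assms(1)])

lemma coord_vec_mdiff: "x \<in> cdom (M q) \<Longrightarrow> coord_vec M q (mdiff M (cmap (M q)) x v) x = v"
  by (simp add: coord_vec_eq mdiff_chart_diff chart_diff_inverse[OF smooth_chart_M smooth_chart_M _ center])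

lemma linear_coord_vec: "x \<in> cdom (M q) \<Longrightarrow> linear (\<lambda>v. coord_vec M q v x)"
  using smooth_near_in_linear[OF smooth_near_cmap[OF smooth_chart_M smooth_chart_M _ center]]
  by (simp add: coord_vec_eq)

text \<open>The second conclusion writes the derivative along \<open>X\<close> in the one chart
  \<open>M p\<close> for all nearby points; in this form it can be differentiated once more.\<close>

lemma smooth_near_mdiff:
  assumes f: "smooth_near f p" and X: "smooth_vf M X"
  shows "smooth_near (\<lambda>x. mdiff M f x (X x)) p"
    and "\<forall>\<^sub>F y in nhds (cmap (M p) p). ((\<lambda>x. mdiff M f x (X x)) \<circ> cinv (M p)) y =
      frechet_derivative (f \<circ> cinv (M p)) (at y) (vf_rep M p X y)"
proof -
  obtain U where U: "open U" "p \<in> U" "U \<subseteq> cdom (M p)" "smooth_on (cmap (M p) ` U) (f \<circ> cinv (M p))"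
    using f by (auto simp: smooth_near_in_def)
  have op: "open (cmap (M p) ` U)" by (rule chart_image_open[OF chart U(1,3)])
  have eq: "frechet_derivative (f \<circ> cinv (M p)) (at y) (vf_rep M p X y) = ((\<lambda>x. mdiff M f x (X x)) \<circ> cinv (M p)) y"
    if "y \<in> cmap (M p) ` U" for y
  proof -
    from that obtain x where x: "x \<in> U" "y = cmap (M p) x" by (rule imageE) blast
    have xp: "x \<in> cdom (M p)" using x U by auto
    have "smooth_near f x"
      by (rule smooth_near_from_chart[OF _ smooth_chart_M xp]) (use x U in \<open>auto simp: smooth_near_in_def\<close>)
    from mdiff_in_chart[OF this smooth_chart_M xp]
    show ?thesis by (simp add: x(2) vf_rep_eq[OF xp] is_chartD(4)[OF chart xp] chart_diff_def)
  qed
  have "smooth_on (cmap (M p) ` U) (\<lambda>y. frechet_derivative (f \<circ> cinv (M p)) (at y) (vf_rep M p X y))"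
    by (rule smooth_on_frechet[OF op U(4)], rule smooth_on_subset[of "cimg (M p)"])
      (use X U(3) in \<open>auto simp: smooth_vf_def cimg_def\<close>)
  then have "smooth_on (cmap (M p) ` U) ((\<lambda>x. mdiff M f x (X x)) \<circ> cinv (M p))"
    by (rule smooth_on_cong[OF op]) (rule eq)
  then show "smooth_near (\<lambda>x. mdiff M f x (X x)) p"
    unfolding smooth_near_in_def using U by blast
  show "\<forall>\<^sub>F y in nhds (cmap (M p) p). ((\<lambda>x. mdiff M f x (X x)) \<circ> cinv (M p)) y =
      frechet_derivative (f \<circ> cinv (M p)) (at y) (vf_rep M p X y)"
    unfolding eventually_nhds using op U(2) eq by (intro exI[of _ "cmap (M p) ` U"]) auto
qed

text \<open>In the chart at \<open>p\<close> the terms with second derivatives of \<open>f\<close>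
  cancel by symmetry; those with derivatives of the coefficients of \<open>X\<close> and
  \<open>Y\<close> are the bracket.\<close>

lemma mdiff_bracket:
  fixes f :: "'m \<Rightarrow> 'b::real_inner"
  assumes f: "smooth_near f p" and X: "smooth_vf M X" and Y: "smooth_vf M Y"
  shows "mdiff M f p (vf_bracket M X Y p) =
    mdiff M (\<lambda>x. mdiff M f x (Y x)) p (X p) - mdiff M (\<lambda>x. mdiff M f x (X x)) p (Y p)"
proof -
  let ?f = "f \<circ> cinv (M p)" and ?y = "cmap (M p) p"
  obtain U where U: "open U" "p \<in> U" "U \<subseteq> cdom (M p)" "smooth_on (cmap (M p) ` U) ?f"
    using f by (auto simp: smooth_near_in_def)
  have op: "open (cmap (M p) ` U)" by (rule chart_image_open[OF chart U(1,3)])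
  have y: "?y \<in> cmap (M p) ` U" using U by auto
  have second: "mdiff M (\<lambda>x. mdiff M f x (Z x)) p v =
      frechet_derivative (\<lambda>y. frechet_derivative ?f (at y) (Z p)) (at ?y) v +
      mdiff M f p (frechet_derivative (vf_rep M p Z) (at ?y) v)" if Z: "smooth_vf M Z" for Z v
  proof -
    have dZ: "(vf_rep M p Z has_derivative frechet_derivative (vf_rep M p Z) (at ?y)) (at ?y)"
      by (rule smooth_on_has_derivative[of "cimg (M p)"])
        (use Z center chart in \<open>auto simp: smooth_vf_def is_chartD(3)\<close>)
    have "((\<lambda>y. frechet_derivative ?f (at y) (vf_rep M p Z y)) has_derivative
        (\<lambda>u. frechet_derivative (\<lambda>y. frechet_derivative ?f (at y) (vf_rep M p Z ?y)) (at ?y) u +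
          frechet_derivative ?f (at ?y) (frechet_derivative (vf_rep M p Z) (at ?y) u))) (at ?y)"
    proof (rule has_derivative_linear_family[OF op y _ _ dZ])
      show "linear (frechet_derivative ?f (at y))" if "y \<in> cmap (M p) ` U" for y
        by (rule has_derivative_linear[OF smooth_on_has_derivative[OF U(4) that]])
      show "(\<lambda>y. frechet_derivative ?f (at y) b) differentiable at ?y" for b
        by (rule smooth_on_differentiable[OF smooth_on_frechet_const[OF U(4)] y])
    qed
    then have "(((\<lambda>x. mdiff M f x (Z x)) \<circ> cinv (M p)) has_derivative
        (\<lambda>u. frechet_derivative (\<lambda>y. frechet_derivative ?f (at y) (vf_rep M p Z ?y)) (at ?y) u +
          frechet_derivative ?f (at ?y) (frechet_derivative (vf_rep M p Z) (at ?y) u))) (at ?y)"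
      by (rule has_derivative_transform_eventually)
        (use smooth_near_mdiff(2)[OF f Z] in \<open>auto simp: eventually_nhds_conv_at eq_commute elim: eventually_mono\<close>)
    from fun_cong[OF frechet_derivative_at[OF this], of v]
    show ?thesis by (simp add: mdiff_def vf_rep_center)
  qed
  have "diff_times_on 2 (cmap (M p) ` U) ?f" using U(4) by (simp add: smooth_on_def)
  from symmetric_second_derivative[OF this op y]
  show ?thesis
    unfolding second[OF X] second[OF Y] vf_bracket_def
    by (simp add: linear_diff[OF linear_mdiff[OF f]])
qed

text \<open>The coefficients of the form in the chart \<open>M q\<close>, as a family of linear maps
  on an open subset of the model space; this is the input of \<open>frobenius\<close> and
  \<open>split_coframe_exists\<close>.\<close>

definition form_rep :: "('m \<Rightarrow> 'e \<Rightarrow> 'g) \<Rightarrow> 'm \<Rightarrow> 'e \<Rightarrow> 'e \<Rightarrow> 'g" where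
  "form_rep \<omega> q y v = \<omega> (cinv (M q) y) (coord_vec M q v (cinv (M q) y))"

lemma form_rep_eq: "x \<in> cdom (M q) \<Longrightarrow> form_rep \<omega> q (cmap (M q) x) v = \<omega> x (coord_vec M q v x)"
  by (simp add: form_rep_def is_chartD(4)[OF chart])

lemma smooth_form_rep: "smooth_one_form M \<omega> \<Longrightarrow> smooth_on (cimg (M q)) (\<lambda>y. form_rep \<omega> q y v)"
  by (simp add: smooth_one_form_def form_rep_def Let_def)

lemma linear_form_rep:
  assumes "smooth_one_form M \<omega>" "y \<in> cimg (M q)"
  shows "linear (form_rep \<omega> q y)"
proof -
  have "linear (\<omega> (cinv (M q) y) \<circ> (\<lambda>v. coord_vec M q v (cinv (M q) y)))"
    by (rule linear_compose[OF linear_coord_vec]) (use assms chart in \<open>auto simp: is_chartD smooth_one_form_def\<close>)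
  then show ?thesis by (simp add: form_rep_def[abs_def] comp_def)
qed

lemma smooth_near_form:
  assumes \<omega>: "smooth_one_form M \<omega>" and X: "smooth_vf M X"
  shows "smooth_near (\<lambda>x. \<omega> x (X x)) p"
proof -
  have op: "open (cimg (M p))" by (rule is_chartD(2)[OF chart])
  have "smooth_on (cimg (M p)) (\<lambda>y. form_rep \<omega> p y (vf_rep M p X y))"
    by (rule smooth_on_linear_family[OF op linear_form_rep[OF \<omega>] smooth_form_rep[OF \<omega>]])
      (use X in \<open>auto simp: smooth_vf_def\<close>)
  then have "smooth_on (cimg (M p)) ((\<lambda>x. \<omega> x (X x)) \<circ> cinv (M p))"
  proof (rule smooth_on_cong[OF op])
    fix y assume "y \<in> cimg (M p)"
    then obtain x where "x \<in> cdom (M p)" "y = cmap (M p) x" by (auto simp: cimg_def)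
    then show "form_rep \<omega> p y (vf_rep M p X y) = ((\<lambda>x. \<omega> x (X x)) \<circ> cinv (M p)) y"
      by (simp add: form_rep_eq vf_rep_eq coord_vec_mdiff is_chartD(4)[OF chart])
  qed
  then show ?thesis
    unfolding smooth_near_in_def
    using center chart by (intro exI[of _ "cdom (M p)"]) (auto simp: is_chartD cimg_def)
qed

text \<open>The scalar \<open>s\<close> is exposed so that pointwise linear conditions on
  \<open>g\<close>, such as tangency, survive the cut-off.\<close>

lemma smooth_cutoff:
  fixes g :: "'e \<Rightarrow> 'b::real_normed_vector"
  assumes N: "open N" "y0 \<in> N" and g: "smooth_on N g"
  obtains r g' s where "0 < r" "cball y0 r \<subseteq> N" "smooth_on UNIV g'" "\<And>y. y \<notin> cball y0 r \<Longrightarrow> g' y = 0"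
    "\<And>y. g' y = s y *\<^sub>R g y" "\<And>y. y \<in> ball y0 (r/2) \<Longrightarrow> g' y = g y"
proof -
  obtain r where r: "0 < r" "cball y0 r \<subseteq> N" using N open_contains_cball by blast
  let ?g = "\<lambda>y. bump r (y - y0) *\<^sub>R g y"
  have 0: "?g y = 0" if "y \<notin> cball y0 r" for y
    using bump_eq_0[OF r(1), of "y - y0"] that by (simp add: dist_norm norm_minus_commute)
  have "smooth_on UNIV ?g"
  proof (rule smooth_on_local)
    fix y
    show "\<exists>U. open U \<and> y \<in> U \<and> smooth_on U ?g"
    proof (cases "y \<in> N")
      case True
      have "smooth_on N (\<lambda>y. bump r (y - y0))"
        by (rule smooth_on_compose[OF N(1) open_UNIV _ _ smooth_on_bump[OF r(1)]])
          (use N in \<open>auto intro!: smooth_on_diff\<close>)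
      then have "smooth_on N ?g" by (intro smooth_on_scaleR N g)
      then show ?thesis using True N(1) by blast
    next
      case False
      have "smooth_on (- cball y0 r) ?g"
        by (rule smooth_on_cong[OF _ smooth_on_const[of _ 0]]) (use 0 in auto)
      moreover have "y \<in> - cball y0 r" using False r(2) by auto
      ultimately show ?thesis by (metis closed_cball open_Compl)
    qed
  qed
  moreover have "?g y = g y" if "y \<in> ball y0 (r/2)" for y
    using bump_eq_1[OF r(1), of "y - y0"] that by (simp add: dist_norm norm_minus_commute)
  ultimately show ?thesis using r 0 by (intro that[of r ?g "\<lambda>y. bump r (y - y0)"]) auto
qed

text \<open>The last conclusion says that every value is 0 or a multiple of the prescribed one, so
  the global extension stays in any field of subspaces that contains the local data.\<close>

lemma extend_vector_field:
  assumes x0: "x0 \<in> cdom (M q)" and N: "open N" "N \<subseteq> cimg (M q)" "cmap (M q) x0 \<in> N" and g: "smooth_on N g"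
  obtains X where "smooth_vf M X" "\<forall>\<^sub>F x in nhds x0. X x = coord_vec M q (g (cmap (M q) x)) x"
    "\<And>x. X x = 0 \<or> (x \<in> cdom (M q) \<and> cmap (M q) x \<in> N \<and> (\<exists>s. X x = s *\<^sub>R coord_vec M q (g (cmap (M q) x)) x))"
proof -
  let ?y0 = "cmap (M q) x0"
  obtain r g' s where r: "0 < r" "cball ?y0 r \<subseteq> N" and g': "smooth_on UNIV g'" "\<And>y. y \<notin> cball ?y0 r \<Longrightarrow> g' y = 0"
    "\<And>y. g' y = s y *\<^sub>R g y" "\<And>y. y \<in> ball ?y0 (r/2) \<Longrightarrow> g' y = g y"
    using smooth_cutoff[OF N(1,3) g] by blast
  define X where "X x = (if x \<in> cdom (M q) then coord_vec M q (g' (cmap (M q) x)) x else 0)" for x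
  \<comment> \<open>A compact set, hence closed because the manifold is Hausdorff; this makes the
    extension by zero smooth at points outside the chart domain.\<close>
  define K where "K = cinv (M q) ` cball ?y0 r"
  have sub: "cball ?y0 r \<subseteq> cimg (M q)" using r N by auto
  have "compact K"
    unfolding K_def
    by (intro compact_continuous_image compact_cball continuous_on_subset[OF is_chartD(8)[OF chart] sub])
  then have K: "closed K" by (rule compact_imp_closed)
  have coord0: "coord_vec M q 0 x = 0" if "x \<in> cdom (M q)" for x
    by (rule linear_0[OF linear_coord_vec[OF that]])
  have XK: "X x = 0" if "x \<notin> K" for x
  proof (cases "x \<in> cdom (M q)")
    case True
    then have "cmap (M q) x \<notin> cball ?y0 r"
      using that is_chartD(4)[OF chart True] unfolding K_def by (metis imageI)
    then show ?thesis using True coord0 by (simp add: X_def g'(2))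
  qed (simp add: X_def)
  have smoothX: "smooth_on (cimg (M p)) (vf_rep M p X)" for p
  proof (rule smooth_on_local)
    fix y assume y: "y \<in> cimg (M p)"
    define x where "x = cinv (M p) y"
    have x: "x \<in> cdom (M p)" "cmap (M p) x = y" using is_chartD(5,6)[OF chart y] by (auto simp: x_def)
    show "\<exists>U. open U \<and> y \<in> U \<and> smooth_on U (vf_rep M p X)"
    proof (cases "x \<in> cdom (M q)")
      case True
      let ?U = "cmap (M p) ` (cdom (M p) \<inter> cdom (M q))" and ?V = "cmap (M q) ` (cdom (M q) \<inter> cdom (M p))"
      have U: "open ?U" and V: "open ?V" by (rule transition_open[OF chart chart])+
      have sV: "smooth_on ?V (\<lambda>z. frechet_derivative (cmap (M p) \<circ> cinv (M q)) (at z) (g' z))"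
        by (rule smooth_on_frechet[OF V smooth_transition[OF smooth_chart_M smooth_chart_M] smooth_on_subset[OF g'(1)]]) simp
      have "smooth_on ?U (\<lambda>y. frechet_derivative (cmap (M p) \<circ> cinv (M q)) (at ((cmap (M q) \<circ> cinv (M p)) y))
          (g' ((cmap (M q) \<circ> cinv (M p)) y)))"
        by (rule smooth_on_compose[OF U V _ smooth_transition[OF smooth_chart_M smooth_chart_M] sV])
          (auto simp: is_chartD(4)[OF chart])
      then have "smooth_on ?U (vf_rep M p X)"
      proof (rule smooth_on_cong[OF U])
        fix z assume "z \<in> ?U"
        then obtain x where x: "x \<in> cdom (M p)" "x \<in> cdom (M q)" "z = cmap (M p) x" by auto
        have "vf_rep M p X z = mdiff M (cmap (M p)) x (coord_vec M q (g' (cmap (M q) x)) x)"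
          by (simp add: x vf_rep_eq X_def)
        also have "\<dots> = chart_diff (M q) (cmap (M p)) x (g' (cmap (M q) x))"
          by (rule mdiff_coord_vec[OF x(2) smooth_near_chart_map[OF smooth_chart_M x(1)]])
        finally show "frechet_derivative (cmap (M p) \<circ> cinv (M q)) (at ((cmap (M q) \<circ> cinv (M p)) z))
          (g' ((cmap (M q) \<circ> cinv (M p)) z)) = vf_rep M p X z"
          by (simp add: chart_diff_def x is_chartD(4)[OF chart])
      qed
      then show ?thesis using U True x by (intro exI[of _ ?U]) auto
    next
      case False
      have "x \<notin> K" using False sub is_chartD(5)[OF chart] by (auto simp: K_def)
      let ?U = "cmap (M p) ` (cdom (M p) \<inter> - K)"
      have U: "open ?U" by (rule chart_image_open[OF chart]) (use K chart in \<open>auto intro!: open_Int is_chartD(1)\<close>)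
      have "smooth_on ?U (vf_rep M p X)"
      proof (rule smooth_on_cong[OF U smooth_on_const[of _ 0]])
        fix z assume "z \<in> ?U"
        then obtain x where x: "x \<in> cdom (M p)" "x \<notin> K" "z = cmap (M p) x" by auto
        then show "0 = vf_rep M p X z"
          by (simp add: vf_rep_eq XK linear_0[OF linear_mdiff[OF smooth_near_chart_map[OF smooth_chart_M]]])
      qed
      then show ?thesis using U \<open>x \<notin> K\<close> x by (intro exI[of _ ?U]) auto
    qed
  qed
  show ?thesis
  proof (rule that[of X])
    show "smooth_vf M X" using smoothX by (simp add: smooth_vf_def)
    have "open (cdom (M q) \<inter> cmap (M q) -` ball ?y0 (r/2))" by (rule chart_preimage_open[OF chart open_ball])
    then show "\<forall>\<^sub>F x in nhds x0. X x = coord_vec M q (g (cmap (M q) x)) x"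
      unfolding eventually_nhds
      by (rule exI[of _ "cdom (M q) \<inter> cmap (M q) -` ball ?y0 (r/2)", OF conjI])
        (use x0 r in \<open>auto simp: X_def g'(4)\<close>)
    show "X x = 0 \<or> (x \<in> cdom (M q) \<and> cmap (M q) x \<in> N \<and> (\<exists>s. X x = s *\<^sub>R coord_vec M q (g (cmap (M q) x)) x))" for x
    proof (cases "x \<in> K")
      case True
      then have x: "x \<in> cdom (M q)" "cmap (M q) x \<in> N"
        using sub r(2) is_chartD(5,6)[OF chart] by (auto simp: K_def subset_iff)
      then have "X x = s (cmap (M q) x) *\<^sub>R coord_vec M q (g (cmap (M q) x)) x"
        by (simp add: X_def g'(3) linear_scale[OF linear_coord_vec])
      then show ?thesis using x by blast
    qed (simp add: XK)
  qed
qed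

text \<open>Surjectivity at \<open>p\<close> gives a smooth right inverse of the form nearby. The
  global clause on multiples serves \<g> = 0 (fields in the kernel) and constants in a
  subspace.\<close>

lemma lift_to_vector_field:
  fixes \<omega> :: "'m \<Rightarrow> 'e \<Rightarrow> 'g::real_inner"
  assumes \<omega>: "smooth_one_form M \<omega>" and surj: "surj (\<omega> p)" and g: "smooth_near g p" and v: "\<omega> p v = g p"
  obtains Y where "smooth_vf M Y" "Y p = v" "\<forall>\<^sub>F x in nhds p. \<omega> x (Y x) = g x" "\<And>x. \<exists>s. \<omega> x (Y x) = s *\<^sub>R g x"
proof -
  let ?\<theta> = "form_rep \<omega> p" and ?y0 = "cmap (M p) p"
  have \<theta>: "?\<theta> (cmap (M p) x) v = \<omega> x (coord_vec M p v x)" if "x \<in> cdom (M p)" for x v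
    by (rule form_rep_eq[OF that])
  have y0: "?y0 \<in> cimg (M p)" by (rule is_chartD(3)[OF chart center])
  have "?\<theta> ?y0 = \<omega> p" by (rule ext) (simp add: form_rep_eq[OF center] coord_vec_center)
  then have surj0: "surj (?\<theta> ?y0)" using surj by simp
  obtain r P B L where rsub: "ball ?y0 r \<subseteq> cimg (M p)" and "split_coframe ?\<theta> ?y0 r P B L"
    by (rule split_coframe_exists[OF is_chartD(2)[OF chart] y0 linear_form_rep[OF \<omega>] smooth_form_rep[OF \<omega>] surj0])
  then interpret split_coframe ?\<theta> ?y0 r P B L by simp
  obtain U where U: "open U" "p \<in> U" "U \<subseteq> cdom (M p)" "smooth_on (cmap (M p) ` U) (g \<circ> cinv (M p))"
    using g by (auto simp: smooth_near_in_def)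
  define N where "N = ball ?y0 r \<inter> cmap (M p) ` U"
  have N: "open N" "N \<subseteq> ball ?y0 r" "N \<subseteq> cmap (M p) ` U" "?y0 \<in> N"
    using chart_image_open[OF chart U(1,3)] r U(2) by (auto simp: N_def)
  \<comment> \<open>The term with \<open>L\<close> produces the prescribed value of the form; the
    term with \<open>B\<close> adjusts the kernel component so that the value at \<open>?y0\<close>
    is \<open>v\<close>.\<close>
  define h where "h y = B y v + L y ((g \<circ> cinv (M p)) y)" for y
  have h: "smooth_on N h"
    unfolding h_def
    by (intro smooth_on_add N(1) smooth_on_subset[OF smooth_B N(2)] smooth_L[OF N(1,2)] smooth_on_subset[OF U(4) N(3)])
  have \<theta>h: "?\<theta> y (h y) = (g \<circ> cinv (M p)) y" "P (h y) = P v" if "y \<in> N" for y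
    using that N(2) by (auto simp: h_def linear_add[OF lin_\<theta>] \<theta>_B \<theta>_L linear_add[OF lin_P] P_B P_L subset_iff)
  have h0: "h ?y0 = v"
  proof -
    have "h ?y0 - v = 0"
    proof (rule separating)
      show "?y0 \<in> ball ?y0 r" using N by auto
      show "?\<theta> ?y0 (h ?y0 - v) = 0"
        using \<theta>h(1)[OF N(4)] v linear_form_rep[OF \<omega> y0]
        by (simp add: \<open>?\<theta> ?y0 = \<omega> p\<close> is_chartD(4)[OF chart center] linear_diff)
      show "P (h ?y0 - v) = 0" using \<theta>h(2)[OF N(4)] by (simp add: linear_diff[OF lin_P])
    qed
    then show ?thesis by simp
  qed
  obtain Y where Y: "smooth_vf M Y" "\<forall>\<^sub>F x in nhds p. Y x = coord_vec M p (h (cmap (M p) x)) x"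
    "\<And>x. Y x = 0 \<or> (x \<in> cdom (M p) \<and> cmap (M p) x \<in> N \<and> (\<exists>s. Y x = s *\<^sub>R coord_vec M p (h (cmap (M p) x)) x))"
    by (rule extend_vector_field[OF center N(1) _ N(4) h]) (use N(2) rsub in auto)
  have \<omega>Y: "\<omega> x (coord_vec M p (h (cmap (M p) x)) x) = g x" if "x \<in> cdom (M p)" "cmap (M p) x \<in> N" for x
    using \<theta>h(1)[OF that(2)] \<theta>[OF that(1)] by (simp add: is_chartD(4)[OF chart that(1)])
  show ?thesis
  proof (rule that[of Y])
    show "smooth_vf M Y" by fact
    show "Y p = v" using eventually_nhds_x_imp_x[OF Y(2)] by (simp add: h0 coord_vec_center)
    have "\<forall>\<^sub>F x in nhds p. x \<in> cdom (M p) \<inter> cmap (M p) -` N"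
      by (rule eventually_nhds_in_open[OF chart_preimage_open[OF chart N(1)]]) (use center N(4) in auto)
    with Y(2) show "\<forall>\<^sub>F x in nhds p. \<omega> x (Y x) = g x"
      by eventually_elim (simp add: \<omega>Y)
    have lin: "linear (\<omega> x)" for x using \<omega> by (simp add: smooth_one_form_def)
    show "\<exists>s. \<omega> x (Y x) = s *\<^sub>R g x" for x
      using Y(3)[of x]
    proof (elim disjE conjE exE)
      assume "Y x = 0"
      then show ?thesis by (intro exI[of _ 0]) (simp add: linear_0[OF lin])
    next
      fix s assume "x \<in> cdom (M p)" "cmap (M p) x \<in> N" "Y x = s *\<^sub>R coord_vec M p (h (cmap (M p) x)) x"
      then show ?thesis using \<omega>Y[of x] by (intro exI[of _ s]) (simp add: linear_scale[OF lin])
    qed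
  qed
qed

end

section \<open>Foliations\<close>

text \<open>\<open>A\<close> is the orthogonal projection onto the complement of \<open>W\<close>.
  It turns a condition modulo \<open>W\<close> into a linear equation: moving tangentially means
  that \<open>A\<close> composed with a foliated chart is constant.\<close>

lemma subspace_eq_kernel:
  fixes W :: "'e::euclidean_space set"
  assumes "subspace W"
  obtains A :: "'e \<Rightarrow> 'e" where "linear A" "\<And>v. A v = 0 \<longleftrightarrow> v \<in> W"
proof -
  obtain B where B: "B \<subseteq> W\<^sup>\<bottom>" "pairwise orthogonal B" "\<And>x. x \<in> B \<Longrightarrow> norm x = 1" "independent B"
    "span B = W\<^sup>\<bottom>"
    using orthonormal_basis_subspace[OF subspace_orthogonal_comp, of W] by metis
  have fB: "finite B" by (rule independent_imp_finite[OF B(4)])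
  define A where "A v = (\<Sum>b\<in>B. (v \<bullet> b) *\<^sub>R b)" for v
  have "linear A"
    by (rule linearI) (simp_all add: A_def inner_add_left scaleR_add_left sum.distrib scaleR_sum_right)
  moreover have "A v = 0 \<longleftrightarrow> v \<in> W" for v
  proof
    assume "A v = 0"
    then have "(\<Sum>b\<in>B. (v \<bullet> b) *\<^sub>R b) \<bullet> c = 0" for c by (simp add: A_def)
    then have "v \<bullet> c = 0" if "c \<in> B" for c
    proof -
      have "(\<Sum>b\<in>B. (v \<bullet> b) *\<^sub>R b) \<bullet> c = (\<Sum>b\<in>B. if b = c then v \<bullet> c else 0)"
        unfolding inner_sum_left
        by (rule sum.cong)
          (use B(2,3) that in \<open>auto simp: pairwise_def orthogonal_def dot_square_norm\<close>)
      then show ?thesis using \<open>\<And>c. (\<Sum>b\<in>B. (v \<bullet> b) *\<^sub>R b) \<bullet> c = 0\<close>[of c] fB that by simp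
    qed
    then have "orthogonal c v" if "c \<in> B" for c using that by (simp add: orthogonal_def inner_commute)
    then have "orthogonal v x" if "x \<in> span B" for x
      using that by (intro orthogonal_to_span[OF that]) (simp add: orthogonal_commute)
    then have "v \<in> W\<^sup>\<bottom>\<^sup>\<bottom>" by (auto simp: B(5) orthogonal_comp_def orthogonal_commute)
    then show "v \<in> W" using orthogonal_comp_self[OF assms] by simp
  next
    assume "v \<in> W"
    then have "v \<bullet> b = 0" if "b \<in> B" for b
      using that B(1) by (auto simp: orthogonal_comp_def orthogonal_def)
    then show "A v = 0" by (simp add: A_def)
  qed
  ultimately show ?thesis by (rule that)
qed

text \<open>The kernels have equal dimension, so they are isomorphic; complements are matched
  through right inverses. It lets all foliated charts share one direction subspace.\<close>

lemma surjections_differ_by_isomorphism: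
  fixes A A0 :: "'e::euclidean_space \<Rightarrow> 'q::real_vector"
  assumes A: "linear A" "surj A" and A0: "linear A0" "surj A0"
  obtains l where "linear l" "bij l" "\<And>v. A0 (l v) = A v"
proof -
  obtain R where R: "linear R" "\<And>g. A (R g) = g"
    using linear_surj_right_inverse[OF A(1), of UNIV UNIV] A(2) by auto
  obtain R0 where R0: "linear R0" "\<And>g. A0 (R0 g) = g"
    using linear_surj_right_inverse[OF A0(1), of UNIV UNIV] A0(2) by auto
  \<comment> \<open>Dimensions are compared inside \<open>'e\<close>, through the ranges of right
    inverses, since \<open>'q\<close> is only a real vector space here.\<close>
  have range_le: "dim (range R0) \<le> dim (range R)"
    if "linear R0" "linear A" "\<And>g. A (R g) = g" for R R0 :: "'q \<Rightarrow> 'e" and A :: "'e \<Rightarrow> 'q"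
  proof -
    have "range R0 = (R0 \<circ> A) ` range R" using that(3) by (auto simp: image_iff)
    then show ?thesis using dim_image_le[OF linear_compose[OF that(2,1)], of "range R"] by simp
  qed
  have ker: "dim {v. A v = 0} + dim (range R) = DIM('e)" if "linear A" "linear R" "\<And>g. A (R g) = g"
    for A :: "'e \<Rightarrow> 'q" and R
  proof -
    have S: "subspace {v. A v = 0}" "subspace (range R)"
      by (rule linear_subspace_kernel[OF that(1)]) (rule linear_subspace_image[OF that(2) subspace_UNIV])
    have "x \<in> {u + v |u v. u \<in> {v. A v = 0} \<and> v \<in> range R}" for x
      by (rule CollectI, rule exI[of _ "x - R (A x)"], rule exI[of _ "R (A x)"])
        (simp add: linear_diff[OF that(1)] that(3))
    then have "{u + v |u v. u \<in> {v. A v = 0} \<and> v \<in> range R} = UNIV" by blast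
    moreover have "{v. A v = 0} \<inter> range R = {0}"
      using that by (auto simp: linear_0 intro!: image_eqI[where x = 0])
    ultimately show ?thesis using dim_sums_Int[OF S] by simp
  qed
  have S: "subspace {v. A v = 0}" "subspace {v. A0 v = 0}"
    by (rule linear_subspace_kernel[OF A(1)]) (rule linear_subspace_kernel[OF A0(1)])
  have "dim {v. A v = 0} = dim {v. A0 v = 0}"
    using ker[OF A(1) R] ker[OF A0(1) R0] range_le[OF R0(1) A(1) R(2)] range_le[OF R(1) A0(1) R0(2)] by linarith
  then obtain f where f: "linear f" "f ` {v. A v = 0} = {v. A0 v = 0}" "inj_on f {v. A v = 0}"
    using subspace_isomorphism[OF S] by blast
  \<comment> \<open>The kernel component of \<open>v\<close> is moved by \<open>f\<close>, the
    complementary one by way of its image under \<open>A\<close>.\<close>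
  define l where "l v = f (v - R (A v)) + R0 (A v)" for v
  have "linear l"
    by (rule linearI) (simp_all add: l_def linear_add[OF A(1)] linear_scale[OF A(1)] linear_add[OF R(1)]
      linear_scale[OF R(1)] linear_add[OF R0(1)] linear_scale[OF R0(1)] linear_diff[OF f(1)] linear_add[OF f(1)]
      linear_scale[OF f(1)] algebra_simps)
  moreover have l: "A0 (l v) = A v" for v
  proof -
    have "v - R (A v) \<in> {v. A v = 0}" by (simp add: linear_diff[OF A(1)] R(2))
    then have "A0 (f (v - R (A v))) = 0" using f(2) by blast
    then show ?thesis by (simp add: l_def linear_add[OF A0(1)] R0(2))
  qed
  moreover have "inj l"
  proof -
    have "v = 0" if "l v = 0" for v
    proof -
      have "A v = 0" using l[of v] that linear_0[OF A0(1)] by simp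
      then have "f v = 0" using that by (simp add: l_def linear_0[OF R(1)] linear_0[OF R0(1)])
      then show "v = 0"
        using inj_onD[OF f(3), of v 0] \<open>A v = 0\<close> by (simp add: linear_0[OF f(1)] linear_0[OF A(1)])
    qed
    then show ?thesis using linear_injective_0[OF \<open>linear l\<close>] by blast
  qed
  then have "bij l" using linear_injective_imp_surjective[OF \<open>linear l\<close>] by (simp add: bij_def)
  ultimately show ?thesis by (intro that)
qed

section \<open>Foliated charts from an involutive kernel\<close>

context smooth_mfd
begin

lemma constant_on_segment:
  assumes c: "smooth_chart M c" and S: "closed_segment a b \<subseteq> cimg c"
    and f: "\<And>z. z \<in> closed_segment a b \<Longrightarrow> smooth_near f (cinv c z)"
    and d: "\<And>z. z \<in> closed_segment a b \<Longrightarrow> chart_diff c f (cinv c z) (b - a) = 0"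
  shows "f (cinv c b) = f (cinv c a)"
proof -
  let ?g = "\<lambda>t. a + t *\<^sub>R (b - a)"
  note ic = smooth_chartD[OF c]
  have seg: "?g t \<in> closed_segment a b" if "t \<in> {0..1}" for t
    using that by (auto simp: closed_segment_def algebra_simps intro!: exI[of _ t])
  have der: "((\<lambda>t. (f \<circ> cinv c) (?g t)) has_derivative (\<lambda>h. 0)) (at t within {0..1})" if t: "t \<in> {0..1}" for t
  proof -
    let ?z = "?g t"
    have z: "?z \<in> cimg c" using seg[OF t] S by blast
    have "smooth_near_in c f (cinv c ?z)"
      by (rule smooth_near_in_chart[OF f[OF seg[OF t]] c is_chartD(5)[OF ic z]])
    from smooth_near_in_has_derivative[OF this]
    have df: "((f \<circ> cinv c) has_derivative chart_diff c f (cinv c ?z)) (at ?z)"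
      by (simp add: is_chartD(6)[OF ic z])
    have "((\<lambda>t. (f \<circ> cinv c) (?g t)) has_derivative (\<lambda>h. chart_diff c f (cinv c ?z) (h *\<^sub>R (b - a)))) (at t within {0..1})"
      by (rule has_derivative_compose[of ?g _ _ _ "f \<circ> cinv c", OF _ df]) (auto intro!: derivative_eq_intros)
    then show ?thesis
      by (simp add: linear_scale[OF has_derivative_linear[OF df]] d[OF seg[OF t]])
  qed
  obtain k where "\<And>t. t \<in> {0..1} \<Longrightarrow> (f \<circ> cinv c) (?g t) = k"
    using has_derivative_zero_constant[of "{0..1}" "\<lambda>t. (f \<circ> cinv c) (?g t)"] der by auto
  from this[of 0] this[of 1] show ?thesis by simp
qed

lemma direction_in_chart:
  assumes c: "smooth_chart M c" and x: "x \<in> cdom c"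
  obtains v where "mdiff M (cmap c) x v = k"
    "\<And>f :: 'm \<Rightarrow> 'b::real_normed_vector. smooth_near f x \<Longrightarrow> chart_diff c f x k = mdiff M f x v"
proof
  show "mdiff M (cmap c) x (chart_diff c (cmap (M x)) x k) = k"
    unfolding mdiff_chart_diff by (rule chart_diff_inverse[OF smooth_chart_M c center x])
  show "chart_diff c f x k = mdiff M f x (chart_diff c (cmap (M x)) x k)" if "smooth_near f x" for f :: "'m \<Rightarrow> 'b"
    unfolding mdiff_chart_diff by (rule smooth_near_change(2)[OF c smooth_chart_M x center that])
qed

lemma chart_compose:
  assumes U: "open U" "U \<subseteq> cimg (M p)" and N: "open N" and hom: "homeomorphism U N G H"
    and G: "smooth_on U G" and H: "smooth_on N H"
  defines "c \<equiv> (cdom (M p) \<inter> cmap (M p) -` U, \<lambda>x. G (cmap (M p) x))"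
  shows "smooth_chart M c" "cimg c = N"
proof -
  let ?D = "cdom (M p) \<inter> cmap (M p) -` U"
  have GH: "\<And>y. y \<in> U \<Longrightarrow> G y \<in> N" "\<And>y. y \<in> U \<Longrightarrow> H (G y) = y" "\<And>z. z \<in> N \<Longrightarrow> H z \<in> U" "\<And>z. z \<in> N \<Longrightarrow> G (H z) = z"
    using hom by (auto simp: homeomorphism_def)
  have D: "open ?D" by (rule chart_preimage_open[OF chart U(1)])
  have inj: "inj_on (\<lambda>x. G (cmap (M p) x)) ?D"
    by (rule inj_onI) (metis GH(2) IntE chart is_chartD(4) vimageE)
  have img: "(\<lambda>x. G (cmap (M p) x)) ` ?D = N"
  proof
    show "N \<subseteq> (\<lambda>x. G (cmap (M p) x)) ` ?D"
    proof
      fix z assume z: "z \<in> N"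
      have "H z \<in> cimg (M p)" using GH(3)[OF z] U(2) by blast
      then show "z \<in> (\<lambda>x. G (cmap (M p) x)) ` ?D"
        using GH(3,4)[OF z] is_chartD(5,6)[OF chart] by (intro image_eqI[of _ _ "cinv (M p) (H z)"]) auto
    qed
  qed (use GH(1) in auto)
  then show cimg: "cimg c = N" by (simp add: cimg_def c_def)
  have cinv: "cinv c z = cinv (M p) (H z)" if z: "z \<in> N" for z
  proof -
    have Hz: "H z \<in> cimg (M p)" using GH(3)[OF z] U(2) by blast
    have "inv_into ?D (\<lambda>x. G (cmap (M p) x)) z = cinv (M p) (H z)"
      by (rule inv_into_f_eq[OF inj]) (use GH(3,4)[OF z] is_chartD(5,6)[OF chart Hz] in auto)
    then show ?thesis by (subst cinv_def) (simp add: c_def)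
  qed
  have ic: "is_chart c"
    unfolding is_chart_def cimg
  proof (intro conjI)
    show "open (cdom c)" using D by (simp add: c_def)
    show "open N" by fact
    show "homeomorphism (cdom c) N (cmap c) (cinv c)"
      unfolding homeomorphism_def
    proof (intro conjI ballI)
      have "continuous_on ?D (\<lambda>x. G (cmap (M p) x))"
        by (rule continuous_on_compose2[OF smooth_on_continuous[OF G] continuous_on_subset[OF is_chartD(7)[OF chart]]]) auto
      then show "continuous_on (cdom c) (cmap c)" by (simp add: c_def)
      have "continuous_on N (\<lambda>z. cinv (M p) (H z))"
        by (rule continuous_on_compose2[OF is_chartD(8)[OF chart] smooth_on_continuous[OF H]]) (use GH(3) U(2) in auto)
      then show "continuous_on N (cinv c)" by (rule continuous_on_eq) (simp add: cinv)
      show "cmap c ` cdom c = N" using img by (simp add: c_def)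
      show "cinv c (cmap c x) = x" if "x \<in> cdom c" for x
        unfolding cinv_def by (rule inv_into_f_f) (use inj that in \<open>auto simp: c_def\<close>)
      have cc: "cinv c z \<in> cdom c \<and> cmap c (cinv c z) = z" if "z \<in> N" for z
        using cinv[OF that] GH(3,4)[OF that] U(2) is_chartD(5,6)[OF chart, of "H z" p] by (auto simp: c_def)
      then show "cmap c (cinv c z) = z" if "z \<in> N" for z using that by blast
      show "cinv c ` N = cdom c"
      proof
        show "cdom c \<subseteq> cinv c ` N"
        proof
          fix x assume x: "x \<in> cdom c"
          then have "cmap c x \<in> N" using img by (auto simp: c_def)
          moreover have "cinv c (cmap c x) = x"
            unfolding cinv_def by (rule inv_into_f_f) (use inj x in \<open>auto simp: c_def\<close>)
          ultimately show "x \<in> cinv c ` N" by (metis imageI)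
        qed
      qed (use cc in auto)
    qed
  qed
  show "smooth_chart M c"
    unfolding smooth_chart_def
  proof (intro conjI ic allI)
    fix q
    let ?A = "cmap (M q) ` (cdom (M q) \<inter> ?D)" and ?B = "cmap c ` (cdom (M q) \<inter> ?D)"
    have cD: "cdom c = ?D" by (simp add: c_def)
    have oqD: "open (cdom (M q) \<inter> ?D)" using D is_chartD(1)[OF chart] by (rule open_Int[rotated])
    have A: "open ?A" by (rule chart_image_open[OF chart oqD]) simp
    have B: "open ?B" by (rule chart_image_open[OF ic oqD]) (auto simp: cD)
    have "smooth_on ?A (cmap (M p) \<circ> cinv (M q))"
      by (rule smooth_on_subset[OF smooth_transition[OF smooth_chart_M smooth_chart_M]]) auto
    then have "smooth_on ?A (\<lambda>y. G ((cmap (M p) \<circ> cinv (M q)) y))"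
      by (rule smooth_on_compose[OF A U(1) _ _ G, rotated]) (auto simp: is_chartD(4)[OF chart])
    then have 1: "smooth_on (cmap (M q) ` (cdom (M q) \<inter> cdom c)) (cmap c \<circ> cinv (M q))"
      by (simp add: c_def comp_def)
    have B': "?B \<subseteq> N" using img by (auto simp: c_def)
    let ?C = "cmap (M p) ` (cdom (M p) \<inter> cdom (M q))"
    have HB: "H ` ?B \<subseteq> ?C" by (auto simp: c_def GH(2))
    have "smooth_on ?B (\<lambda>z. (cmap (M q) \<circ> cinv (M p)) (H z))"
      by (rule smooth_on_compose[OF B transition_open[OF chart chart] HB smooth_on_subset[OF H B']
        smooth_transition[OF smooth_chart_M smooth_chart_M]])
    then have "smooth_on ?B (cmap (M q) \<circ> cinv c)"
    proof (rule smooth_on_cong[OF B])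
      fix z assume "z \<in> ?B"
      then have "z \<in> N" using B' by blast
      then show "(cmap (M q) \<circ> cinv (M p)) (H z) = (cmap (M q) \<circ> cinv c) z" by (simp add: cinv)
    qed
    with 1 show "compatible (M q) c" by (simp add: compatible_def cD Int_commute)
  qed
qed

text \<open>Two nearby points of \<open>c\<close> that differ by an element of \<open>W\<close> are
  joined by a straight segment in \<open>c\<close>. Its direction lies in \<open>T\<close>
  throughout, hence in \<open>W\<close> when read in \<open>d\<close>, so the transverse part of
  \<open>d\<close> is constant along it.\<close>

lemma foliation_overlap_kernel:
  assumes c: "smooth_chart M c" and d: "smooth_chart M d"
    and W: "subspace W" and tc: "\<And>x v. x \<in> cdom c \<Longrightarrow> mdiff M (cmap c) x v \<in> W \<Longrightarrow> v \<in> T x"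
    and td: "\<And>x v. x \<in> cdom d \<Longrightarrow> v \<in> T x \<Longrightarrow> mdiff M (cmap d) x v \<in> W"
    and p: "p \<in> cdom c \<inter> cdom d"
  shows "\<exists>U. open U \<and> p \<in> U \<and> U \<subseteq> cdom c \<inter> cdom d \<and>
    (\<forall>x\<in>U. \<forall>y\<in>U. cmap c x - cmap c y \<in> W \<longrightarrow> cmap d x - cmap d y \<in> W)"
proof -
  note ic = smooth_chartD[OF c] and id = smooth_chartD[OF d]
  obtain A :: "'e \<Rightarrow> 'e" where A: "linear A" "\<And>v. A v = 0 \<longleftrightarrow> v \<in> W" using subspace_eq_kernel[OF W] by blast
  have bA: "bounded_linear A" using A(1) by (simp add: linear_conv_bounded_linear)
  have "cmap c p \<in> cmap c ` (cdom c \<inter> cdom d)" using p by blast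
  then obtain r where r: "r > 0" "ball (cmap c p) r \<subseteq> cmap c ` (cdom c \<inter> cdom d)"
    using transition_open[OF ic id] open_contains_ball by blast
  define U where "U = (cdom c \<inter> cdom d) \<inter> (cdom c \<inter> cmap c -` ball (cmap c p) r)"
  show ?thesis
  proof (intro exI[of _ U] conjI ballI impI)
    show "open U"
      unfolding U_def by (intro open_Int is_chartD(1) ic id chart_preimage_open open_ball)
    show "p \<in> U" "U \<subseteq> cdom c \<inter> cdom d" using p r by (auto simp: U_def)
    fix x y assume x: "x \<in> U" and y: "y \<in> U" and W': "cmap c x - cmap c y \<in> W"
    have seg: "closed_segment (cmap c y) (cmap c x) \<subseteq> cmap c ` (cdom c \<inter> cdom d)"
      by (rule order_trans[OF _ r(2)], rule closed_segment_subset) (use x y in \<open>auto simp: U_def\<close>)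
    have z: "cinv c z \<in> cdom c" "cinv c z \<in> cdom d" if "z \<in> closed_segment (cmap c y) (cmap c x)" for z
      using seg that is_chartD(4)[OF ic] by (auto dest!: subsetD)
    have sm: "smooth_near (\<lambda>x. A (cmap d x)) (cinv c z)" if "z \<in> closed_segment (cmap c y) (cmap c x)" for z
      by (rule smooth_near_bounded_linear(1)[OF smooth_near_chart_map[OF d z(2)[OF that]] bA])
    have "A (cmap d (cinv c (cmap c x))) = A (cmap d (cinv c (cmap c y)))"
    proof (rule constant_on_segment[OF c _ sm])
      show "closed_segment (cmap c y) (cmap c x) \<subseteq> cimg c" using seg by (auto simp: cimg_def)
      fix z assume zs: "z \<in> closed_segment (cmap c y) (cmap c x)"
      obtain v where v: "mdiff M (cmap c) (cinv c z) v = cmap c x - cmap c y"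
        and *: "\<And>f :: 'm \<Rightarrow> 'e. smooth_near f (cinv c z) \<Longrightarrow>
          chart_diff c f (cinv c z) (cmap c x - cmap c y) = mdiff M f (cinv c z) v"
        by (rule direction_in_chart[OF c z(1)[OF zs], where 'b = 'e]) blast
      have "v \<in> T (cinv c z)" by (rule tc[OF z(1)[OF zs]]) (simp add: v W')
      then have "mdiff M (cmap d) (cinv c z) v \<in> W" by (rule td[OF z(2)[OF zs]])
      then show "chart_diff c (\<lambda>x. A (cmap d x)) (cinv c z) (cmap c x - cmap c y) = 0"
        by (simp add: *[OF sm[OF zs]] smooth_near_bounded_linear(2)[OF smooth_near_chart_map[OF d z(2)[OF zs]] bA] A(2))
    qed
    then have "A (cmap d x - cmap d y) = 0"
      using x y by (simp add: U_def is_chartD(4)[OF ic] linear_diff[OF A(1)])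
    then show "cmap d x - cmap d y \<in> W" by (simp add: A(2))
  qed
qed

lemma involutive_kernel_foliation:
  fixes \<omega> :: "'m \<Rightarrow> 'e \<Rightarrow> 'q::real_inner"
  assumes \<omega>: "smooth_one_form M \<omega>" and surj: "\<And>p. surj (\<omega> p)"
    and inv: "\<And>X Y p. smooth_vf M X \<Longrightarrow> smooth_vf M Y \<Longrightarrow> \<omega> p (X p) = 0 \<Longrightarrow> \<omega> p (Y p) = 0 \<Longrightarrow>
      ext_deriv M \<omega> X Y p = 0"
  shows "\<exists>F. foliation M F \<and> (\<forall>p. fol_tangent M F p = {v. \<omega> p v = 0})"
proof -
  have lin: "linear (\<omega> p)" for p using \<omega> by (simp add: smooth_one_form_def)
  \<comment> \<open>Fields with constant coefficients in a chart commute, so on them the exterior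
    derivative is a difference of partial derivatives: involutivity becomes the hypothesis of
    \<open>frobenius\<close>.\<close>
  have inv_rep: "frechet_derivative (\<lambda>y. form_rep \<omega> p y v) (at y) u = frechet_derivative (\<lambda>y. form_rep \<omega> p y u) (at y) v"
    if y: "y \<in> cimg (M p)" and u: "form_rep \<omega> p y u = 0" and v: "form_rep \<omega> p y v = 0" for p y u v
  proof -
    define x where "x = cinv (M p) y"
    have x: "x \<in> cdom (M p)" "cmap (M p) x = y" using is_chartD(5,6)[OF chart y] by (auto simp: x_def)
    have ext: "\<exists>X. smooth_vf M X \<and> (\<forall>\<^sub>F x' in nhds x. X x' = coord_vec M p w x')" for w
      by (rule extend_vector_field[OF x(1) is_chartD(2)[OF chart] order_refl _ smooth_on_const[of _ w]])
        (use x y in auto)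
    obtain X Y where X: "smooth_vf M X" "\<forall>\<^sub>F x' in nhds x. X x' = coord_vec M p u x'"
      and Y: "smooth_vf M Y" "\<forall>\<^sub>F x' in nhds x. Y x' = coord_vec M p v x'"
      using ext[of u] ext[of v] by blast
    have Xx: "X x = coord_vec M p u x" and Yx: "Y x = coord_vec M p v x"
      using eventually_nhds_x_imp_x[OF X(2)] eventually_nhds_x_imp_x[OF Y(2)] by auto
    have nhd: "\<forall>\<^sub>F x' in nhds x. x' \<in> cdom (M p)"
      by (rule eventually_nhds_in_open[OF is_chartD(1)[OF chart] x(1)])
    have near_p: "smooth_near (cmap (M p)) x'" if "x' \<in> cdom (M p)" for x'
      by (rule smooth_near_chart_map[OF smooth_chart_M that])
    have const: "mdiff M (\<lambda>x'. mdiff M (cmap (M p)) x' (Z x')) x = (\<lambda>_. 0)"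
      if Z: "smooth_vf M Z" "\<forall>\<^sub>F x' in nhds x. Z x' = coord_vec M p w x'" for Z w
    proof -
      have "\<forall>\<^sub>F x' in nhds x. mdiff M (cmap (M p)) x' (Z x') = w"
        using Z(2) nhd
        by eventually_elim (simp add: mdiff_coord_vec[OF _ near_p] chart_diff_self[OF chart])
      from mdiff_cong[OF smooth_near_mdiff(1)[OF near_p[OF x(1)] Z(1)] this] show ?thesis by auto
    qed
    have "mdiff M (cmap (M p)) x (vf_bracket M X Y x) = 0"
      by (simp add: mdiff_bracket[OF near_p[OF x(1)] X(1) Y(1)] const[OF X] const[OF Y])
    then have "coord_vec M p 0 x = vf_bracket M X Y x" using coord_vec_mdiff[OF x(1), of "vf_bracket M X Y x"] by simp
    then have br0: "vf_bracket M X Y x = 0" by (simp add: linear_0[OF linear_coord_vec[OF x(1)]])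
    have der: "mdiff M (\<lambda>x. \<omega> x (Z x)) x (coord_vec M p w' x) = frechet_derivative (\<lambda>y. form_rep \<omega> p y w) (at y) w'"
      if Z: "smooth_vf M Z" "\<forall>\<^sub>F x' in nhds x. Z x' = coord_vec M p w x'" for Z w w'
    proof -
      have sm: "smooth_near (\<lambda>x. \<omega> x (Z x)) x" by (rule smooth_near_form[OF \<omega> Z(1)])
      have "\<forall>\<^sub>F x' in nhds x. \<omega> x' (Z x') = form_rep \<omega> p (cmap (M p) x') w"
        using Z(2) nhd by eventually_elim (simp add: form_rep_eq)
      from smooth_near_in_cong(2)[OF chart smooth_near_in_chart[OF sm smooth_chart_M x(1)] this]
      have "mdiff M (\<lambda>x. \<omega> x (Z x)) x (coord_vec M p w' x) =
          chart_diff (M p) (\<lambda>x'. form_rep \<omega> p (cmap (M p) x') w) x w'"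
        by (simp add: mdiff_coord_vec[OF x(1) sm])
      also have "\<dots> = frechet_derivative (\<lambda>y. form_rep \<omega> p y w) (at y) w'"
        unfolding chart_diff_def x(2)
        by (rule fun_cong[OF frechet_derivative_transform_within_open[symmetric, OF _ is_chartD(2)[OF chart] y]])
          (auto simp: is_chartD(6)[OF chart] intro: smooth_on_differentiable[OF smooth_form_rep[OF \<omega>] y])
      finally show ?thesis .
    qed
    have "ext_deriv M \<omega> X Y x = 0"
      by (rule inv[OF X(1) Y(1)]) (use u v in \<open>simp_all add: Xx Yx form_rep_eq[OF x(1), symmetric] x(2)\<close>)
    then show ?thesis by (simp add: ext_deriv_def br0 linear_0[OF lin] Xx Yx der[OF X] der[OF Y])
  qed
  \<comment> \<open>An arbitrary point; its kernel becomes the direction shared by all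
    charts.\<close>
  define p0 :: 'm where "p0 = undefined"
  define W where "W = {v. \<omega> p0 v = 0}"
  have W: "subspace W" unfolding W_def by (rule linear_subspace_kernel[OF lin])
  have "\<exists>c. smooth_chart M c \<and> p \<in> cdom c \<and> (\<forall>x\<in>cdom c. \<forall>v. mdiff M (cmap c) x v \<in> W \<longleftrightarrow> \<omega> x v = 0)" for p
  proof -
    let ?\<theta> = "form_rep \<omega> p" and ?y0 = "cmap (M p) p"
    have y0: "?y0 \<in> cimg (M p)" by (rule is_chartD(3)[OF chart center])
    have \<theta>0: "?\<theta> ?y0 = \<omega> p" by (rule ext) (simp add: form_rep_eq[OF center] coord_vec_center)
    then have surj0: "surj (?\<theta> ?y0)" using surj by simp
    obtain U N g \<Psi> where U: "open U" "?y0 \<in> U" "U \<subseteq> cimg (M p)" and N: "open N" and hom: "homeomorphism U N g \<Psi>"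
      and g: "smooth_on U g" and \<Psi>: "smooth_on N \<Psi>"
      and ker: "\<And>y v. y \<in> U \<Longrightarrow> ?\<theta> ?y0 (frechet_derivative g (at y) v) = 0 \<longleftrightarrow> ?\<theta> y v = 0"
      by (rule frobenius[OF is_chartD(2)[OF chart] y0 linear_form_rep[OF \<omega>] smooth_form_rep[OF \<omega>] surj0 inv_rep])
        blast+
    \<comment> \<open>The chart from \<open>frobenius\<close> straightens to the kernel at
      \<open>p\<close>; composing with \<open>l\<close> turns that kernel into
      \<open>W\<close>.\<close>
    obtain l where l: "linear l" "bij l" "\<And>v. \<omega> p0 (l v) = \<omega> p v"
      using surjections_differ_by_isomorphism[OF lin surj lin surj] by blast
    have bl: "bounded_linear l" using l(1) by (simp add: linear_conv_bounded_linear)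
    obtain l' where l': "linear l'" "\<And>v. l' (l v) = v" "\<And>v. l (l' v) = v"
      using linear_injective_isomorphism[OF l(1)] l(2) by (auto simp: bij_def)
    have bl': "bounded_linear l'" using l'(1) by (simp add: linear_conv_bounded_linear)
    have lN: "l ` N = l' -` N" using l' by (auto simp: image_iff) (metis l'(3))
    have olN: "open (l ` N)"
      unfolding lN by (intro open_vimage N linear_continuous_on bl')
    have hom': "homeomorphism U (l ` N) (\<lambda>y. l (g y)) (\<lambda>z. \<Psi> (l' z))"
    proof -
      have "homeomorphism N (l ` N) l l'"
        unfolding homeomorphism_def using l' bl bl'
        by (auto simp: image_image intro: linear_continuous_on)
      from homeomorphism_compose[OF hom this] show ?thesis by (simp add: comp_def)
    qed
    let ?c = "(cdom (M p) \<inter> cmap (M p) -` U, \<lambda>x. l (g (cmap (M p) x)))"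
    have sg: "smooth_on U (\<lambda>y. l (g y))" by (rule smooth_on_bounded_linear_comp[OF U(1) bl g])
    have s\<Psi>: "smooth_on (l ` N) (\<lambda>z. \<Psi> (l' z))"
      by (rule smooth_on_compose[OF olN N _ smooth_on_bounded_linear[OF olN bl'] \<Psi>]) (auto simp: l')
    have c: "smooth_chart M ?c" by (rule chart_compose(1)[OF U(1,3) olN hom' sg s\<Psi>])
    moreover have "mdiff M (cmap ?c) x v \<in> W \<longleftrightarrow> \<omega> x v = 0" if x: "x \<in> cdom ?c" for x v
    proof -
      have xp: "x \<in> cdom (M p)" and xU: "cmap (M p) x \<in> U" using x by auto
      let ?w = "mdiff M (cmap (M p)) x v"
      have dg: "((\<lambda>y. l (g y)) has_derivative (\<lambda>w. l (frechet_derivative g (at (cmap (M p) x)) w))) (at (cmap (M p) x))"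
        by (rule bounded_linear.has_derivative[OF bl smooth_on_has_derivative[OF g xU]])
      have "((cmap ?c \<circ> cinv (M p)) has_derivative (\<lambda>w. l (frechet_derivative g (at (cmap (M p) x)) w))) (at (cmap (M p) x))"
        by (rule has_derivative_transform_within_open[OF dg is_chartD(2)[OF chart] is_chartD(3)[OF chart xp]])
          (simp add: is_chartD(6)[OF chart])
      from frechet_derivative_at[OF this]
      have "chart_diff (M p) (cmap ?c) x ?w = l (frechet_derivative g (at (cmap (M p) x)) ?w)"
        by (simp add: chart_diff_def fun_eq_iff)
      then have "mdiff M (cmap ?c) x v = l (frechet_derivative g (at (cmap (M p) x)) ?w)"
        using mdiff_in_chart[OF smooth_near_chart_map[OF c x] smooth_chart_M xp] by simp
      then have "mdiff M (cmap ?c) x v \<in> W \<longleftrightarrow> ?\<theta> ?y0 (frechet_derivative g (at (cmap (M p) x)) ?w) = 0"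
        by (simp add: W_def l(3) \<theta>0)
      also have "\<dots> \<longleftrightarrow> ?\<theta> (cmap (M p) x) ?w = 0" by (rule ker[OF xU])
      also have "\<dots> \<longleftrightarrow> \<omega> x v = 0" by (simp add: form_rep_eq[OF xp] coord_vec_mdiff[OF xp])
      finally show ?thesis .
    qed
    ultimately show ?thesis using center U(2) by (intro exI[of _ ?c]) auto
  qed
  then obtain c where c: "\<And>p. smooth_chart M (c p)" "\<And>p. p \<in> cdom (c p)"
    "\<And>p x v. x \<in> cdom (c p) \<Longrightarrow> mdiff M (cmap (c p)) x v \<in> W \<longleftrightarrow> \<omega> x v = 0"
    by metis
  have "foliation M (W, range c)"
    unfolding foliation_def
  proof (intro conjI ballI)
    show "subspace (fol_dir (W, range c))" using W by simp
    show "smooth_chart M d" if "d \<in> fol_atlas (W, range c)" for d using that c(1) by auto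
    show "(\<Union>d\<in>fol_atlas (W, range c). cdom d) = UNIV" using c(2) by auto
    fix d d' x assume "d \<in> fol_atlas (W, range c)" "d' \<in> fol_atlas (W, range c)" and x: "x \<in> cdom d \<inter> cdom d'"
    then obtain p q where pq: "d = c p" "d' = c q" by auto
    show "\<exists>U. open U \<and> x \<in> U \<and> U \<subseteq> cdom d \<inter> cdom d' \<and>
        (\<forall>x\<in>U. \<forall>y\<in>U. cmap d x - cmap d y \<in> fol_dir (W, range c) \<longrightarrow> cmap d' x - cmap d' y \<in> fol_dir (W, range c))"
      unfolding fst_conv pq
      by (rule foliation_overlap_kernel[OF c(1) c(1) W, where T = "\<lambda>x. {v. \<omega> x v = 0}"]) (use c(3) x pq in auto)
  qed
  moreover have "fol_tangent M (W, range c) p = {v. \<omega> p v = 0}" for p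
  proof -
    have "v \<in> fol_tangent M (W, range c) p" if "\<omega> p v = 0" for v
      using c(2)[of p] c(3)[of p p v] that by (auto simp: fol_tangent_def)
    then show ?thesis using c(3) by (auto simp: fol_tangent_def)
  qed
  ultimately show ?thesis by blast
qed

subsection \<open>Leaves\<close>

lemma foliation_chart: "foliation M F \<Longrightarrow> c \<in> fol_atlas F \<Longrightarrow> smooth_chart M c"
  by (simp add: foliation_def)

lemma foliation_cover: "foliation M F \<Longrightarrow> \<exists>c\<in>fol_atlas F. x \<in> cdom c"
  unfolding foliation_def by blast

text \<open>The definition asks for some foliated chart, and this passes to every one. The overlap
  condition compares points, so it is differentiated along the line from \<open>cmap c x\<close> in
  the given direction.\<close>

lemma fol_tangent_in_chart:
  assumes F: "foliation M F" and d: "d \<in> fol_atlas F" "x \<in> cdom d"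
  shows "v \<in> fol_tangent M F x \<longleftrightarrow> mdiff M (cmap d) x v \<in> fol_dir F"
proof
  assume "v \<in> fol_tangent M F x"
  then obtain c where c: "c \<in> fol_atlas F" "x \<in> cdom c" and k: "mdiff M (cmap c) x v \<in> fol_dir F"
    by (auto simp: fol_tangent_def)
  let ?k = "mdiff M (cmap c) x v"
  have sc: "smooth_chart M c" and sd: "smooth_chart M d" using foliation_chart[OF F] c d by auto
  note ic = smooth_chartD[OF sc]
  have W: "subspace (fol_dir F)" using F by (simp add: foliation_def)
  obtain A :: "'e \<Rightarrow> 'e" where A: "linear A" "\<And>v. A v = 0 \<longleftrightarrow> v \<in> fol_dir F" using subspace_eq_kernel[OF W] by blast
  have bA: "bounded_linear A" using A(1) by (simp add: linear_conv_bounded_linear)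
  obtain U where U: "open U" "x \<in> U" "U \<subseteq> cdom c \<inter> cdom d"
    "\<And>x y. x \<in> U \<Longrightarrow> y \<in> U \<Longrightarrow> cmap c x - cmap c y \<in> fol_dir F \<Longrightarrow> cmap d x - cmap d y \<in> fol_dir F"
    using F c d unfolding foliation_def by (metis IntI)
  let ?h = "\<lambda>t::real. cmap c x + t *\<^sub>R ?k"
  have opU: "open (cmap c ` U)" by (rule chart_image_open[OF ic U(1)]) (use U in auto)
  have smd: "smooth_near (cmap d) x" by (rule smooth_near_chart_map[OF sd d(2)])
  have dd: "((cmap d \<circ> cinv c) has_derivative chart_diff c (cmap d) x) (at (cmap c x))"
    by (rule smooth_near_in_has_derivative[OF smooth_near_in_chart[OF smd sc c(2)]])
  have "((\<lambda>t. A ((cmap d \<circ> cinv c) (?h t))) has_derivative (\<lambda>t. A (chart_diff c (cmap d) x (t *\<^sub>R ?k)))) (at 0)"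
    by (intro bounded_linear.has_derivative[OF bA] has_derivative_compose[of ?h _ _ _ "cmap d \<circ> cinv c"])
      (use dd in \<open>auto intro!: derivative_eq_intros\<close>)
  moreover have "((\<lambda>t. A ((cmap d \<circ> cinv c) (?h t))) has_derivative (\<lambda>t. 0)) (at 0)"
  proof (rule has_derivative_transform_within_open[OF has_derivative_const])
    show "open (?h -` (cmap c ` U))" by (intro open_vimage opU continuous_intros)
    show "0 \<in> ?h -` (cmap c ` U)" using U(2) by auto
    fix t assume "t \<in> ?h -` (cmap c ` U)"
    then obtain y where y: "y \<in> U" "?h t = cmap c y" by auto
    have "cmap c y - cmap c x = t *\<^sub>R ?k" by (simp flip: y(2))
    then have "cmap d y - cmap d x \<in> fol_dir F" using U(4)[OF y(1) U(2)] k W by (simp add: subspace_scale)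
    then have "A (cmap d y) = A (cmap d x)" using A by (simp add: linear_diff flip: A(2))
    moreover have "cinv c (?h t) = y" using y U(3) by (auto simp: is_chartD(4)[OF ic])
    ultimately show "A (cmap d x) = A ((cmap d \<circ> cinv c) (?h t))" by simp
  qed
  ultimately have "A (chart_diff c (cmap d) x (1 *\<^sub>R ?k)) = 0"
    by (rule fun_cong[OF has_derivative_unique])
  then show "mdiff M (cmap d) x v \<in> fol_dir F"
    using mdiff_in_chart[OF smd sc c(2), of v] A(2) by simp
qed (use d in \<open>auto simp: fol_tangent_def\<close>)

text \<open>The set \<open>S\<close> is the preimage of a straight segment. It is chosen before
  \<open>f\<close>, and \<open>Q\<close> is a parameter, so the lemma serves transverse coordinates
  on a chart as well as functions on the whole manifold.\<close>

lemma tangential_segment: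
  assumes F: "foliation M F" and c: "c \<in> fol_atlas F" "x \<in> cdom c" and Q: "open Q" "x \<in> Q"
  obtains V where "open V" "x \<in> V"
    "\<And>y. y \<in> V \<Longrightarrow> y \<in> cdom c \<Longrightarrow> cmap c y - cmap c x \<in> fol_dir F \<Longrightarrow>
      \<exists>S. connected S \<and> x \<in> S \<and> y \<in> S \<and> S \<subseteq> Q \<and> (\<forall>f :: 'm \<Rightarrow> 'b::real_normed_vector.
        (\<forall>z\<in>Q. smooth_near f z \<and> (\<forall>v\<in>fol_tangent M F z. mdiff M f z v = 0)) \<longrightarrow> (\<forall>z\<in>S. f z = f x))"
proof -
  have sc: "smooth_chart M c" by (rule foliation_chart[OF F c(1)])
  note ic = smooth_chartD[OF sc]
  have W: "subspace (fol_dir F)" using F by (simp add: foliation_def)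
  have oQ: "open (cmap c ` (cdom c \<inter> Q))" by (rule chart_image_open[OF ic]) (use Q is_chartD(1)[OF ic] in auto)
  have "cmap c x \<in> cmap c ` (cdom c \<inter> Q)" using c(2) Q(2) by blast
  then obtain r where r: "r > 0" "ball (cmap c x) r \<subseteq> cmap c ` (cdom c \<inter> Q)"
    using oQ open_contains_ball by blast
  show ?thesis
  proof (rule that[of "cdom c \<inter> cmap c -` ball (cmap c x) r"])
    show "open (cdom c \<inter> cmap c -` ball (cmap c x) r)" by (rule chart_preimage_open[OF ic open_ball])
    show "x \<in> cdom c \<inter> cmap c -` ball (cmap c x) r" using c(2) r(1) by simp
    fix y assume y: "y \<in> cdom c \<inter> cmap c -` ball (cmap c x) r" and k: "cmap c y - cmap c x \<in> fol_dir F"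
    let ?seg = "closed_segment (cmap c x) (cmap c y)"
    have seg: "?seg \<subseteq> cmap c ` (cdom c \<inter> Q)"
      by (rule order_trans[OF _ r(2)], rule closed_segment_subset) (use y r(1) in auto)
    then have seg': "?seg \<subseteq> cimg c" by (auto simp: cimg_def)
    have zQ: "cinv c z \<in> cdom c" "cinv c z \<in> Q" if "z \<in> ?seg" for z
      using seg that by (auto dest!: subsetD simp: is_chartD(4)[OF ic])
    have "f (cinv c z) = f x"
      if f: "\<And>z. z \<in> Q \<Longrightarrow> smooth_near f z" "\<And>z v. z \<in> Q \<Longrightarrow> v \<in> fol_tangent M F z \<Longrightarrow> mdiff M f z v = 0"
        and z: "z \<in> ?seg" for f :: "'m \<Rightarrow> 'b" and z
    proof -
      obtain s where s: "z = (1 - s) *\<^sub>R cmap c x + s *\<^sub>R cmap c y" using z by (auto simp: closed_segment_def)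
      have dir: "z - cmap c x = s *\<^sub>R (cmap c y - cmap c x)" by (simp add: s algebra_simps)
      have sub: "closed_segment (cmap c x) z \<subseteq> ?seg" using z by (simp add: subset_closed_segment)
      have "f (cinv c z) = f (cinv c (cmap c x))"
      proof (rule constant_on_segment[OF sc order_trans[OF sub seg']])
        fix z' assume "z' \<in> closed_segment (cmap c x) z"
        then have z': "z' \<in> ?seg" using sub by blast
        show sm: "smooth_near f (cinv c z')" by (rule f(1)[OF zQ(2)[OF z']])
        obtain v where v: "mdiff M (cmap c) (cinv c z') v = z - cmap c x"
          "\<And>f :: 'm \<Rightarrow> 'b. smooth_near f (cinv c z') \<Longrightarrow> chart_diff c f (cinv c z') (z - cmap c x) = mdiff M f (cinv c z') v"
          by (rule direction_in_chart[OF sc zQ(1)[OF z'], where 'b = 'b]) blast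
        have "v \<in> fol_tangent M F (cinv c z')"
          unfolding fol_tangent_in_chart[OF F c(1) zQ(1)[OF z']] v(1) dir by (rule subspace_scale[OF W k])
        then show "chart_diff c f (cinv c z') (z - cmap c x) = 0"
          by (simp add: v(2)[OF sm] f(2)[OF zQ(2)[OF z']])
      qed
      then show ?thesis by (simp add: is_chartD(4)[OF ic c(2)])
    qed
    moreover have "connected (cinv c ` ?seg)"
      by (intro connected_continuous_image continuous_on_subset[OF is_chartD(8)[OF ic] seg'] connected_segment)
    moreover have "x \<in> cinv c ` ?seg" using is_chartD(4)[OF ic c(2)] by (metis ends_in_segment(1) imageI)
    moreover have "y \<in> cinv c ` ?seg" using is_chartD(4)[OF ic, of y] y by (metis IntD1 ends_in_segment(2) imageI)
    moreover have "cinv c ` ?seg \<subseteq> Q" using zQ by blast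
    ultimately show "\<exists>S. connected S \<and> x \<in> S \<and> y \<in> S \<and> S \<subseteq> Q \<and> (\<forall>f :: 'm \<Rightarrow> 'b.
        (\<forall>z\<in>Q. smooth_near f z \<and> (\<forall>v\<in>fol_tangent M F z. mdiff M f z v = 0)) \<longrightarrow> (\<forall>z\<in>S. f z = f x))"
      by (intro exI[of _ "cinv c ` ?seg"]) blast
  qed
qed

text \<open>Plaques are connected, so an equivalence relation that relates each point of a plaque to
  its neighbours there relates all of it; chains of plaques follow by transitivity.\<close>

lemma leaf_subset_class:
  assumes F: "foliation M F" and R: "\<And>x. R x x" "\<And>x y. R x y \<Longrightarrow> R y x" "\<And>x y z. R x y \<Longrightarrow> R y z \<Longrightarrow> R x z"
    and loc: "\<And>c x. c \<in> fol_atlas F \<Longrightarrow> x \<in> cdom c \<Longrightarrow> \<exists>V. open V \<and> x \<in> V \<and>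
      (\<forall>y\<in>V. y \<in> cdom c \<longrightarrow> cmap c y - cmap c x \<in> fol_dir F \<longrightarrow> R x y)"
    and y: "y \<in> leaf F x"
  shows "R x y"
proof -
  have W: "subspace (fol_dir F)" using F by (simp add: foliation_def)
  have plaque: "R u v" if c: "c \<in> fol_atlas F" and u: "u \<in> cdom c" and v: "v \<in> plaque F c u" for c u v
  proof -
    let ?S = "plaque F c u"
    have Sub: "?S \<subseteq> {y \<in> cdom c. cmap c y - cmap c u \<in> fol_dir F}"
      unfolding plaque_def by (rule connected_component_subset)
    have "u \<in> ?S" using u W by (simp add: plaque_def connected_component_refl subspace_0)
    show ?thesis
    proof (rule connected_equivalence_relation[of ?S u v R])
      show "connected ?S" unfolding plaque_def by (rule connected_connected_component)
      fix a assume a: "a \<in> ?S"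
      then have ac: "a \<in> cdom c" using Sub by blast
      obtain V where V: "open V" "a \<in> V" "\<And>y. y \<in> V \<Longrightarrow> y \<in> cdom c \<Longrightarrow> cmap c y - cmap c a \<in> fol_dir F \<Longrightarrow> R a y"
        using loc[OF c ac] by blast
      have "R a y" if "y \<in> ?S \<inter> V" for y
      proof (rule V(3))
        have "(cmap c y - cmap c u) - (cmap c a - cmap c u) \<in> fol_dir F"
          by (rule subspace_diff[OF W]) (use Sub a that in auto)
        then show "cmap c y - cmap c a \<in> fol_dir F" by simp
      qed (use that Sub in auto)
      then show "\<exists>T. openin (top_of_set ?S) T \<and> a \<in> T \<and> (\<forall>x\<in>T. R a x)"
        using V(1,2) a by (intro exI[of _ "?S \<inter> V"]) (auto simp: openin_open_Int)
    qed (use \<open>u \<in> ?S\<close> v R in blast)+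
  qed
  have "(\<lambda>u v. \<exists>c\<in>fol_atlas F. u \<in> cdom c \<and> v \<in> plaque F c u)\<^sup>*\<^sup>* x y" using y by (simp add: leaf_def)
  then show ?thesis
    by (induction rule: rtranclp_induct) (use R plaque in blast)+
qed

lemma plaque_sym:
  assumes W: "subspace (fol_dir F)" and v: "v \<in> plaque F c u" and u: "u \<in> cdom c"
  shows "u \<in> plaque F c v" "v \<in> cdom c"
proof -
  let ?S = "\<lambda>u. {y \<in> cdom c. cmap c y - cmap c u \<in> fol_dir F}"
  have vS: "v \<in> ?S u" using v connected_component_subset unfolding plaque_def by blast
  have "cmap c y - cmap c u \<in> fol_dir F \<longleftrightarrow> cmap c y - cmap c v \<in> fol_dir F" for y
    using subspace_diff[OF W, of "cmap c y - cmap c u" "cmap c v - cmap c u"]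
      subspace_add[OF W, of "cmap c y - cmap c v" "cmap c v - cmap c u"] vS by auto
  then have "?S u = ?S v" by auto
  then show "u \<in> plaque F c v" using v unfolding plaque_def by (simp add: connected_component_sym_eq)
  show "v \<in> cdom c" using vS by simp
qed

text \<open>The equivalence relation is being in one leaf of \<open>F'\<close>. A short segment
  tangent to \<open>F\<close> lies in a plaque of \<open>F'\<close>, since the transverse
  coordinates of \<open>F'\<close> have zero derivative along it.\<close>

lemma leaf_mono:
  assumes F: "foliation M F" and F': "foliation M F'" and sub: "\<And>p. fol_tangent M F p \<subseteq> fol_tangent M F' p"
  shows "leaf F x \<subseteq> leaf F' x"
proof
  fix y assume y: "y \<in> leaf F x"
  have W': "subspace (fol_dir F')" using F' by (simp add: foliation_def)
  let ?step = "\<lambda>u v. \<exists>c\<in>fol_atlas F'. u \<in> cdom c \<and> v \<in> plaque F' c u"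
  obtain A :: "'e \<Rightarrow> 'e" where A: "linear A" "\<And>v. A v = 0 \<longleftrightarrow> v \<in> fol_dir F'" using subspace_eq_kernel[OF W'] by blast
  have bA: "bounded_linear A" using A(1) by (simp add: linear_conv_bounded_linear)
  have "symp ?step" by (rule sympI) (meson plaque_sym[OF W'])
  then have sym: "symp ?step\<^sup>*\<^sup>*" by (rule symp_rtranclp)
  have "?step\<^sup>*\<^sup>* x y"
  proof (rule leaf_subset_class[OF F _ _ _ _ y])
    fix c x assume c: "c \<in> fol_atlas F" "x \<in> cdom c"
    obtain d where d: "d \<in> fol_atlas F'" "x \<in> cdom d" using foliation_cover[OF F'] by blast
    have sd: "smooth_chart M d" by (rule foliation_chart[OF F' d(1)])
    obtain V where V: "open V" "x \<in> V" "\<And>y. y \<in> V \<Longrightarrow> y \<in> cdom c \<Longrightarrow> cmap c y - cmap c x \<in> fol_dir F \<Longrightarrow>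
      \<exists>S. connected S \<and> x \<in> S \<and> y \<in> S \<and> S \<subseteq> cdom d \<and> (\<forall>f :: 'm \<Rightarrow> 'e.
        (\<forall>z\<in>cdom d. smooth_near f z \<and> (\<forall>v\<in>fol_tangent M F z. mdiff M f z v = 0)) \<longrightarrow> (\<forall>z\<in>S. f z = f x))"
      using tangential_segment[OF F c is_chartD(1)[OF smooth_chartD[OF sd]] d(2), where 'b = 'e] by blast
    have Ad: "smooth_near (\<lambda>x. A (cmap d x)) z \<and> (\<forall>v\<in>fol_tangent M F z. mdiff M (\<lambda>x. A (cmap d x)) z v = 0)"
      if "z \<in> cdom d" for z
      using smooth_near_bounded_linear[OF smooth_near_chart_map[OF sd that] bA] sub[of z]
        fol_tangent_in_chart[OF F' d(1) that] A(2) by auto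
    have "?step x y" if y: "y \<in> V" "y \<in> cdom c" "cmap c y - cmap c x \<in> fol_dir F" for y
    proof -
      from V(3)[OF y] obtain S where S: "connected S" "x \<in> S" "y \<in> S" "S \<subseteq> cdom d"
        and const: "\<forall>f :: 'm \<Rightarrow> 'e. (\<forall>z\<in>cdom d. smooth_near f z \<and> (\<forall>v\<in>fol_tangent M F z. mdiff M f z v = 0))
          \<longrightarrow> (\<forall>z\<in>S. f z = f x)"
        by (elim exE conjE)
      have SA: "\<And>z. z \<in> S \<Longrightarrow> A (cmap d z) = A (cmap d x)"
        using mp[OF spec[OF const, of "\<lambda>x. A (cmap d x)"]] Ad by blast
      have "S \<subseteq> {y \<in> cdom d. cmap d y - cmap d x \<in> fol_dir F'}"
        using S(4) SA by (auto simp: A(2)[symmetric] linear_diff[OF A(1)])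
      then have "y \<in> plaque F' d x"
        unfolding plaque_def using S(1-3) by (auto simp: connected_component_def)
      then show ?thesis using d by blast
    qed
    then show "\<exists>V. open V \<and> x \<in> V \<and> (\<forall>y\<in>V. y \<in> cdom c \<longrightarrow> cmap c y - cmap c x \<in> fol_dir F \<longrightarrow> ?step\<^sup>*\<^sup>* x y)"
      using V(1,2) by (intro exI[of _ V] conjI ballI impI r_into_rtranclp)
  next
    show "?step\<^sup>*\<^sup>* y x" if "?step\<^sup>*\<^sup>* x y" for x y by (rule sympD[OF sym that])
  qed (rule rtranclp.rtrancl_refl, rule rtranclp_trans)
  then show "y \<in> leaf F' x" by (simp add: leaf_def)
qed

text \<open>A level set is closed; containing the leaf through \<open>x\<close>, it contains the
  closure of that leaf.\<close>

lemma leafwise_constant: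
  fixes f :: "'m \<Rightarrow> 'b::real_normed_vector"
  assumes F: "foliation M F" and dense: "dense_leaves F" and f: "\<And>p. smooth_near f p"
    and d: "\<And>p v. v \<in> fol_tangent M F p \<Longrightarrow> mdiff M f p v = 0"
  shows "f x = f y"
proof -
  have leaf: "f x = f z" if "z \<in> leaf F x" for z
  proof (rule leaf_subset_class[OF F _ _ _ _ that])
    fix c x assume c: "c \<in> fol_atlas F" "x \<in> cdom c"
    show "\<exists>V. open V \<and> x \<in> V \<and> (\<forall>y\<in>V. y \<in> cdom c \<longrightarrow> cmap c y - cmap c x \<in> fol_dir F \<longrightarrow> f x = f y)"
      using tangential_segment[OF F c open_UNIV UNIV_I, where 'b = 'b] f d by (metis UNIV_I)
  qed auto
  have "continuous_on UNIV f" using smooth_near_isCont[OF f] by (simp add: continuous_at_imp_continuous_on)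
  then have "closed {z. f z = f x}" by (intro closed_Collect_eq continuous_on_const)
  moreover have "leaf F x \<subseteq> {z. f z = f x}" using leaf by auto
  ultimately have "closure (leaf F x) \<subseteq> {z. f z = f x}" by (rule closure_minimal[rotated])
  then have "y \<in> {z. f z = f x}" using dense unfolding dense_leaves_def by blast
  then show ?thesis by simp
qed

end

section \<open>Leafwise cohomology\<close>

context smooth_mfd
begin

definition leafwise_form :: "('m, 'e) foliation \<Rightarrow> ('m \<Rightarrow> 'e \<Rightarrow> 'b::real_normed_vector) \<Rightarrow> bool" where
  "leafwise_form F a \<longleftrightarrow>
    (\<forall>p. \<forall>u\<in>fol_tangent M F p. \<forall>v\<in>fol_tangent M F p. \<forall>k. a p (k *\<^sub>R u + v) = k *\<^sub>R a p u + a p v) \<and>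
    (\<forall>X p. tangent_vf M F X \<longrightarrow> smooth_near (\<lambda>x. a x (X x)) p)"

text \<open>The Koszul formula for the trivial connection on a fixed space of values.\<close>

definition leafwise_closed :: "('m, 'e) foliation \<Rightarrow> ('m \<Rightarrow> 'e \<Rightarrow> 'b::real_normed_vector) \<Rightarrow> bool" where
  "leafwise_closed F a \<longleftrightarrow> (\<forall>X Y p. tangent_vf M F X \<longrightarrow> tangent_vf M F Y \<longrightarrow>
    mdiff M (\<lambda>x. a x (Y x)) p (X p) - mdiff M (\<lambda>x. a x (X x)) p (Y p) - a p (vf_bracket M X Y p) = 0)"

definition leafwise_exact :: "('m, 'e) foliation \<Rightarrow> ('m \<Rightarrow> 'e \<Rightarrow> 'b::real_normed_vector) \<Rightarrow> bool" where
  "leafwise_exact F a \<longleftrightarrow> (\<exists>f. (\<forall>p. smooth_near f p) \<and> (\<forall>X p. tangent_vf M F X \<longrightarrow> a p (X p) = mdiff M f p (X p)))"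

end

section \<open>The normal bundle of a Lie foliation and its Bott connection\<close>

locale lie_fol = smooth_mfd M for M :: "'m::{t2_space,second_countable_topology} \<Rightarrow> ('m, 'e::euclidean_space) chart" +
  fixes br :: "'g::real_inner \<Rightarrow> 'g \<Rightarrow> 'g" and \<omega> :: "'m \<Rightarrow> 'e \<Rightarrow> 'g" and F :: "('m, 'e) foliation"
  assumes lie_fol: "lie_foliation M br \<omega> F"
begin

lemma form: "smooth_one_form M \<omega>" and surj_form: "surj (\<omega> p)" and fol: "foliation M F"
  and bil: "bilinear br" and alt: "br g g = 0"
  using lie_fol by (auto simp: lie_foliation_def maurer_cartan_def nonsingular_form_def lie_algebra_def)

lemma tangent: "v \<in> fol_tangent M F p \<longleftrightarrow> \<omega> p v = 0"
  using lie_fol by (simp add: lie_foliation_def)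

lemma lin_form: "linear (\<omega> p)"
  using form by (simp add: smooth_one_form_def)

lemma form_bracket_eq:
  assumes X: "smooth_vf M X" and Y: "smooth_vf M Y"
  shows "\<omega> p (vf_bracket M X Y p) =
    mdiff M (\<lambda>x. \<omega> x (Y x)) p (X p) - mdiff M (\<lambda>x. \<omega> x (X x)) p (Y p) + br (\<omega> p (X p)) (\<omega> p (Y p))"
proof -
  have "ext_deriv M \<omega> X Y p + (1/2) *\<^sub>R form_bracket br \<omega> X Y p = 0"
    using lie_fol X Y by (simp add: lie_foliation_def maurer_cartan_def)
  then show ?thesis by (simp add: ext_deriv_def form_bracket_def algebra_simps)
qed

lemma tangent_vfD: "tangent_vf M F X \<Longrightarrow> smooth_vf M X" "tangent_vf M F X \<Longrightarrow> \<omega> p (X p) = 0"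
  by (auto simp: tangent_vf_def tangent)

lemma lift:
  assumes "smooth_near g p" "\<omega> p v = g p"
  obtains Y where "smooth_vf M Y" "Y p = v" "\<forall>\<^sub>F x in nhds p. \<omega> x (Y x) = g x" "\<And>x. \<exists>s. \<omega> x (Y x) = s *\<^sub>R g x"
  by (rule lift_to_vector_field[OF form surj_form assms]) blast

lemma tangent_extension:
  assumes "v \<in> fol_tangent M F p"
  obtains X where "tangent_vf M F X" "X p = v"
proof -
  \<comment> \<open>Lifting the function 0 makes every value of the form a multiple of 0, so the
    field is tangent on the whole manifold and not only near \<open>p\<close>.\<close>
  obtain X where X: "smooth_vf M X" "X p = v" "\<And>x. \<exists>s. \<omega> x (X x) = s *\<^sub>R 0"
    using lift[OF smooth_near_const[of p 0], of v] assms tangent by blast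
  then have "tangent_vf M F X" by (auto simp: tangent_vf_def tangent)
  then show ?thesis using X(2) by (rule that)
qed

text \<open>The algebra bracket in the Maurer-Cartan equation drops out because the form kills
  \<open>X\<close>. This is the statement that the form makes the Bott connection trivial.\<close>

lemma bracket_tangent:
  assumes "tangent_vf M F X" "smooth_vf M Y"
  shows "\<omega> p (vf_bracket M X Y p) = mdiff M (\<lambda>x. \<omega> x (Y x)) p (X p)"
  using form_bracket_eq[OF tangent_vfD(1)[OF assms(1)] assms(2)] assms(1)
  by (simp add: tangent_vfD(2) bilinear_lzero[OF bil])

text \<open>The point of the normal fibre at \<open>p\<close> that corresponds to \<open>g\<close>:
  by surjectivity the form identifies this fibre with the Lie algebra, and sections become functions
  with values in it.\<close>

definition coset :: "'m \<Rightarrow> 'g \<Rightarrow> 'e set" where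
  "coset p g = {w. \<omega> p w = g}"

lemma mem_coset: "w \<in> coset p g \<longleftrightarrow> \<omega> p w = g"
  by (simp add: coset_def)

lemma coset_nonempty: "\<exists>w. w \<in> coset p g"
  using surj_form[of p] by (metis mem_coset surjD)

lemma coset_inject: "coset p g = coset p h \<longleftrightarrow> g = h"
  using coset_nonempty by (metis mem_coset)

lemma normal_class_coset: "normal_class M F p v = coset p (\<omega> p v)"
  by (auto simp: normal_class_def coset_def tangent linear_diff[OF lin_form])

lemma coset_diff_coset: "coset_diff (coset p g) (coset p h) = coset p (g - h)"
proof
  show "coset p (g - h) \<subseteq> coset_diff (coset p g) (coset p h)"
  proof
    fix w assume w: "w \<in> coset p (g - h)"
    obtain u where u: "u \<in> coset p h" using coset_nonempty by blast
    have "w + u \<in> coset p g" using w u by (simp add: mem_coset linear_add[OF lin_form])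
    then show "w \<in> coset_diff (coset p g) (coset p h)"
      unfolding coset_diff_def using u by (metis (mono_tags, lifting) add_diff_cancel_right' mem_Collect_eq)
  qed
qed (auto simp: coset_diff_def mem_coset linear_diff[OF lin_form])

lemma represents_at_coset:
  "represents_at M F (\<lambda>x. coset x (f x)) p Y \<longleftrightarrow> smooth_vf M Y \<and> (\<forall>\<^sub>F x in nhds p. \<omega> x (Y x) = f x)"
  unfolding represents_at_def normal_class_coset coset_inject by (simp add: eq_commute)

lemma normal_section_coset: "normal_section M F (\<lambda>x. coset x (f x)) \<longleftrightarrow> (\<forall>p. smooth_near f p)"
proof
  assume s: "normal_section M F (\<lambda>x. coset x (f x))"
  show "\<forall>p. smooth_near f p"
  proof
    fix p
    obtain Y where "smooth_vf M Y" "\<forall>\<^sub>F x in nhds p. \<omega> x (Y x) = f x"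
      using s unfolding normal_section_def represents_at_coset by blast
    then show "smooth_near f p" using smooth_near_cong(1)[OF smooth_near_form[OF form]] by blast
  qed
next
  assume f: "\<forall>p. smooth_near f p"
  show "normal_section M F (\<lambda>x. coset x (f x))"
    unfolding normal_section_def represents_at_coset
  proof
    fix p
    obtain v where "\<omega> p v = f p" using surj_form[of p] by (metis surjD)
    then obtain Y where "smooth_vf M Y" "\<forall>\<^sub>F x in nhds p. \<omega> x (Y x) = f x"
      by (rule lift[OF spec[OF f, of p]])
    then show "\<exists>Y. smooth_vf M Y \<and> (\<forall>\<^sub>F x in nhds p. \<omega> x (Y x) = f x)" by blast
  qed
qed

lemma normal_sectionE:
  assumes "normal_section M F s"
  obtains f where "s = (\<lambda>x. coset x (f x))" "\<And>p. smooth_near f p"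
proof -
  have "\<exists>g. s x = coset x g" for x
    using assms unfolding normal_section_def represents_at_def normal_class_coset
    by (meson eventually_nhds_x_imp_x)
  then obtain f where f: "s = (\<lambda>x. coset x (f x))" by metis
  then show ?thesis using assms normal_section_coset by (intro that[of f]) auto
qed

text \<open>Whatever representative the choice operator picks, the form takes the value
  \<open>f\<close> on it near \<open>p\<close>, and by \<open>bracket_tangent\<close> only this
  function matters.\<close>

lemma bott_coset:
  assumes X: "tangent_vf M F X" and f: "\<And>p. smooth_near f p"
  shows "bott M F X (\<lambda>x. coset x (f x)) p = coset p (mdiff M f p (X p))"
proof -
  define Y where "Y = (SOME Y. represents_at M F (\<lambda>x. coset x (f x)) p Y)"
  have "represents_at M F (\<lambda>x. coset x (f x)) p Y"
  proof -
    have "normal_section M F (\<lambda>x. coset x (f x))" using f by (simp add: normal_section_coset)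
    then have "\<exists>Y. represents_at M F (\<lambda>x. coset x (f x)) p Y" by (simp add: normal_section_def)
    then show ?thesis unfolding Y_def by (rule someI_ex)
  qed
  then have Y: "smooth_vf M Y" "\<forall>\<^sub>F x in nhds p. \<omega> x (Y x) = f x" by (auto simp: represents_at_coset)
  show ?thesis
    unfolding bott_def Y_def[symmetric] normal_class_coset bracket_tangent[OF X Y(1)]
    by (simp add: mdiff_cong[OF smooth_near_form[OF form Y(1)] Y(2)])
qed

lemma bracket_in_tangent:
  assumes "tangent_vf M F X" "tangent_vf M F Y"
  shows "vf_bracket M X Y p \<in> fol_tangent M F p"
  using bracket_tangent[OF assms(1) tangent_vfD(1)[OF assms(2)]] by (simp add: tangent tangent_vfD(2)[OF assms(2)])

lemma d_bott_coset:
  assumes a: "leafwise_form F a" and \<alpha>: "\<And>p v. v \<in> fol_tangent M F p \<Longrightarrow> \<alpha> p v = coset p (a p v)"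
    and X: "tangent_vf M F X" and Y: "tangent_vf M F Y"
  shows "d_bott M F \<alpha> X Y p = coset p (mdiff M (\<lambda>x. a x (Y x)) p (X p) - mdiff M (\<lambda>x. a x (X x)) p (Y p)
    - a p (vf_bracket M X Y p))"
proof -
  have "(\<lambda>x. \<alpha> x (Z x)) = (\<lambda>x. coset x (a x (Z x)))" if "tangent_vf M F Z" for Z
    using that \<alpha> by (auto simp: tangent_vf_def)
  moreover have "smooth_near (\<lambda>x. a x (Z x)) p" if "tangent_vf M F Z" for Z p
    using a that by (simp add: leafwise_form_def)
  ultimately show ?thesis
    unfolding d_bott_def
    using X Y bracket_in_tangent[OF X Y, of p] by (simp add: bott_coset coset_diff_coset \<alpha>)
qed

text \<open>Taking cosets is a bijection between functions with values in the algebra and sections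
  that respects smoothness and the differential, so cocycles and primitives can be moved both
  ways.\<close>

theorem infinitesimally_rigid_iff:
  "infinitesimally_rigid M F \<longleftrightarrow>
    (\<forall>a :: 'm \<Rightarrow> 'e \<Rightarrow> 'g. leafwise_form F a \<longrightarrow> leafwise_closed F a \<longrightarrow> leafwise_exact F a)"
proof
  assume rigid: "infinitesimally_rigid M F"
  show "\<forall>a :: 'm \<Rightarrow> 'e \<Rightarrow> 'g. leafwise_form F a \<longrightarrow> leafwise_closed F a \<longrightarrow> leafwise_exact F a"
  proof (intro allI impI)
    fix a :: "'m \<Rightarrow> 'e \<Rightarrow> 'g" assume a: "leafwise_form F a" and closed: "leafwise_closed F a"
    let ?\<alpha> = "\<lambda>p v. coset p (a p v)"
    have "leafwise_one_form M F ?\<alpha>"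
      unfolding leafwise_one_form_def
    proof (intro conjI allI impI ballI)
      show "coset p (a p v) \<in> range (normal_class M F p)" for p v
      proof -
        obtain w where "\<omega> p w = a p v" using coset_nonempty by (metis mem_coset)
        then have "coset p (a p v) = normal_class M F p w" by (simp add: normal_class_coset)
        then show ?thesis by blast
      qed
      show "normal_section M F (\<lambda>p. coset p (a p (X p)))" if "tangent_vf M F X" for X
        using a that by (simp add: normal_section_coset leafwise_form_def)
      fix p u v k x y
      assume "u \<in> fol_tangent M F p" "v \<in> fol_tangent M F p" "x \<in> coset p (a p u)" "y \<in> coset p (a p v)"
      then show "k *\<^sub>R x + y \<in> coset p (a p (k *\<^sub>R u + v))"
        using a by (simp add: mem_coset leafwise_form_def linear_add[OF lin_form] linear_scale[OF lin_form])
    qed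
    moreover have "closed_one_form M F ?\<alpha>"
      using closed by (simp add: closed_one_form_def leafwise_closed_def d_bott_coset[OF a] normal_class_coset
        linear_0[OF lin_form])
    ultimately obtain s where s: "normal_section M F s" "\<And>X p. tangent_vf M F X \<Longrightarrow> ?\<alpha> p (X p) = bott M F X s p"
      using rigid by (auto simp: infinitesimally_rigid_def exact_one_form_def)
    obtain f where f: "s = (\<lambda>x. coset x (f x))" "\<And>p. smooth_near f p" using normal_sectionE[OF s(1)] by blast
    have "a p (X p) = mdiff M f p (X p)" if "tangent_vf M F X" for X p
      using s(2)[OF that, of p] by (simp add: f(1) bott_coset[OF that f(2)] coset_inject)
    then show "leafwise_exact F a" using f(2) by (auto simp: leafwise_exact_def)
  qed
next
  assume *: "\<forall>a :: 'm \<Rightarrow> 'e \<Rightarrow> 'g. leafwise_form F a \<longrightarrow> leafwise_closed F a \<longrightarrow> leafwise_exact F a"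
  show "infinitesimally_rigid M F"
    unfolding infinitesimally_rigid_def
  proof (intro allI impI, elim conjE)
    fix \<alpha> assume \<alpha>: "leafwise_one_form M F \<alpha>" and closed: "closed_one_form M F \<alpha>"
    \<comment> \<open>The description is unique on tangent vectors because distinct algebra elements
      have distinct cosets; elsewhere its value is immaterial.\<close>
    define a where "a p v = (THE g. \<alpha> p v = coset p g)" for p v
    have a_eq: "\<alpha> p v = coset p (a p v)" if v: "v \<in> fol_tangent M F p" for p v
    proof -
      have "\<alpha> p v \<in> range (normal_class M F p)" using \<alpha> v unfolding leafwise_one_form_def by blast
      then obtain g where g: "\<alpha> p v = coset p g" by (auto simp: normal_class_coset)
      then have "a p v = g" unfolding a_def by (simp add: coset_inject)
      then show ?thesis using g by simp
    qed
    have fun_eq: "(\<lambda>x. \<alpha> x (X x)) = (\<lambda>x. coset x (a x (X x)))" if "tangent_vf M F X" for X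
      using that a_eq by (auto simp: tangent_vf_def)
    have a: "leafwise_form F a"
      unfolding leafwise_form_def
    proof (intro conjI allI ballI impI)
      show "smooth_near (\<lambda>x. a x (X x)) p" if "tangent_vf M F X" for X p
      proof -
        have "normal_section M F (\<lambda>p. \<alpha> p (X p))" using \<alpha> that by (simp add: leafwise_one_form_def)
        then show ?thesis by (simp add: fun_eq[OF that] normal_section_coset)
      qed
      fix p u v k assume u: "u \<in> fol_tangent M F p" and v: "v \<in> fol_tangent M F p"
      obtain x y where x: "x \<in> coset p (a p u)" and y: "y \<in> coset p (a p v)" using coset_nonempty by blast
      have kuv: "k *\<^sub>R u + v \<in> fol_tangent M F p"
        using u v by (simp add: tangent linear_add[OF lin_form] linear_scale[OF lin_form])
      have "k *\<^sub>R x + y \<in> \<alpha> p (k *\<^sub>R u + v)"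
        using \<alpha> u v x y unfolding leafwise_one_form_def by (metis a_eq)
      then show "a p (k *\<^sub>R u + v) = k *\<^sub>R a p u + a p v"
        using x y by (simp add: a_eq[OF kuv] mem_coset linear_add[OF lin_form] linear_scale[OF lin_form])
    qed
    have "leafwise_closed F a"
      using closed by (simp add: closed_one_form_def leafwise_closed_def d_bott_coset[OF a a_eq] normal_class_coset
        linear_0[OF lin_form] coset_inject)
    then obtain f where f: "\<And>p. smooth_near f p" "\<And>X p. tangent_vf M F X \<Longrightarrow> a p (X p) = mdiff M f p (X p)"
      using * a unfolding leafwise_exact_def by blast
    show "exact_one_form M F \<alpha>"
      unfolding exact_one_form_def
    proof (intro exI[of _ "\<lambda>x. coset x (f x)"] conjI allI impI)
      show "normal_section M F (\<lambda>x. coset x (f x))" using f(1) by (simp add: normal_section_coset)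
      show "\<alpha> p (X p) = bott M F X (\<lambda>x. coset x (f x)) p" if X: "tangent_vf M F X" for X p
        using fun_cong[OF fun_eq[OF X], of p] by (simp add: bott_coset[OF X f(1)] f(2)[OF X])
    qed
  qed
qed

end

section \<open>Quotients of Lie foliations\<close>

lemma lie_quotient_algebra:
  fixes br :: "'g::real_inner \<Rightarrow> 'g \<Rightarrow> 'g" and brq :: "'q::real_inner \<Rightarrow> 'q \<Rightarrow> 'q"
  assumes L: "lie_algebra br" and Q: "lie_quotient br \<hh> brq \<pi>"
  shows "lie_algebra brq"
proof -
  have \<pi>: "linear \<pi>" "surj \<pi>" and hom: "\<And>x y. brq (\<pi> x) (\<pi> y) = \<pi> (br x y)"
    using Q by (auto simp: lie_quotient_def)
  have bil: "bilinear br" and alt: "\<And>x. br x x = 0"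
    and jac: "\<And>x y z. br x (br y z) + br y (br z x) + br z (br x y) = 0"
    using L by (auto simp: lie_algebra_def)
  obtain B :: "'g set" where B: "finite B" "span B = UNIV" using L by (auto simp: lie_algebra_def)
  have rep: "\<exists>x. q = \<pi> x" for q using \<pi>(2) by (metis surjD)
  show ?thesis
    unfolding lie_algebra_def
  proof (intro conjI allI)
    show "\<exists>B::'q set. finite B \<and> span B = UNIV"
      using B \<pi> linear_span_image[OF \<pi>(1), of B] by (intro exI[of _ "\<pi> ` B"]) auto
    show "bilinear brq"
      unfolding bilinear_def
    proof (intro conjI allI linearI)
      fix x y z :: 'q and r :: real
      obtain x' y' z' where e: "x = \<pi> x'" "y = \<pi> y'" "z = \<pi> z'" using rep by metis
      show "brq x (y + z) = brq x y + brq x z" "brq (y + z) x = brq y x + brq z x"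
        "brq x (r *\<^sub>R y) = r *\<^sub>R brq x y" "brq (r *\<^sub>R y) x = r *\<^sub>R brq y x"
        unfolding e
        by (simp_all add: hom linear_add[OF \<pi>(1), symmetric] linear_scale[OF \<pi>(1), symmetric]
          bilinear_ladd[OF bil] bilinear_radd[OF bil] bilinear_lmul[OF bil] bilinear_rmul[OF bil])
    qed
    fix x y z :: 'q
    obtain x' y' z' where e: "x = \<pi> x'" "y = \<pi> y'" "z = \<pi> z'" using rep by metis
    show "brq x x = 0" unfolding e by (simp add: hom alt linear_0[OF \<pi>(1)])
    show "brq x (brq y z) + brq y (brq z x) + brq z (brq x y) = 0"
      unfolding e by (simp add: hom linear_add[OF \<pi>(1), symmetric] jac linear_0[OF \<pi>(1)])
  qed
qed

context lie_fol
begin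

lemma bounded_linear_from_algebra: "linear l \<Longrightarrow> bounded_linear l" for l :: "'g \<Rightarrow> 'b::real_normed_vector"
  using lie_fol by (auto simp: lie_foliation_def lie_algebra_def intro: bounded_linear_finite_dim)

lemma quotient_maurer_cartan:
  fixes brq :: "'q::real_inner \<Rightarrow> 'q \<Rightarrow> 'q"
  assumes Q: "lie_quotient br \<hh> brq \<pi>"
  shows "maurer_cartan M brq (\<lambda>p v. \<pi> (\<omega> p v))"
  unfolding maurer_cartan_def
proof (intro conjI allI impI)
  have \<pi>: "linear \<pi>" and hom: "\<And>x y. brq (\<pi> x) (\<pi> y) = \<pi> (br x y)"
    using Q by (auto simp: lie_quotient_def)
  note b\<pi> = bounded_linear_from_algebra[OF \<pi>]
  show "smooth_one_form M (\<lambda>p v. \<pi> (\<omega> p v))"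
    unfolding smooth_one_form_def
  proof (intro conjI allI)
    show "linear (\<lambda>v. \<pi> (\<omega> p v))" for p using linear_compose[OF lin_form \<pi>] by (simp add: comp_def)
    show "smooth_on (cimg (M q)) (\<lambda>y. let p = cinv (M q) y in \<pi> (\<omega> p (coord_vec M q v p)))" for q v
      using smooth_on_bounded_linear_comp[OF is_chartD(2)[OF chart] b\<pi> smooth_form_rep[OF form, of q v]]
      by (simp add: form_rep_def Let_def)
  qed
  fix X Y p assume X: "smooth_vf M X" and Y: "smooth_vf M Y"
  show "ext_deriv M (\<lambda>p v. \<pi> (\<omega> p v)) X Y p + (1/2) *\<^sub>R form_bracket brq (\<lambda>p v. \<pi> (\<omega> p v)) X Y p = 0"
    by (simp add: ext_deriv_def form_bracket_def hom form_bracket_eq[OF X Y] linear_add[OF \<pi>] linear_diff[OF \<pi>]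
      smooth_near_bounded_linear(2)[OF smooth_near_form[OF form X] b\<pi>]
      smooth_near_bounded_linear(2)[OF smooth_near_form[OF form Y] b\<pi>])
qed

text \<open>On vectors killed by the quotient form the bracket term of its Maurer-Cartan equation
  vanishes, which is the involutivity needed.\<close>

lemma quotient_foliation_exists:
  fixes brq :: "'q::real_inner \<Rightarrow> 'q \<Rightarrow> 'q"
  assumes Q: "lie_quotient br \<hh> brq \<pi>"
  shows "\<exists>F'. lie_foliation M brq (\<lambda>p v. \<pi> (\<omega> p v)) F'"
proof -
  let ?\<omega>' = "\<lambda>p v. \<pi> (\<omega> p v)"
  have mc: "maurer_cartan M brq ?\<omega>'" by (rule quotient_maurer_cartan[OF Q])
  have alg: "lie_algebra brq"
    by (rule lie_quotient_algebra[OF _ Q]) (use lie_fol in \<open>simp add: lie_foliation_def\<close>)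
  have surj: "surj (?\<omega>' p)" for p
    using comp_surj[OF surj_form[of p], of \<pi>] Q by (simp add: lie_quotient_def comp_def)
  have "\<exists>F'. foliation M F' \<and> (\<forall>p. fol_tangent M F' p = {v. ?\<omega>' p v = 0})"
  proof (rule involutive_kernel_foliation)
    show "smooth_one_form M ?\<omega>'" using mc by (simp add: maurer_cartan_def)
    show "surj (?\<omega>' p)" for p by (rule surj)
    fix X Y p assume "smooth_vf M X" "smooth_vf M Y" and 0: "?\<omega>' p (X p) = 0" "?\<omega>' p (Y p) = 0"
    then have "ext_deriv M ?\<omega>' X Y p + (1/2) *\<^sub>R form_bracket brq ?\<omega>' X Y p = 0"
      using mc by (simp add: maurer_cartan_def)
    then show "ext_deriv M ?\<omega>' X Y p = 0" using alg 0 by (simp add: form_bracket_def lie_algebra_def)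
  qed
  then show ?thesis using mc alg surj by (auto simp: lie_foliation_def nonsingular_form_def)
qed

end

section \<open>Density and rigidity of the quotient foliation\<close>

locale quotient_lie_fol = lie_fol M br \<omega> F + quot: lie_fol M brq "\<lambda>p v. \<pi> (\<omega> p v)" F'
  for M :: "'m::{t2_space,second_countable_topology} \<Rightarrow> ('m, 'e::euclidean_space) chart"
    and br :: "'g::real_inner \<Rightarrow> 'g \<Rightarrow> 'g" and \<omega> F
    and brq :: "'q::real_inner \<Rightarrow> 'q \<Rightarrow> 'q" and \<pi> F' +
  fixes \<hh> :: "'g set"
  assumes dense: "dense_leaves F" and ideal: "lie_ideal br \<hh>" and quotient: "lie_quotient br \<hh> brq \<pi>"
begin

lemma lin_\<pi>: "linear \<pi>" and surj_\<pi>: "surj \<pi>" and ker_\<pi>: "\<pi> g = 0 \<longleftrightarrow> g \<in> \<hh>"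
  using quotient by (auto simp: lie_quotient_def)

lemma subspace_ideal: "subspace \<hh>" and bracket_ideal: "y \<in> \<hh> \<Longrightarrow> br x y \<in> \<hh>"
  using ideal by (auto simp: lie_ideal_def)

lemma quot_tangent: "v \<in> fol_tangent M F' p \<longleftrightarrow> \<omega> p v \<in> \<hh>"
  by (simp add: quot.tangent ker_\<pi>)

lemma tangent_sub: "fol_tangent M F p \<subseteq> fol_tangent M F' p"
  by (auto simp: tangent quot.tangent linear_0[OF lin_\<pi>])

lemma tangent_vf_sub: "tangent_vf M F X \<Longrightarrow> tangent_vf M F' X"
  using tangent_sub by (auto simp: tangent_vf_def)

lemma dense_quotient: "dense_leaves F'"
  using dense closure_mono[OF leaf_mono[OF fol quot.fol tangent_sub]] by (auto simp: dense_leaves_def)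

text \<open>Since \<open>\<beta>\<close> kills the tangent vectors of \<open>F\<close>, it factors
  at each point through a linear map on \<open>\<hh>\<close>. Closedness against fields tangent to
  \<open>F\<close> makes this map constant; closedness on two transverse fields makes it vanish on
  their brackets.\<close>

lemma vanishing_on_sub:
  fixes \<beta> :: "'m \<Rightarrow> 'e \<Rightarrow> 'q"
  assumes form\<beta>: "leafwise_form F' \<beta>" and closed: "leafwise_closed F' \<beta>"
    and van: "\<And>p v. v \<in> fol_tangent M F p \<Longrightarrow> \<beta> p v = 0" and perfect: "lie_perfect br \<hh>"
    and v: "v \<in> fol_tangent M F' p"
  shows "\<beta> p v = 0"
proof -
  have lin\<beta>: "\<beta> p (k *\<^sub>R u + v) = k *\<^sub>R \<beta> p u + \<beta> p v"
    if "u \<in> fol_tangent M F' p" "v \<in> fol_tangent M F' p" for p k u v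
    using form\<beta> that by (simp add: leafwise_form_def)
  \<comment> \<open>The chosen preimage is immaterial for \<open>y\<close> in \<open>\<hh>\<close>:
    two preimages differ by a vector tangent to \<open>F\<close>.\<close>
  define b where "b x y = \<beta> x (SOME v. \<omega> x v = y)" for x y
  have b: "\<beta> x v = b x y" if y: "y \<in> \<hh>" and v: "\<omega> x v = y" for x v y
  proof -
    define w where "w = (SOME v. \<omega> x v = y)"
    have w: "\<omega> x w = y" unfolding w_def by (rule someI) (rule v)
    have "\<beta> x (1 *\<^sub>R (v - w) + w) = 1 *\<^sub>R \<beta> x (v - w) + \<beta> x w"
      by (rule lin\<beta>) (use y v w in \<open>simp_all add: quot_tangent linear_diff[OF lin_form] subspace_0[OF subspace_ideal]\<close>)
    moreover have "\<beta> x (v - w) = 0" by (rule van) (simp add: tangent linear_diff[OF lin_form] v w)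
    ultimately show ?thesis by (simp add: b_def w_def)
  qed
  \<comment> \<open>The form has constant value \<open>y\<close> near \<open>p\<close> and elsewhere
    a multiple of \<open>y\<close>, so the field is tangent to \<open>F'\<close> everywhere.\<close>
  have field: "\<exists>Y. tangent_vf M F' Y \<and> (\<forall>\<^sub>F x in nhds p. \<omega> x (Y x) = y) \<and> \<omega> p (Y p) = y" if y: "y \<in> \<hh>" for y p
  proof -
    obtain v where "\<omega> p v = y" using surj_form[of p] by (metis surjD)
    then obtain Y where Y: "smooth_vf M Y" "\<forall>\<^sub>F x in nhds p. \<omega> x (Y x) = y" "\<And>x. \<exists>s. \<omega> x (Y x) = s *\<^sub>R y"
      using lift[OF smooth_near_const[of p y]] by metis
    have "\<omega> x (Y x) \<in> \<hh>" for x using Y(3)[of x] subspace_scale[OF subspace_ideal y] by auto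
    then have "tangent_vf M F' Y" using Y(1) by (simp add: tangent_vf_def quot_tangent)
    then show ?thesis using Y(2) eventually_nhds_x_imp_x[OF Y(2)] by blast
  qed
  have near: "\<forall>\<^sub>F x in nhds p. \<beta> x (Y x) = b x y" if "y \<in> \<hh>" "\<forall>\<^sub>F x in nhds p. \<omega> x (Y x) = y" for Y y p
    using that(2) by eventually_elim (rule b[OF that(1)])
  have sm: "smooth_near (\<lambda>x. \<beta> x (Y x)) p" if "tangent_vf M F' Y" for Y p
    using form\<beta> that by (simp add: leafwise_form_def)
  have cl: "mdiff M (\<lambda>x. \<beta> x (Y x)) p (X p) - mdiff M (\<lambda>x. \<beta> x (X x)) p (Y p) = \<beta> p (vf_bracket M X Y p)"
    if "tangent_vf M F' X" "tangent_vf M F' Y" for X Y p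
  proof -
    have "mdiff M (\<lambda>x. \<beta> x (Y x)) p (X p) - mdiff M (\<lambda>x. \<beta> x (X x)) p (Y p) - \<beta> p (vf_bracket M X Y p) = 0"
      using closed that unfolding leafwise_closed_def by blast
    then show ?thesis by (simp only: right_minus_eq)
  qed
  have d\<omega>: "mdiff M (\<lambda>x. \<omega> x (Y x)) p = (\<lambda>_. 0)" if "smooth_vf M Y" "\<forall>\<^sub>F x in nhds p. \<omega> x (Y x) = y" for Y y p
    by (rule ext) (simp add: mdiff_cong[OF smooth_near_form[OF form that(1)] that(2)])
  have b_const: "b x y = b x' y" if y: "y \<in> \<hh>" for x x' y
  proof (rule leafwise_constant[OF fol dense])
    fix p
    obtain Y where Y: "tangent_vf M F' Y" "\<forall>\<^sub>F x in nhds p. \<omega> x (Y x) = y" "\<omega> p (Y p) = y"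
      using field[OF y] by blast
    show "smooth_near (\<lambda>x. b x y) p" by (rule smooth_near_cong(1)[OF sm[OF Y(1)] near[OF y Y(2)]])
    fix v assume "v \<in> fol_tangent M F p"
    then obtain X where X: "tangent_vf M F X" "X p = v" by (rule tangent_extension)
    \<comment> \<open>The form is constant on \<open>Y\<close> near \<open>p\<close>, so its value
      on the bracket is 0. Closedness then reduces to the vanishing of the derivative of
      \<open>b x y\<close> along \<open>X\<close>.\<close>
    have "vf_bracket M X Y p \<in> fol_tangent M F p"
      using bracket_tangent[OF X(1) quot.tangent_vfD(1)[OF Y(1)]] d\<omega>[OF quot.tangent_vfD(1)[OF Y(1)] Y(2)]
      by (simp add: tangent)
    moreover have "(\<lambda>x. \<beta> x (X x)) = (\<lambda>x. 0)" using van X(1) by (auto simp: tangent_vf_def)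
    ultimately have "mdiff M (\<lambda>x. \<beta> x (Y x)) p v = 0"
      using cl[OF tangent_vf_sub[OF X(1)] Y(1), of p] X(2) van by simp
    then show "mdiff M (\<lambda>x. b x y) p v = 0"
      by (simp add: mdiff_cong[OF sm[OF Y(1)] near[OF y Y(2)]])
  qed
  have b_bracket: "b p (br y y') = 0" if y: "y \<in> \<hh>" and y': "y' \<in> \<hh>" for y y'
  proof -
    obtain Y where Y: "tangent_vf M F' Y" "\<forall>\<^sub>F x in nhds p. \<omega> x (Y x) = y" "\<omega> p (Y p) = y"
      using field[OF y] by blast
    obtain Y' where Y': "tangent_vf M F' Y'" "\<forall>\<^sub>F x in nhds p. \<omega> x (Y' x) = y'" "\<omega> p (Y' p) = y'"
      using field[OF y'] by blast
    have d\<beta>: "mdiff M (\<lambda>x. \<beta> x (Z x)) p = (\<lambda>_. 0)"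
      if Z: "tangent_vf M F' Z" "\<forall>\<^sub>F x in nhds p. \<omega> x (Z x) = z" and z: "z \<in> \<hh>" for Z z
    proof -
      have "\<forall>\<^sub>F x in nhds p. \<beta> x (Z x) = b p z"
        using near[OF z Z(2)] by eventually_elim (use b_const[OF z] in metis)
      from mdiff_cong[OF sm[OF Z(1)] this] show ?thesis by auto
    qed
    \<comment> \<open>Both derivative terms vanish by local constancy, leaving only the bracket of
      the algebra. By constancy of \<open>b\<close> the same happens in the closedness of
      \<open>\<beta>\<close>.\<close>
    have "\<omega> p (vf_bracket M Y Y' p) = br y y'"
      using form_bracket_eq[OF quot.tangent_vfD(1)[OF Y(1)] quot.tangent_vfD(1)[OF Y'(1)]]
        d\<omega>[OF quot.tangent_vfD(1)[OF Y(1)] Y(2)] d\<omega>[OF quot.tangent_vfD(1)[OF Y'(1)] Y'(2)] Y(3) Y'(3)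
      by simp
    then have "b p (br y y') = \<beta> p (vf_bracket M Y Y' p)" using b[OF bracket_ideal[OF y']] by metis
    also have "\<dots> = 0" using cl[OF Y(1) Y'(1), of p] d\<beta>[OF Y(1,2) y] d\<beta>[OF Y'(1,2) y'] by simp
    finally show ?thesis .
  qed
  have lin_b: "b p (k *\<^sub>R y + y') = k *\<^sub>R b p y + b p y'" if y: "y \<in> \<hh>" and y': "y' \<in> \<hh>" for k y y'
  proof -
    obtain u u' where u: "\<omega> p u = y" "\<omega> p u' = y'" using surj_form[of p] by (metis surjD)
    have "k *\<^sub>R y + y' \<in> \<hh>" by (intro subspace_add subspace_scale subspace_ideal y y')
    then have "b p (k *\<^sub>R y + y') = \<beta> p (k *\<^sub>R u + u')"
      using b[of "k *\<^sub>R y + y'" p "k *\<^sub>R u + u'"] u by (simp add: linear_add[OF lin_form] linear_scale[OF lin_form])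
    also have "\<dots> = k *\<^sub>R \<beta> p u + \<beta> p u'" by (rule lin\<beta>) (use u y y' in \<open>simp_all add: quot_tangent\<close>)
    finally show ?thesis using b[OF y u(1)] b[OF y' u(2)] by simp
  qed
  \<comment> \<open>A subspace of \<open>\<hh>\<close> that contains all brackets is all of
    \<open>\<hh>\<close>, by perfectness.\<close>
  have "subspace {y \<in> \<hh>. b p y = 0}"
    unfolding subspace_def
  proof (intro conjI ballI allI)
    have "b p (1 *\<^sub>R 0 + 0) = 1 *\<^sub>R b p 0 + b p 0" by (rule lin_b) (auto intro: subspace_0 subspace_ideal)
    then have b0: "b p 0 = 0" by simp
    then show "0 \<in> {y \<in> \<hh>. b p y = 0}" by (simp add: subspace_0 subspace_ideal)
    show "x + y \<in> {y \<in> \<hh>. b p y = 0}" if "x \<in> {y \<in> \<hh>. b p y = 0}" "y \<in> {y \<in> \<hh>. b p y = 0}" for x y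
      using that lin_b[of x y 1] by (simp add: subspace_add[OF subspace_ideal])
    show "c *\<^sub>R x \<in> {y \<in> \<hh>. b p y = 0}" if "x \<in> {y \<in> \<hh>. b p y = 0}" for c x
      using that lin_b[of x 0 c] b0 by (simp add: subspace_scale[OF subspace_ideal] subspace_0[OF subspace_ideal])
  qed
  then have "span {br x y | x y. x \<in> \<hh> \<and> y \<in> \<hh>} \<subseteq> {y \<in> \<hh>. b p y = 0}"
    by (rule span_minimal[rotated]) (auto simp: b_bracket bracket_ideal)
  then have "\<hh> \<subseteq> {y \<in> \<hh>. b p y = 0}" using perfect by (simp add: lie_perfect_def)
  then show ?thesis using b[of "\<omega> p v" p v] v by (auto simp: quot_tangent)
qed

theorem rigid_quotient:
  assumes rigid: "infinitesimally_rigid M F" and perfect: "lie_perfect br \<hh>"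
  shows "infinitesimally_rigid M F'"
  unfolding quot.infinitesimally_rigid_iff
proof (intro allI impI)
  fix a :: "'m \<Rightarrow> 'e \<Rightarrow> 'q" assume a: "leafwise_form F' a" and closed: "leafwise_closed F' a"
  \<comment> \<open>Rigidity of \<open>F\<close> concerns forms with values in \<open>'g\<close>, so
    \<open>a\<close> is lifted by a linear section of \<open>\<pi>\<close> and the primitive is
    projected back.\<close>
  obtain \<sigma> where \<sigma>: "linear \<sigma>" "\<And>q. \<pi> (\<sigma> q) = q"
    using linear_surj_right_inverse[OF lin_\<pi>, of UNIV UNIV] surj_\<pi> by auto
  note b\<pi> = bounded_linear_from_algebra[OF lin_\<pi>] and b\<sigma> = quot.bounded_linear_from_algebra[OF \<sigma>(1)]
  have sm: "smooth_near (\<lambda>x. a x (X x)) p" if "tangent_vf M F' X" for X p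
    using a that by (simp add: leafwise_form_def)
  have "leafwise_form F (\<lambda>p v. \<sigma> (a p v))"
    unfolding leafwise_form_def
  proof (intro conjI allI ballI impI)
    show "\<sigma> (a p (k *\<^sub>R u + v)) = k *\<^sub>R \<sigma> (a p u) + \<sigma> (a p v)"
      if "u \<in> fol_tangent M F p" "v \<in> fol_tangent M F p" for p u v k
      using a that tangent_sub by (simp add: leafwise_form_def subset_iff linear_add[OF \<sigma>(1)] linear_scale[OF \<sigma>(1)])
    show "smooth_near (\<lambda>x. \<sigma> (a x (X x))) p" if "tangent_vf M F X" for X p
      by (rule smooth_near_bounded_linear(1)[OF sm[OF tangent_vf_sub[OF that]] b\<sigma>])
  qed
  moreover have "leafwise_closed F (\<lambda>p v. \<sigma> (a p v))"
    unfolding leafwise_closed_def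
  proof (intro allI impI)
    fix X Y p assume X: "tangent_vf M F X" and Y: "tangent_vf M F Y"
    have "mdiff M (\<lambda>x. a x (Y x)) p (X p) - mdiff M (\<lambda>x. a x (X x)) p (Y p) - a p (vf_bracket M X Y p) = 0"
      using closed tangent_vf_sub[OF X] tangent_vf_sub[OF Y] by (simp add: leafwise_closed_def)
    then show "mdiff M (\<lambda>x. \<sigma> (a x (Y x))) p (X p) - mdiff M (\<lambda>x. \<sigma> (a x (X x))) p (Y p) - \<sigma> (a p (vf_bracket M X Y p)) = 0"
      by (simp add: smooth_near_bounded_linear(2)[OF sm[OF tangent_vf_sub[OF X]] b\<sigma>]
        smooth_near_bounded_linear(2)[OF sm[OF tangent_vf_sub[OF Y]] b\<sigma>] linear_0[OF \<sigma>(1)] flip: linear_diff[OF \<sigma>(1)])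
  qed
  ultimately have "leafwise_exact F (\<lambda>p v. \<sigma> (a p v))" using rigid unfolding infinitesimally_rigid_iff by blast
  then obtain h where h: "\<And>p. smooth_near h p" "\<And>X p. tangent_vf M F X \<Longrightarrow> \<sigma> (a p (X p)) = mdiff M h p (X p)"
    unfolding leafwise_exact_def by blast
  define f where "f x = \<pi> (h x)" for x
  have f: "smooth_near f p" for p unfolding f_def by (rule smooth_near_bounded_linear(1)[OF h(1) b\<pi>])
  have df: "a p (X p) = mdiff M f p (X p)" if "tangent_vf M F X" for X p
    unfolding f_def smooth_near_bounded_linear(2)[OF h(1) b\<pi>] h(2)[OF that, symmetric] \<sigma>(2) ..
  \<comment> \<open>Subtracting an exact form keeps \<open>\<beta>\<close> closed along
    \<open>F'\<close> and makes it vanish along \<open>F\<close>; once it vanishes along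
    \<open>F'\<close> as well, \<open>f\<close> is the required primitive.\<close>
  define \<beta> where "\<beta> p v = a p v - mdiff M f p v" for p v
  have smf: "smooth_near (\<lambda>x. mdiff M f x (X x)) p" if "tangent_vf M F' X" for X p
    by (rule smooth_near_mdiff(1)[OF f quot.tangent_vfD(1)[OF that]])
  have form\<beta>: "leafwise_form F' \<beta>"
    unfolding leafwise_form_def \<beta>_def
  proof (intro conjI allI ballI impI)
    show "a p (k *\<^sub>R u + v) - mdiff M f p (k *\<^sub>R u + v) = k *\<^sub>R (a p u - mdiff M f p u) + (a p v - mdiff M f p v)"
      if "u \<in> fol_tangent M F' p" "v \<in> fol_tangent M F' p" for p u v k
      using a that by (simp add: leafwise_form_def linear_add[OF linear_mdiff[OF f]] linear_scale[OF linear_mdiff[OF f]]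
        algebra_simps)
    show "smooth_near (\<lambda>x. a x (X x) - mdiff M f x (X x)) p" if "tangent_vf M F' X" for X p
      by (rule smooth_near_diff(1)[OF sm[OF that] smf[OF that]])
  qed
  have closed\<beta>: "leafwise_closed F' \<beta>"
    unfolding leafwise_closed_def
  proof (intro allI impI)
    fix X Y p assume X: "tangent_vf M F' X" and Y: "tangent_vf M F' Y"
    have "mdiff M (\<lambda>x. a x (Y x)) p (X p) - mdiff M (\<lambda>x. a x (X x)) p (Y p) - a p (vf_bracket M X Y p) = 0"
      using closed X Y by (simp add: leafwise_closed_def)
    then show "mdiff M (\<lambda>x. \<beta> x (Y x)) p (X p) - mdiff M (\<lambda>x. \<beta> x (X x)) p (Y p) - \<beta> p (vf_bracket M X Y p) = 0"
      unfolding \<beta>_def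
      by (simp add: smooth_near_diff(2)[OF sm[OF X] smf[OF X]] smooth_near_diff(2)[OF sm[OF Y] smf[OF Y]]
        mdiff_bracket[OF f quot.tangent_vfD(1)[OF X] quot.tangent_vfD(1)[OF Y]])
  qed
  have van: "\<beta> p v = 0" if v: "v \<in> fol_tangent M F p" for p v
  proof -
    obtain X where "tangent_vf M F X" "X p = v" using tangent_extension[OF v] by blast
    then show ?thesis using df[of X p] by (simp add: \<beta>_def)
  qed
  have "a p (X p) = mdiff M f p (X p)" if X: "tangent_vf M F' X" for X p
  proof -
    have "\<beta> p (X p) = 0"
      by (rule vanishing_on_sub[OF form\<beta> closed\<beta> van perfect]) (use X in \<open>simp_all add: tangent_vf_def\<close>)
    then show ?thesis by (simp add: \<beta>_def)
  qed
  then show "leafwise_exact F' a" unfolding leafwise_exact_def using f by blast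
qed

end

theorem theoremB:
  fixes M :: "'m::{t2_space,second_countable_topology} \<Rightarrow> ('m, 'e::euclidean_space) chart"
    and br :: "'g::real_inner \<Rightarrow> 'g \<Rightarrow> 'g"
    and brq :: "'q::real_inner \<Rightarrow> 'q \<Rightarrow> 'q"
    and \<omega> :: "'m \<Rightarrow> 'e \<Rightarrow> 'g"
    and F :: "('m, 'e) foliation"
    and \<hh> :: "'g set"
    and \<pi> :: "'g \<Rightarrow> 'q"
  assumes "smooth_manifold M"
    and "lie_foliation M br \<omega> F"
    and "dense_leaves F"
    and "lie_ideal br \<hh>"
    and "lie_quotient br \<hh> brq \<pi>"
  shows "(\<exists>F'. lie_foliation M brq (\<lambda>p v. \<pi> (\<omega> p v)) F') \<and>
         (\<forall>F'. lie_foliation M brq (\<lambda>p v. \<pi> (\<omega> p v)) F' \<longrightarrow>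
            dense_leaves F' \<and>
            (infinitesimally_rigid M F \<and> lie_perfect br \<hh> \<longrightarrow> infinitesimally_rigid M F'))"
proof (intro conjI allI impI)
  interpret lie_fol M br \<omega> F
    by (intro lie_fol.intro smooth_mfd.intro lie_fol_axioms.intro assms)
  show "\<exists>F'. lie_foliation M brq (\<lambda>p v. \<pi> (\<omega> p v)) F'"
    by (rule quotient_foliation_exists[OF assms(5)])
  fix F' assume F': "lie_foliation M brq (\<lambda>p v. \<pi> (\<omega> p v)) F'"
  interpret quotient_lie_fol M br \<omega> F brq \<pi> F' \<hh>
    by (intro quotient_lie_fol.intro lie_fol.intro smooth_mfd.intro lie_fol_axioms.intro
      quotient_lie_fol_axioms.intro assms F')
  show "dense_leaves F'" by (rule dense_quotient)
  show "infinitesimally_rigid M F'" if "infinitesimally_rigid M F \<and> lie_perfect br \<hh>"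
    using that rigid_quotient by blast
qed

end
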